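(* Let $X$ be a locally convex space over $\mathbb K$ belonging to the class $\mathfrak M$. Then for any $k\in\mathbb N$ there exists a hereditarily hypercyclic (and therefore mixing) uniformly continuous operator group $\{T_t\}_{t\in\mathbb K^k}$ on $X$. Moreover, if $\mathbb K=\mathbb C$, the group can be taken so that the map $z\mapsto T_zx$ from $\mathbb C^k$ to $X$ is holomorphic for each $x\in X$.
   Context: Conventions: $\mathbb K$ is $\mathbb R$ or $\mathbb C$; all vector spaces are non-zero and over $\mathbb K$; all topological spaces are Hausdorff; $\mathbb N=\{1,2,\dots\}$, $\mathbb Z_+=\{0,1,2,\dots\}$. $L(X)$ is the space of continuous linear operators on $X$. The topology of a locally convex space $X$ is called weak if it coincides with $\sigma(X,Y)$ (the weakest topology making all functionals in $Y$ continuous) for some linear space $Y$ of linear functionals on $X$ separating points of $X$. A sequence $\{x_n\}_{n\in\mathbb Z_+}$ in a topological vector space $X$ is an $\ell_1$-sequence if $x_n\to0$ in $X$ and $\sum_{n=0}^\infty a_nx_n$ converges in $X$ for each $a\in\ell_1$. A locally convex space $X$ belongs to the class $\mathfrak M$ if its topology is not weak and there exists an $\ell_1$-sequence in $X$ with dense linear span. An operator group $\{T_t\}_{t\in\mathbb K^k}$ on $X$ is a family of elements of $L(X)$ with $T_0=I$ and $T_{s+t}=T_tT_s$ for all $s,t\in\mathbb K^k$; $|t|$ is the Euclidean norm of $t$. It is uniformly continuous if there is a neighborhood $U$ of zero in $X$ such that for any sequence $t_n\to t$ in $\mathbb K^k$, $T_{t_n}x$ converges to $T_tx$ uniformly for $x\in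 U$. It is hereditarily hypercyclic if for any sequence $\{t_n\}_{n\in\mathbb Z_+}$ in $\mathbb K^k$ with $|t_n|\to\infty$ there is $x\in X$ such that $\{T_{t_n}x:n\in\mathbb Z_+\}$ is dense in $X$. It is mixing if for any non-empty open $U,V\subseteq X$ there is $r>0$ such that $T_t(U)\cap V\neq\varnothing$ whenever $|t|>r$. *)

theory Defs
  imports "HOL-Analysis.Analysis"
begin

text \<open>
  The scalar field is a type variable \<open>'k\<close> (used at \<open>real\<close> and \<open>complex\<close>), the space is a type
  carrying an additive group structure and a Hausdorff topology, and scalar multiplication is an
  explicit parameter, since the library has no type class of complex vector spaces.
\<close>

locale topological_vector_space = vector_space smul
  for smul :: "'k::real_normed_field \<Rightarrow> 'x::{t2_space, topological_ab_group_add} \<Rightarrow> 'x" +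
  assumes continuous_scale: "continuous_on UNIV (\<lambda>(c, x). smul c x)"
    and nonzero: "\<exists>x::'x. x \<noteq> 0"

definition convex_set :: "('k::real_normed_field \<Rightarrow> 'x::ab_group_add \<Rightarrow> 'x) \<Rightarrow> 'x set \<Rightarrow> bool" where
  "convex_set smul V \<longleftrightarrow>
    (\<forall>x\<in>V. \<forall>y\<in>V. \<forall>u\<ge>0. \<forall>v\<ge>0. u + v = 1 \<longrightarrow> smul (of_real u) x + smul (of_real v) y \<in> V)"

locale locally_convex_space = topological_vector_space +
  assumes convex_base: "open U \<Longrightarrow> 0 \<in> U \<Longrightarrow> \<exists>V. open V \<and> 0 \<in> V \<and> V \<subseteq> U \<and> convex_set smul V"

text \<open>The topology is \<open>\<sigma>(X, Y)\<close> for some point-separating linear space \<open>Y\<close> of linear functionals.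
  The functionals in \<open>Y\<close> are not required to be continuous beforehand.\<close>

definition weak_topology ::
    "('k::real_normed_field \<Rightarrow> 'x::{ab_group_add, topological_space} \<Rightarrow> 'x) \<Rightarrow> bool" where
  "weak_topology smul \<longleftrightarrow>
    (\<exists>Y :: ('x \<Rightarrow> 'k) set.
      (\<forall>f\<in>Y. Vector_Spaces.linear smul (*) f) \<and>
      (\<lambda>x. 0) \<in> Y \<and>
      (\<forall>f\<in>Y. \<forall>g\<in>Y. (\<lambda>x. f x + g x) \<in> Y) \<and>
      (\<forall>c. \<forall>f\<in>Y. (\<lambda>x. c * f x) \<in> Y) \<and>
      (\<forall>x y. x \<noteq> y \<longrightarrow> (\<exists>f\<in>Y. f x \<noteq> f y)) \<and>
      (\<forall>S :: 'x set. open S \<longleftrightarrow> generate_topology {f -` U | f U. f \<in> Y \<and> open U} S))"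

definition ell1_sequence ::
    "('k::real_normed_field \<Rightarrow> 'x::{ab_group_add, topological_space} \<Rightarrow> 'x) \<Rightarrow> (nat \<Rightarrow> 'x) \<Rightarrow> bool" where
  "ell1_sequence smul x \<longleftrightarrow>
    x \<longlonglongrightarrow> 0 \<and>
    (\<forall>a :: nat \<Rightarrow> 'k. summable (\<lambda>n. norm (a n)) \<longrightarrow> summable (\<lambda>n. smul (a n) (x n)))"

definition class_M ::
    "('k::real_normed_field \<Rightarrow> 'x::{t2_space, topological_ab_group_add} \<Rightarrow> 'x) \<Rightarrow> bool" where
  "class_M smul \<longleftrightarrow>
    locally_convex_space smul \<and> \<not> weak_topology smul \<and>
    (\<exists>x. ell1_sequence smul x \<and> closure (module.span smul (range x)) = UNIV)"

definition operator_group ::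
    "('k::real_normed_field \<Rightarrow> 'x::{ab_group_add, topological_space} \<Rightarrow> 'x) \<Rightarrow>
      ('k ^ 'n \<Rightarrow> 'x \<Rightarrow> 'x) \<Rightarrow> bool" where
  "operator_group smul T \<longleftrightarrow>
    (\<forall>t. Vector_Spaces.linear smul smul (T t) \<and> continuous_on UNIV (T t)) \<and>
    T 0 = id \<and> (\<forall>s t. T (s + t) = T t \<circ> T s)"

text \<open>Uniform convergence is with respect to the translation-invariant uniformity of \<open>X\<close>.\<close>

definition uniformly_continuous_group ::
    "('k::real_normed_field ^ 'n \<Rightarrow> 'x::{ab_group_add, topological_space} \<Rightarrow> 'x) \<Rightarrow> bool" where
  "uniformly_continuous_group T \<longleftrightarrow>
    (\<exists>U. 0 \<in> interior U \<and>
      (\<forall>t l. t \<longlonglongrightarrow> l \<longrightarrow>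
        (\<forall>V. open V \<and> 0 \<in> V \<longrightarrow> (\<forall>\<^sub>F n in sequentially. \<forall>x\<in>U. T (t n) x - T l x \<in> V))))"

definition hereditarily_hypercyclic ::
    "('k::real_normed_field ^ 'n \<Rightarrow> 'x::topological_space \<Rightarrow> 'x) \<Rightarrow> bool" where
  "hereditarily_hypercyclic T \<longleftrightarrow>
    (\<forall>t. filterlim (\<lambda>n. norm (t n)) at_top sequentially \<longrightarrow>
      (\<exists>x. closure (range (\<lambda>n::nat. T (t n) x)) = UNIV))"

definition mixing_group ::
    "('k::real_normed_field ^ 'n \<Rightarrow> 'x::topological_space \<Rightarrow> 'x) \<Rightarrow> bool" where
  "mixing_group T \<longleftrightarrow>
    (\<forall>U V. open U \<and> U \<noteq> {} \<and> open V \<and> V \<noteq> {} \<longrightarrow>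
      (\<exists>r>0. \<forall>t. norm t > r \<longrightarrow> T t ` U \<inter> V \<noteq> {}))"

text \<open>Holomorphy of an \<open>X\<close>-valued map on \<open>\<complex>\<^sup>k\<close>: (total) complex differentiability at every point, the
  limit being taken in the topology of \<open>X\<close> and the derivative having values in \<open>X\<close> itself rather
  than in its completion.\<close>

definition entire_map ::
    "(complex \<Rightarrow> 'x::{ab_group_add, topological_space} \<Rightarrow> 'x) \<Rightarrow> (complex ^ 'n \<Rightarrow> 'x) \<Rightarrow> bool" where
  "entire_map smul f \<longleftrightarrow>
    (\<forall>z. \<exists>L. Vector_Spaces.linear vector_scalar_mult smul L \<and>
      ((\<lambda>h. smul (inverse (of_real (norm h))) (f (z + h) - f z - L h)) \<longlongrightarrow> 0) (at 0))"

end

theory Submission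
  imports Defs "HOL-Computational_Algebra.Polynomial"
begin

text \<open>
  Since the topology of \<open>X\<close> is not weak, some continuous seminorm \<open>p\<close> has a kernel of infinite
  codimension. A Gram--Schmidt argument inside the Banach disc generated by the \<open>\<ell>\<^sub>1\<close>-sequence
  then gives vectors \<open>u\<^sub>n\<close> with dense span, indexed by the multi-indices \<open>n\<close>, and a biorthogonal
  family of functionals bounded by multiples of \<open>p\<close>. Identify \<open>u\<^sub>n\<close> with the monomial \<open>z\<^sup>n\<close> in \<open>k\<close>
  variables. If the \<open>u\<^sub>n\<close> are scaled to grow fast enough, the translation \<open>f \<mapsto> f(\<cdot> + t)\<close> of polynomials
  extends to \<open>X\<close> as the identity plus an absolutely convergent series of rank one operators, which
  depends holomorphically on \<open>t\<close>.

  The translations are mixing on polynomials: if \<open>t\<^sub>j\<close> is the largest coordinate of \<open>t\<close> and \<open>N\<close> exceeds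
  the degree of \<open>n\<close>, then \<open>(z - t)\<^sup>n (z\<^sub>j / t\<^sub>j)\<^sup>N\<close> tends to \<open>0\<close> as \<open>|t| \<rightarrow> \<infinity>\<close> while its
  translate \<open>z\<^sup>n (1 + z\<^sub>j / t\<^sub>j)\<^sup>N\<close> tends to \<open>z\<^sup>n\<close>; the opposite direction follows from \<open>T\<^sub>-\<^sub>t\<close>.
  Because these limits hold in the Banach disc, a hypercyclic vector is obtained as the sum of a
  rapidly convergent series, although \<open>X\<close> itself need not be a Baire space.
\<close>

section \<open>Hahn--Banach extension\<close>

text \<open>X need not be complete or metrizable, so limits cannot simply be taken in X: series are
  summed through their coefficients in ell_1, which is complete, and estimates are made in the balls
  of the disc. One seminorm \<open>p\<close> has to dominate the whole biorthogonal family, because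
  then the single neighbourhood where \<open>p x \<le> 1\<close> serves all parameters in uniform
  continuity. This is where non-weakness enters: if the kernel of \<open>p\<close> had finite
  codimension, the functionals bounded by multiples of \<open>p\<close> would form a finite
  dimensional space. The growth of the vectors serves the terms that send \<open>u n\<close> to
  multiples of \<open>u m\<close> with \<open>m < n\<close>: enlarging \<open>u n\<close> shrinks
  its dual functional and with it the whole row. Polynomials in k variables are used because their
  translations are a commuting family indexed by the k-dimensional scalar space, and the group law
  is the binomial theorem, checked on monomials and carried over by density.\<close>

definition seminorm ::
    "('k::real_normed_field \<Rightarrow> 'x::ab_group_add \<Rightarrow> 'x) \<Rightarrow> ('x \<Rightarrow> real) \<Rightarrow> bool" where
  "seminorm smul p \<longleftrightarrow>
    (\<forall>x y. p (x + y) \<le> p x + p y) \<and> (\<forall>c x. p (smul c x) = norm c * p x)"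

definition sublinear :: "(real \<Rightarrow> 'x::ab_group_add \<Rightarrow> 'x) \<Rightarrow> ('x \<Rightarrow> real) \<Rightarrow> bool" where
  "sublinear smul p \<longleftrightarrow>
    (\<forall>x y. p (x + y) \<le> p x + p y) \<and> (\<forall>c\<ge>0. \<forall>x. p (smul c x) = c * p x)"

context
  fixes smul :: "real \<Rightarrow> 'x::ab_group_add \<Rightarrow> 'x"
  assumes vs: "vector_space smul"
begin

interpretation vector_space smul by (fact vs)

lemma sublinear_add: "sublinear smul p \<Longrightarrow> p (x + y) \<le> p x + p y"
  by (simp add: sublinear_def)

lemma sublinear_scale: "sublinear smul p \<Longrightarrow> 0 \<le> c \<Longrightarrow> p (smul c x) = c * p x"
  by (simp add: sublinear_def)

lemma sublinear_zero: "sublinear smul p \<Longrightarrow> p 0 = 0"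
  using sublinear_scale[of p 0 0] by simp

lemma sublinear_minus_le: "sublinear smul p \<Longrightarrow> - p (- x) \<le> p x"
  using sublinear_add[of p x "- x"] sublinear_zero[of p] by simp

lemma sublinearI:
  assumes add: "\<And>x y. p (x + y) \<le> p x + p y" and zero: "p 0 = 0"
    and scale: "\<And>c x. c > 0 \<Longrightarrow> p (smul c x) \<le> c * p x"
  shows "sublinear smul p"
  unfolding sublinear_def
proof (intro conjI allI impI)
  show "p (x + y) \<le> p x + p y" for x y by (fact add)
  fix c :: real and x assume "0 \<le> c"
  show "p (smul c x) = c * p x"
  proof (cases "c = 0")
    case True then show ?thesis by (simp add: zero)
  next
    case False
    with \<open>0 \<le> c\<close> have c: "c > 0" by simp
    have "p (smul (inverse c) (smul c x)) \<le> inverse c * p (smul c x)"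
      using c by (intro scale) simp
    then have "p x \<le> inverse c * p (smul c x)" using c by simp
    then have "c * p x \<le> p (smul c x)" using c by (simp add: field_simps)
    with scale[OF c, of x] show ?thesis by simp
  qed
qed

text \<open>Lowers \<open>p\<close> along the ray of \<open>y\<close>. It is used twice: started
  from \<open>p\<close> it forces \<open>q (- y) \<le> - p y\<close>, hence equality at
  \<open>y\<close>; applied to a minimal sublinear functional, which cannot be lowered, it yields
  superadditivity and so linearity.\<close>

lemma sublinear_descend:
  assumes p: "sublinear smul p"
  shows "\<exists>q. sublinear smul q \<and> (\<forall>x. q x \<le> p x) \<and> (\<forall>x. q x \<le> p (x + y) - p y)"
proof -
  define S where "S x = (\<lambda>t. p (x + smul t y) - t * p y) ` {0..}" for x
  define q where "q x = Inf (S x)" for x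
  have lb: "- p (- x) \<le> s" if sx: "s \<in> S x" for s x
  proof -
    obtain t where t: "t \<in> {0..}" "s = p (x + smul t y) - t * p y" using sx unfolding S_def by blast
    have "t * p y = p (smul t y)" using p t(1) by (simp add: sublinear_scale)
    also have "\<dots> = p ((x + smul t y) + - x)" by simp
    also have "\<dots> \<le> p (x + smul t y) + p (- x)" by (rule sublinear_add[OF p])
    finally show ?thesis using t(2) by simp
  qed
  have bdd: "bdd_below (S x)" for x
    using lb by (intro bdd_belowI[of _ "- p (- x)"]) auto
  have ne: "S x \<noteq> {}" for x by (auto simp: S_def)
  have le: "q x \<le> p (x + smul t y) - t * p y" if "t \<ge> 0" for x t
    unfolding q_def by (rule cInf_lower[OF _ bdd]) (use that in \<open>auto simp: S_def\<close>)
  have ge: "c \<le> q x" if "\<And>t. t \<ge> 0 \<Longrightarrow> c \<le> p (x + smul t y) - t * p y" for c x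
    unfolding q_def by (rule cInf_greatest[OF ne]) (use that in \<open>auto simp: S_def\<close>)
  have "sublinear smul q"
  proof (rule sublinearI)
    fix x x'
    have *: "q (x + x') - (p (x' + smul t' y) - t' * p y) \<le> p (x + smul t y) - t * p y"
      if "t \<ge> 0" "t' \<ge> 0" for t t'
    proof -
      have "q (x + x') \<le> p ((x + x') + smul (t + t') y) - (t + t') * p y"
        using that by (intro le) simp
      also have "(x + x') + smul (t + t') y = (x + smul t y) + (x' + smul t' y)"
        by (simp add: scale_left_distrib)
      also have "p \<dots> \<le> p (x + smul t y) + p (x' + smul t' y)" by (rule sublinear_add[OF p])
      finally show ?thesis by (simp add: algebra_simps)
    qed
    have "q (x + x') - q x \<le> p (x' + smul t' y) - t' * p y" if "t' \<ge> 0" for t'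
      using ge[of "q (x + x') - (p (x' + smul t' y) - t' * p y)" x, OF *] that by simp
    from ge[of "q (x + x') - q x" x', OF this] show "q (x + x') \<le> q x + q x'" by simp
  next
    show "q 0 = 0"
      using le[of 0 0] ge[of 0 0] by (simp add: sublinear_scale[OF p] sublinear_zero[OF p])
  next
    fix c :: real and x assume c: "c > 0"
    have "inverse c * q (smul c x) \<le> p (x + smul t y) - t * p y" if "t \<ge> 0" for t
    proof -
      have "q (smul c x) \<le> p (smul c x + smul (c * t) y) - (c * t) * p y"
        using that c by (intro le) simp
      also have "smul c x + smul (c * t) y = smul c (x + smul t y)"
        by (simp add: scale_right_distrib)
      also have "p \<dots> = c * p (x + smul t y)" using c by (intro sublinear_scale[OF p]) simp
      finally show ?thesis using c by (simp add: field_simps)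
    qed
    from ge[of "inverse c * q (smul c x)" x, OF this] show "q (smul c x) \<le> c * q x"
      using c by (simp add: field_simps)
  qed
  moreover have "q x \<le> p x" for x using le[of 0 x] by simp
  moreover have "q x \<le> p (x + y) - p y" for x using le[of 1 x] by simp
  ultimately show ?thesis by blast
qed

text \<open>Zorn's lemma downwards in the pointwise order. Infima along a chain stay finite because
  every member is bounded below by \<open>- p (- x)\<close>.\<close>

lemma minimal_sublinear:
  assumes p: "sublinear smul p"
  shows "\<exists>q. sublinear smul q \<and> (\<forall>x. q x \<le> p x) \<and>
    (\<forall>r. sublinear smul r \<longrightarrow> (\<forall>x. r x \<le> q x) \<longrightarrow> r = q)"
proof -
  define A where "A = {q. sublinear smul q \<and> (\<forall>x. q x \<le> p x)}"
  define P where "P = (\<lambda>(q::'x \<Rightarrow> real) r. \<forall>x. r x \<le> q x)"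
  have "\<exists>m\<in>A. \<forall>a\<in>A. P m a \<longrightarrow> a = m"
  proof (rule predicate_Zorn)
    have "trans (relation_of P A)"
      by (rule transI) (auto simp: relation_of_def P_def intro: order_trans)
    moreover have "antisym (relation_of P A)"
      by (rule antisymI) (simp add: relation_of_def P_def fun_eq_iff eq_iff)
    ultimately show "partial_order_on A (relation_of P A)"
      by (auto simp: partial_order_on_def preorder_on_def refl_on_def relation_of_def P_def)
  next
    fix C assume C: "C \<in> Chains (relation_of P A)"
    have CA: "C \<subseteq> A" using C by (auto simp: Chains_def relation_of_def)
    have tot: "(\<forall>x. r x \<le> q x) \<or> (\<forall>x. q x \<le> r x)" if "q \<in> C" "r \<in> C" for q r
      using C that by (auto simp: Chains_def relation_of_def P_def)
    show "\<exists>u\<in>A. \<forall>a\<in>C. P a u"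
    proof (cases "C = {}")
      case True then show ?thesis using p by (auto simp: A_def)
    next
      case False
      define u where "u x = Inf ((\<lambda>q. q x) ` C)" for x
      have sub: "sublinear smul q" if "q \<in> C" for q using CA that by (auto simp: A_def)
      have lb: "- p (- x) \<le> q x" if "q \<in> C" for q x
      proof -
        have "q (- x) \<le> p (- x)" using CA that by (auto simp: A_def)
        then show ?thesis using sublinear_minus_le[OF sub[OF that], of x] by simp
      qed
      have bdd: "bdd_below ((\<lambda>q. q x) ` C)" for x
    using lb by (intro bdd_belowI[of _ "- p (- x)"]) auto
      have le: "u x \<le> q x" if "q \<in> C" for q x
        unfolding u_def by (rule cInf_lower[OF _ bdd]) (use that in auto)
      have ge: "c \<le> u x" if "\<And>q. q \<in> C \<Longrightarrow> c \<le> q x" for c x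
        unfolding u_def by (rule cInf_greatest) (use that False in auto)
      have "sublinear smul u"
      proof (rule sublinearI)
        fix x y
        have *: "u (x + y) - r y \<le> q x" if qr: "q \<in> C" "r \<in> C" for q r
        proof -
          \<comment> \<open>The smaller of two members of the chain serves both \<open>x\<close> and
            \<open>y\<close>, so the infimum inherits subadditivity.\<close>
          obtain m where m: "m \<in> C" "m x \<le> q x" "m y \<le> r y" using tot[OF qr] qr by blast
          have "u (x + y) \<le> m x + m y"
            using le[OF m(1), of "x + y"] sublinear_add[OF sub[OF m(1)], of x y] by simp
          with m show ?thesis by simp
        qed
        have "u (x + y) - u x \<le> r y" if "r \<in> C" for r
        proof -
          have "u (x + y) - r y \<le> u x" by (rule ge) (rule *[OF _ that])
          then show ?thesis by simp
        qed
        then have "u (x + y) - u x \<le> u y" by (rule ge)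
        then show "u (x + y) \<le> u x + u y" by simp
      next
        obtain q where "q \<in> C" using False by blast
        then show "u 0 = 0"
          using le[of q 0] ge[of 0 0] by (simp add: sublinear_zero[OF sub])
      next
        fix c :: real and x assume c: "c > 0"
        have "inverse c * u (smul c x) \<le> q x" if "q \<in> C" for q
          using le[OF that, of "smul c x"] sublinear_scale[OF sub[OF that], of c x] c
          by (simp add: field_simps)
        then have "inverse c * u (smul c x) \<le> u x" by (rule ge)
        then show "u (smul c x) \<le> c * u x" using c by (simp add: field_simps)
      qed
      moreover have "u x \<le> p x" for x
      proof -
        obtain q where "q \<in> C" using False by blast
        then have "u x \<le> q x" "q x \<le> p x" using le CA by (auto simp: A_def)
        then show ?thesis by simp
      qed
      ultimately show ?thesis using le by (auto simp: A_def P_def)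
    qed
  qed
  then obtain m where m: "m \<in> A" "\<And>a. a \<in> A \<Longrightarrow> P m a \<Longrightarrow> a = m" by blast
  have "r = m" if "sublinear smul r" "\<forall>x. r x \<le> m x" for r
  proof (rule m(2))
    show "P m r" using that by (simp add: P_def)
    have "r x \<le> p x" for x using that m(1) by (auto simp: A_def intro: order_trans)
    then show "r \<in> A" using that by (simp add: A_def)
  qed
  then show ?thesis using m(1) by (auto simp: A_def)
qed

text \<open>Linearity comes from minimality instead of a stepwise extension from subspaces. Choosing
  the minimal functional below the lowered \<open>q\<close>, not merely below \<open>p\<close>,
  fixes its value at \<open>y\<close>.\<close>

lemma hahn_banach_sublinear:
  assumes p: "sublinear smul p"
  shows "\<exists>f. Vector_Spaces.linear smul (*) f \<and> (\<forall>x. f x \<le> p x) \<and> f y = p y"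
proof -
  obtain q where q: "sublinear smul q" "\<And>x. q x \<le> p x" "\<And>x. q x \<le> p (x + y) - p y"
    using sublinear_descend[OF p] by blast
  obtain f where f: "sublinear smul f" "\<And>x. f x \<le> q x"
    and min: "\<And>r. sublinear smul r \<Longrightarrow> (\<And>x. r x \<le> f x) \<Longrightarrow> r = f"
    using minimal_sublinear[OF q(1)] by metis
  have "f x + f z \<le> f (x + z)" for x z
  proof -
    obtain r where r: "sublinear smul r" "\<And>x. r x \<le> f x" "\<And>x. r x \<le> f (x + z) - f z"
      using sublinear_descend[OF f(1)] by blast
    from min[OF r(1,2)] r(3)[of x] show ?thesis by simp
  qed
  then have add: "f (x + z) = f x + f z" for x z
    using sublinear_add[OF f(1), of x z] by (simp add: antisym)
  have minus: "f (- x) = - f x" for x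
    using add[of x "- x"] sublinear_zero[OF f(1)] by simp
  have scale: "f (smul c x) = c * f x" for c x
  proof (cases "c \<ge> 0")
    case True then show ?thesis by (rule sublinear_scale[OF f(1)])
  next
    case False
    then have "f (smul (- c) x) = - c * f x" by (intro sublinear_scale[OF f(1)]) simp
    then show ?thesis by (simp add: minus)
  qed
  have "Vector_Spaces.linear smul (*) f"
    unfolding Vector_Spaces.linear_iff
    by (auto simp: add scale vs intro!: vector_space.intro simp: algebra_simps)
  moreover have "f x \<le> p x" for x using f(2) q(2) by (rule order_trans)
  moreover have "f y = p y"
  proof (rule antisym)
    show "f y \<le> p y" by fact
    have "f (- y) \<le> p (- y + y) - p y" using f(2) q(3) by (rule order_trans)
    then show "p y \<le> f y" by (simp add: minus sublinear_zero[OF p])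
  qed
  ultimately show ?thesis by blast
qed

end

text \<open>The conclusion of the Hahn--Banach theorem is isolated as a property of the scalar field.\<close>

definition norming_functionals :: "('k::real_normed_field \<Rightarrow> 'x::ab_group_add \<Rightarrow> 'x) \<Rightarrow> bool" where
  "norming_functionals smul \<longleftrightarrow>
    (\<forall>p y. seminorm smul p \<and> p y \<noteq> 0 \<longrightarrow>
      (\<exists>f. Vector_Spaces.linear smul (*) f \<and> (\<forall>x. norm (f x) \<le> p x) \<and> f y \<noteq> 0))"

lemma norming_functionals_real:
  fixes smul :: "real \<Rightarrow> 'x::ab_group_add \<Rightarrow> 'x"
  assumes vs: "vector_space smul"
  shows "norming_functionals smul"
  unfolding norming_functionals_def
proof (intro allI impI, elim conjE)
  interpret vector_space smul by fact
  fix p y assume p: "seminorm smul p" and y: "p y \<noteq> 0"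
  have "sublinear smul p" using p by (auto simp: seminorm_def sublinear_def)
  from hahn_banach_sublinear[OF vs this, of y] obtain f where
    f: "Vector_Spaces.linear smul (*) f" "\<And>x. f x \<le> p x" "f y = p y" by blast
  have "norm (f x) \<le> p x" for x
  proof -
    have "f (smul (-1) x) = - f x" "p (smul (-1) x) = p x"
      using f(1) p by (simp_all only: Vector_Spaces.linear_iff seminorm_def) auto
    then show ?thesis using f(2)[of x] f(2)[of "smul (-1) x"] by simp
  qed
  with f y show "\<exists>f. Vector_Spaces.linear smul (*) f \<and> (\<forall>x. norm (f x) \<le> p x) \<and> f y \<noteq> 0"
    by metis
qed

text \<open>A complex functional is determined by its real part \<open>u\<close>, as
  \<open>u x - i * u (i x)\<close>. Rotating \<open>x\<close> by \<open>cnj (sgn (f x))\<close>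
  makes the value real and nonnegative, so the real bound \<open>u \<le> p\<close> controls the
  modulus.\<close>

lemma norming_functionals_complex:
  fixes smul :: "complex \<Rightarrow> 'x::ab_group_add \<Rightarrow> 'x"
  assumes vs: "vector_space smul"
  shows "norming_functionals smul"
  unfolding norming_functionals_def
proof (intro allI impI, elim conjE)
  interpret vector_space smul by fact
  fix p y assume p: "seminorm smul p" and y: "p y \<noteq> 0"
  define rs where "rs r = smul (complex_of_real r)" for r
  have rvs: "vector_space rs"
    by unfold_locales (auto simp: rs_def scale_right_distrib scale_left_distrib)
  have "sublinear rs p" using p by (auto simp: seminorm_def sublinear_def rs_def)
  from hahn_banach_sublinear[OF rvs this, of y] obtain u where
    u: "Vector_Spaces.linear rs (*) u" "\<And>x. u x \<le> p x" "u y = p y" by blast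
  have u_add: "u (x + z) = u x + u z" for x z using u(1) by (simp add: Vector_Spaces.linear_iff)
  have u_scale: "u (smul (complex_of_real r) x) = r * u x" for r x
    using u(1) by (simp add: Vector_Spaces.linear_iff rs_def)
  define f where "f x = Complex (u x) (- u (smul \<i> x))" for x
  have f_add: "f (x + z) = f x + f z" for x z
    by (simp add: f_def u_add scale_right_distrib complex_eq_iff)
  have f_scale: "f (smul c x) = c * f x" for c x
  proof -
    have c: "smul c x = smul (complex_of_real (Re c)) x + smul (complex_of_real (Im c)) (smul \<i> x)"
      by (simp add: scale_left_distrib[symmetric] complex_eq_iff)
    have ic: "smul \<i> (smul c x) =
        smul (complex_of_real (Re c)) (smul \<i> x) + smul (complex_of_real (- Im c)) x"
      by (simp only: scale_scale scale_left_distrib[symmetric])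
        (rule arg_cong[of _ _ "\<lambda>d. smul d x"], simp add: complex_eq_iff)
    have "u (smul c x) = Re c * u x + Im c * u (smul \<i> x)"
      by (subst c) (simp only: u_add u_scale)
    moreover have "u (smul \<i> (smul c x)) = Re c * u (smul \<i> x) - Im c * u x"
      unfolding ic u_add u_scale by simp
    ultimately show ?thesis by (simp add: f_def complex_eq_iff)
  qed
  have "Vector_Spaces.linear smul (*) f"
    unfolding Vector_Spaces.linear_iff
    by (auto simp: f_add f_scale vs intro!: vector_space.intro simp: algebra_simps)
  moreover have "norm (f x) \<le> p x" for x
  proof -
    define c where "c = cnj (sgn (f x))"
    have nc: "norm c \<le> 1" by (simp add: c_def norm_sgn)
    have "f (smul c x) = complex_of_real (norm (f x))"
    proof -
      have "cnj (f x) * f x = complex_of_real (norm (f x)) * complex_of_real (norm (f x))"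
        by (metis complex_norm_square mult.commute power2_eq_square of_real_power)
      then show ?thesis by (simp add: f_scale c_def sgn_eq)
    qed
    then have "norm (f x) = u (smul c x)" by (simp add: f_def complex_eq_iff)
    also have "\<dots> \<le> p (smul c x)" by (rule u(2))
    also have "\<dots> = norm c * p x" using p by (simp add: seminorm_def)
    also have "\<dots> \<le> 1 * p x"
    proof (rule mult_right_mono[OF nc])
      have "p (x + smul (-1) x) \<le> p x + p (smul (-1) x)" "p (smul (-1) x) = norm (-1::complex) * p x"
        "p (smul 0 x) = norm (0::complex) * p x"
        using p unfolding seminorm_def by blast+
      then show "0 \<le> p x" by simp
    qed
    finally show ?thesis by simp
  qed
  moreover have "f y \<noteq> 0" using u(3) y by (simp add: f_def complex_eq_iff)
  ultimately show "\<exists>f. Vector_Spaces.linear smul (*) f \<and> (\<forall>x. norm (f x) \<le> p x) \<and> f y \<noteq> 0"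
    by blast
qed

section \<open>Continuous seminorms\<close>

text \<open>A bound on one neighbourhood of 0 is the form that the gauge construction delivers;
  homogeneity and the reverse triangle inequality turn it into continuity everywhere.\<close>

definition cont_seminorm ::
    "('k::real_normed_field \<Rightarrow> 'x::{ab_group_add, topological_space} \<Rightarrow> 'x) \<Rightarrow> ('x \<Rightarrow> real) \<Rightarrow> bool" where
  "cont_seminorm smul p \<longleftrightarrow> seminorm smul p \<and> (\<exists>W. open W \<and> 0 \<in> W \<and> (\<forall>x\<in>W. p x \<le> 1))"

context topological_vector_space
begin

lemma seminorm_add: "seminorm smul p \<Longrightarrow> p (x + y) \<le> p x + p y"
  by (simp add: seminorm_def)

lemma seminorm_scale: "seminorm smul p \<Longrightarrow> p (smul c x) = norm c * p x"
  by (simp add: seminorm_def)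

lemma seminorm_zero: "seminorm smul p \<Longrightarrow> p 0 = 0"
  using seminorm_scale[of p 0 0] by simp

lemma seminorm_minus: "seminorm smul p \<Longrightarrow> p (- x) = p x"
  using seminorm_scale[of p "-1" x] by simp

lemma seminorm_nonneg: "seminorm smul p \<Longrightarrow> 0 \<le> p x"
  using seminorm_add[of p x "- x"] by (simp add: seminorm_zero seminorm_minus)

lemma seminorm_diff: "seminorm smul p \<Longrightarrow> p (x - y) \<le> p x + p y"
  using seminorm_add[of p x "- y"] by (simp add: seminorm_minus)

lemma seminorm_diff_commute: "seminorm smul p \<Longrightarrow> p (x - y) = p (y - x)"
  using seminorm_minus[of p "x - y"] by simp

lemma seminorm_abs_diff: "seminorm smul p \<Longrightarrow> \<bar>p x - p y\<bar> \<le> p (x - y)"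
  using seminorm_add[of p "x - y" y] seminorm_add[of p "y - x" x]
  by (simp add: seminorm_diff_commute[of p y x])

lemma seminorm_sum: "seminorm smul p \<Longrightarrow> p (sum f A) \<le> (\<Sum>a\<in>A. p (f a))"
  by (induction A rule: infinite_finite_induct)
    (auto simp: seminorm_zero intro: order_trans[OF seminorm_add])

lemma continuous_scale_right: "continuous_on UNIV (\<lambda>x. smul c x)"
proof -
  have "continuous_on UNIV ((\<lambda>(c, x). smul c x) \<circ> (\<lambda>x. (c, x)))"
    by (intro continuous_on_compose continuous_on_subset[OF continuous_scale])
      (auto intro!: continuous_intros)
  then show ?thesis by (simp add: o_def)
qed

lemma continuous_scale_left: "continuous_on UNIV (\<lambda>c. smul c x)"
proof -
  have "continuous_on UNIV ((\<lambda>(c, x). smul c x) \<circ> (\<lambda>c. (c, x)))"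
    by (intro continuous_on_compose continuous_on_subset[OF continuous_scale])
      (auto intro!: continuous_intros)
  then show ?thesis by (simp add: o_def)
qed

lemma open_scaled_translate:
  assumes "open W"
  shows "open {y. smul c (y - x) \<in> W}"
proof -
  have "continuous_on UNIV ((\<lambda>y. smul c y) \<circ> (\<lambda>y. y - x))"
    by (intro continuous_on_compose continuous_on_subset[OF continuous_scale_right])
      (auto intro!: continuous_intros)
  then have "open ((\<lambda>y. smul c (y - x)) -` W)"
    using assms by (simp add: o_def continuous_on_open_vimage)
  then show ?thesis by (simp add: vimage_def)
qed

lemma cont_seminorm_small:
  assumes p: "cont_seminorm smul p" and e: "e > 0"
  shows "eventually (\<lambda>y. p (y - x) < e) (nhds x)"
proof -
  obtain W where W: "open W" "0 \<in> W" "\<And>x. x \<in> W \<Longrightarrow> p x \<le> 1"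
    using p by (auto simp: cont_seminorm_def)
  have s: "seminorm smul p" using p by (simp add: cont_seminorm_def)
  define c where "c = (of_real (2 / e) :: 'k)"
  have c: "norm c = 2 / e" using e by (simp add: c_def norm_divide)
  have "p (y - x) < e" if "smul c (y - x) \<in> W" for y
  proof -
    have "p (smul c (y - x)) \<le> 1" using that W by blast
    then have "p (y - x) \<le> e / 2"
      using e unfolding seminorm_scale[OF s] c by (simp add: field_simps)
    then show ?thesis using e by simp
  qed
  moreover have "eventually (\<lambda>y. y \<in> {y. smul c (y - x) \<in> W}) (nhds x)"
    using W by (intro eventually_nhds_in_open open_scaled_translate) auto
  ultimately show ?thesis by (auto elim: eventually_mono)
qed

lemma cont_seminorm_continuous:
  assumes p: "cont_seminorm smul p"
  shows "continuous_on UNIV p"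
  unfolding continuous_on_eq_continuous_at[OF open_UNIV] continuous_at
proof (intro ballI tendstoI)
  fix x :: 'x and e :: real assume "e > 0"
  have s: "seminorm smul p" using p by (simp add: cont_seminorm_def)
  have "eventually (\<lambda>y. p (y - x) < e) (at x)"
    using cont_seminorm_small[OF p \<open>e > 0\<close>, of x] by (auto simp: eventually_at_filter elim: eventually_mono)
  then show "eventually (\<lambda>y. dist (p y) (p x) < e) (at x)"
    by (rule eventually_mono)
      (auto simp: dist_real_def intro: le_less_trans[OF seminorm_abs_diff[OF s]])
qed

lemma cont_seminorm_tendsto_zero:
  assumes p: "cont_seminorm smul p" and f: "(f \<longlongrightarrow> l) F"
  shows "((\<lambda>i. p (f i - l)) \<longlongrightarrow> 0) F"
proof -
  have "isCont p 0"
    using cont_seminorm_continuous[OF p] by (simp add: continuous_on_eq_continuous_at)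
  moreover have "((\<lambda>i. f i - l) \<longlongrightarrow> 0) F" using tendsto_diff[OF f tendsto_const[of l]] by simp
  ultimately have "((\<lambda>i. p (f i - l)) \<longlongrightarrow> p 0) F" by (rule isCont_tendsto_compose)
  then show ?thesis using p by (simp add: cont_seminorm_def seminorm_zero)
qed

lemma linear_bounded_continuous:
  assumes f: "Vector_Spaces.linear smul (*) f" and p: "cont_seminorm smul p"
    and le: "\<And>x. norm (f x) \<le> p x"
  shows "continuous_on UNIV f"
  unfolding continuous_on_eq_continuous_at[OF open_UNIV] continuous_at
proof (intro ballI)
  fix x :: 'x
  have sub: "f (y - x) = f y - f x" for y
    using f by (rule module_hom.diff[OF Vector_Spaces.linear.axioms(3)])
  have "((\<lambda>y. p (y - x)) \<longlongrightarrow> 0) (at x)"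
    by (rule cont_seminorm_tendsto_zero[OF p]) (rule tendsto_ident_at)
  then have "((\<lambda>y. f y - f x) \<longlongrightarrow> 0) (at x)"
    by (rule Lim_null_comparison[rotated]) (simp add: le sub[symmetric])
  then show "(f \<longlongrightarrow> f x) (at x)" by (rule LIM_zero_cancel)
qed

end

context locally_convex_space
begin

text \<open>Minkowski gauge of the balanced core of a convex neighbourhood. Convexity of the core
  gives subadditivity, balancedness gives absolute homogeneity over the scalar field, and joint
  continuity of scalar multiplication puts an open set inside the core.\<close>

lemma gauge_exists:
  assumes U: "open U" "0 \<in> U"
  shows "\<exists>p. cont_seminorm smul p \<and> (\<forall>x. p x < 1 \<longrightarrow> x \<in> U)"
proof -
  obtain C where C: "open C" "0 \<in> C" "C \<subseteq> U" "convex_set smul C"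
    using convex_base[OF U] by blast
  define V where "V = {x. \<forall>c. norm c \<le> 1 \<longrightarrow> smul c x \<in> C}"
  have VC: "V \<subseteq> C" by (auto simp: V_def dest: spec[of _ 1])
  have bal: "smul c x \<in> V" if "x \<in> V" "norm c \<le> 1" for c x
    unfolding V_def
  proof (intro CollectI allI impI)
    fix d :: 'a assume "norm d \<le> 1"
    with that(2) have "norm (d * c) \<le> 1" by (simp add: norm_mult mult_le_one)
    with that(1) show "smul d (smul c x) \<in> C" by (simp add: V_def)
  qed
  have conv: "smul (of_real u) x + smul (of_real v) y \<in> V"
    if "x \<in> V" "y \<in> V" "u \<ge> 0" "v \<ge> 0" "u + v = 1" for x y u v
    unfolding V_def
  proof (intro CollectI allI impI)
    fix c :: 'a assume "norm c \<le> 1"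
    with that have "smul c x \<in> C" "smul c y \<in> C" by (auto simp: V_def)
    with C(4) that(3-5)
    have "smul (of_real u) (smul c x) + smul (of_real v) (smul c y) \<in> C"
      unfolding convex_set_def by blast
    then show "smul c (smul (of_real u) x + smul (of_real v) y) \<in> C"
      by (simp add: scale_right_distrib mult.commute)
  qed
  obtain W where W: "open W" "0 \<in> W" "W \<subseteq> V"
  proof -
    have "open ((\<lambda>(c, x). smul c x) -` C)"
      using continuous_scale C(1) by (simp add: continuous_on_open_vimage)
    moreover have "(0, 0) \<in> (\<lambda>(c, x). smul c x) -` C" using C(2) by simp
    ultimately obtain A W0 where AW: "open A" "open W0" "(0, 0) \<in> A \<times> W0"
      "A \<times> W0 \<subseteq> (\<lambda>(c, x). smul c x) -` C" by (rule open_prod_elim)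
    obtain d where d: "d > 0" "\<And>c. norm c < d \<Longrightarrow> c \<in> A"
      using AW(1,3) by (auto simp: open_dist dist_norm)
    \<comment> \<open>The factors \<open>d / 2\<close> and \<open>2 / d\<close> cancel: a scalar of
      modulus at most 1 times \<open>d / 2\<close> stays in \<open>A\<close>, and the dilation by
      \<open>2 / d\<close> is absorbed by \<open>W\<close>.\<close>
    define W where "W = {x. smul (of_real (2 / d)) (x - 0) \<in> W0}"
    have "W \<subseteq> V" unfolding V_def
    proof (intro subsetI CollectI allI impI)
      fix x and c :: 'a assume x: "x \<in> W" and c: "norm c \<le> 1"
      have "c * of_real (d / 2) \<in> A"
      proof (rule d(2))
        have "norm c * (d / 2) \<le> 1 * (d / 2)" using c d by (intro mult_right_mono) auto
        then show "norm (c * of_real (d / 2)) < d" using d by (simp add: norm_mult norm_divide)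
      qed
      then have "smul (c * of_real (d / 2)) (smul (of_real (2 / d)) x) \<in> C"
        using x AW(4) by (auto simp: W_def)
      then show "smul c x \<in> C" using d by simp
    qed
    moreover have "open W" unfolding W_def by (intro open_scaled_translate AW)
    ultimately show ?thesis using AW(3) by (intro that) (auto simp: W_def)
  qed
  define R where "R x = {r. r > 0 \<and> smul (of_real (inverse r)) x \<in> V}" for x
  define p where "p x = Inf (R x)" for x
  have R_mono: "s \<in> R x" if "r \<in> R x" "r \<le> s" for r s x
  proof -
    have "smul (of_real (r / s)) (smul (of_real (inverse r)) x) \<in> V"
      using that by (rule_tac bal) (auto simp: R_def norm_divide)
    moreover have "r / s * inverse r = inverse s" using that by (simp add: R_def divide_simps)
    then have "of_real (r / s) * of_real (inverse r) = (of_real (inverse s) :: 'a)"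
      by (metis of_real_mult)
    ultimately show ?thesis using that by (simp add: R_def del: of_real_inverse of_real_divide)
  qed
  have R_ne: "R x \<noteq> {}" for x
  proof -
    have "open ((\<lambda>c. smul c x) -` W)"
      using continuous_scale_left W(1) by (simp add: continuous_on_open_vimage)
    moreover have "0 \<in> (\<lambda>c. smul c x) -` W" using W(2) by simp
    ultimately obtain d where d0: "d > 0" "\<And>c. dist c 0 < d \<Longrightarrow> c \<in> (\<lambda>c. smul c x) -` W"
      unfolding open_dist by blast
    then have d: "d > 0" "\<And>c. norm c < d \<Longrightarrow> smul c x \<in> W" by auto
    have "smul (of_real (inverse (2 / d))) x \<in> W" using d(1) by (intro d(2)) (simp add: norm_divide)
    then have "2 / d \<in> R x" using d W(3) by (auto simp: R_def)
    then show ?thesis by blast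
  qed
  have bdd: "bdd_below (R x)" for x by (rule bdd_belowI[of _ 0]) (simp add: R_def)
  have p_le: "p x \<le> r" if "r \<in> R x" for x r
    unfolding p_def by (rule cInf_lower[OF that bdd])
  have p_ge: "c \<le> p x" if "\<And>r. r \<in> R x \<Longrightarrow> c \<le> r" for x c
    unfolding p_def by (rule cInf_greatest[OF R_ne]) (use that in auto)
  have p_less: "\<exists>r\<in>R x. r < c" if "p x < c" for x c
    using that p_ge[of x c] by (meson leI leD)
  have p_scale_le: "p (smul c x) \<le> norm c * p x" if "c \<noteq> 0" for c x
  proof -
    have "p (smul c x) / norm c \<le> r" if r: "r \<in> R x" for r
    proof -
      have "smul (c / of_real (norm c)) (smul (of_real (inverse r)) x) \<in> V"
        using r \<open>c \<noteq> 0\<close> by (rule_tac bal) (auto simp: R_def norm_divide)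
      moreover have "c / of_real (norm c) * of_real (inverse r) = of_real (inverse (norm c * r)) * c"
        by (simp add: field_simps)
      ultimately have "norm c * r \<in> R (smul c x)"
        using r \<open>c \<noteq> 0\<close> by (simp add: R_def del: of_real_inverse of_real_divide)
      from p_le[OF this] show ?thesis using \<open>c \<noteq> 0\<close> by (simp add: field_simps)
    qed
    then have "p (smul c x) / norm c \<le> p x" by (rule p_ge)
    then show ?thesis using that by (simp add: field_simps)
  qed
  have p_zero: "p 0 = 0"
  proof (rule antisym)
    have "p 0 \<le> 0 + e" if "e > 0" for e
      using p_le[of e 0] that W by (auto simp: R_def)
    then show "p 0 \<le> 0" by (rule field_le_epsilon)
    show "0 \<le> p 0" by (rule p_ge) (simp add: R_def)
  qed
  have scale: "p (smul c x) = norm c * p x" for c x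
  proof (cases "c = 0")
    case True then show ?thesis by (simp add: p_zero)
  next
    case False
    have "p (smul (inverse c) (smul c x)) \<le> norm (inverse c) * p (smul c x)"
      using False by (intro p_scale_le) simp
    then have "norm c * p x \<le> p (smul c x)" using False by (simp add: norm_inverse norm_divide field_simps)
    then show ?thesis using p_scale_le[OF False, of x] by simp
  qed
  have add: "p (x + y) \<le> p x + p y" for x y
  proof -
    have *: "p (x + y) \<le> r + s" if r: "r \<in> R x" and s: "s \<in> R y" for r s
    proof (rule p_le)
      have rs: "r > 0" "s > 0" using r s by (auto simp: R_def)
      have "smul (of_real (r / (r + s))) (smul (of_real (inverse r)) x) +
          smul (of_real (s / (r + s))) (smul (of_real (inverse s)) y) \<in> V"
        using r s rs by (rule_tac conv) (auto simp: R_def add_divide_distrib[symmetric])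
      also have "smul (of_real (r / (r + s))) (smul (of_real (inverse r)) x) +
          smul (of_real (s / (r + s))) (smul (of_real (inverse s)) y) =
          smul (of_real (inverse (r + s))) (x + y)"
        using rs by (simp add: scale_right_distrib divide_simps del: of_real_add)
      finally show "r + s \<in> R (x + y)" using rs by (simp add: R_def)
    qed
    have "p (x + y) - s \<le> p x" if "s \<in> R y" for s
      using *[OF _ that] by (intro p_ge) (simp add: algebra_simps)
    then have "p (x + y) - p x \<le> p y" by (intro p_ge) (simp add: algebra_simps)
    then show ?thesis by simp
  qed
  have "cont_seminorm smul p" unfolding cont_seminorm_def seminorm_def
  proof (intro conjI allI exI ballI)
    fix x assume "x \<in> W"
    then show "p x \<le> 1" using W(3) by (intro p_le) (auto simp: R_def)
  qed (use add scale W in auto)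
  moreover have "x \<in> U" if px: "p x < 1" for x
  proof -
    obtain r where "r \<in> R x" "r < 1" using p_less[OF px] by blast
    from R_mono[OF this(1), of 1] this(2) have "x \<in> V" by (simp add: R_def)
    then show ?thesis using VC C(3) by blast
  qed
  ultimately show ?thesis by blast
qed

lemma gauge_exists_at:
  assumes U: "open U" "x \<in> U"
  shows "\<exists>p. cont_seminorm smul p \<and> (\<forall>y. p (y - x) < 1 \<longrightarrow> y \<in> U)"
proof -
  have "open {y. smul 1 (y - (- x)) \<in> U}" by (rule open_scaled_translate[OF U(1)])
  then have "open {z. z + x \<in> U}" by simp
  with U(2) obtain p where p: "cont_seminorm smul p" "\<forall>z. p z < 1 \<longrightarrow> z \<in> {z. z + x \<in> U}"
    using gauge_exists[of "{z. z + x \<in> U}"] by auto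
  then show ?thesis by (metis (no_types, lifting) diff_add_cancel mem_Collect_eq)
qed

lemma tendsto_cont_seminormI:
  assumes "\<And>p. cont_seminorm smul p \<Longrightarrow> ((\<lambda>i. p (f i - l)) \<longlongrightarrow> 0) F"
  shows "(f \<longlongrightarrow> l) F"
proof (rule topological_tendstoI)
  fix S assume "open S" "l \<in> S"
  then obtain p where p: "cont_seminorm smul p" "\<And>y. p (y - l) < 1 \<Longrightarrow> y \<in> S"
    using gauge_exists_at by blast
  have "eventually (\<lambda>i. p (f i - l) < 1) F"
    using assms[OF p(1)] by (rule order_tendstoD) simp
  then show "eventually (\<lambda>i. f i \<in> S) F" by (rule eventually_mono) (rule p(2))
qed

lemma closure_eq_UNIV_I:
  assumes "\<And>x p e. cont_seminorm smul p \<Longrightarrow> e > 0 \<Longrightarrow> \<exists>y\<in>A. p (y - x) < e"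
  shows "closure A = UNIV"
proof -
  have "x \<in> closure A" for x
  proof (subst closure_iff_nhds_not_empty, intro allI impI)
    fix U V assume "V \<subseteq> U" "open V" "x \<in> V"
    then obtain p where p: "cont_seminorm smul p" "\<And>y. p (y - x) < 1 \<Longrightarrow> y \<in> V"
      using gauge_exists_at by blast
    from assms[OF p(1), of 1 x] show "A \<inter> U \<noteq> {}" using p(2) \<open>V \<subseteq> U\<close> by auto
  qed
  then show ?thesis by blast
qed

lemma closure_eq_UNIV_D:
  assumes A: "closure A = UNIV" and p: "cont_seminorm smul p" and e: "e > 0"
  shows "\<exists>y\<in>A. p (y - x) < e"
proof -
  obtain S where S: "open S" "x \<in> S" "\<And>y. y \<in> S \<Longrightarrow> p (y - x) < e"
    using cont_seminorm_small[OF p e, of x] by (auto simp: eventually_nhds)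
  have "S \<inter> A \<noteq> {}" using S A open_Int_closure_eq_empty[of S A] by auto
  then show ?thesis using S by blast
qed

end

section \<open>Linear functionals and non-weak topologies\<close>

lemma linear_to_field:
  assumes f: "Vector_Spaces.linear smul (*) f"
  shows linear_to_field_add: "f (x + y) = f x + f y"
    and linear_to_field_diff: "f (x - y) = f x - f y"
    and linear_to_field_scale: "f (smul c x) = c * f x"
    and linear_to_field_zero: "f 0 = 0"
    and linear_to_field_sum: "f (sum h A) = (\<Sum>a\<in>A. f (h a))"
proof -
  interpret module_hom smul "(*)" f using f by (rule Vector_Spaces.linear.axioms(3))
  show "f (x + y) = f x + f y" "f (x - y) = f x - f y" "f (smul c x) = c * f x" "f 0 = 0"
    "f (sum h A) = (\<Sum>a\<in>A. f (h a))"
    by (rule add diff scale zero sum)+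
qed

context topological_vector_space
begin

lemma linear_to_fieldI:
  assumes "\<And>x y. f (x + y) = f x + f y" "\<And>c x. f (smul c x) = c * f x"
  shows "Vector_Spaces.linear smul (*) f"
  unfolding Vector_Spaces.linear_iff
  using assms by (auto intro!: vector_space_axioms vector_space.intro simp: algebra_simps)

lemma seminorm_le_functionals:
  assumes "finite F" "\<And>f. f \<in> F \<Longrightarrow> Vector_Spaces.linear smul (*) f" "seminorm smul p"
    "\<And>x. (\<And>f. f \<in> F \<Longrightarrow> f x = 0) \<Longrightarrow> p x = 0"
  shows "\<exists>C\<ge>0. \<forall>x. p x \<le> C * (\<Sum>f\<in>F. norm (f x))"
  using assms
proof (induction F arbitrary: p rule: finite_induct)
  case empty
  then show ?case by auto
next
  case (insert g F)
  have lin: "Vector_Spaces.linear smul (*) f" if "f \<in> insert g F" for f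
    using insert.prems(1) that by blast
  note g = lin[of g, OF insertI1]
  show ?case
  proof (cases "\<exists>z. (\<forall>f\<in>F. f z = 0) \<and> g z \<noteq> 0")
    case False
    have "\<exists>C\<ge>0. \<forall>x. p x \<le> C * (\<Sum>f\<in>F. norm (f x))"
    proof (rule insert.IH)
      fix x assume x: "\<And>f. f \<in> F \<Longrightarrow> f x = 0"
      then have "g x = 0" using False by blast
      with x show "p x = 0" by (intro insert.prems(3)) auto
    qed (use lin insert.prems in auto)
    then obtain C where C: "C \<ge> 0" "\<And>x. p x \<le> C * (\<Sum>f\<in>F. norm (f x))" by blast
    have "p x \<le> C * (\<Sum>f\<in>insert g F. norm (f x))" for x
      using C(2)[of x] insert.hyps C(1) by (simp add: ring_distribs add_increasing)
    then show ?thesis using C(1) by blast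
  next
    case True
    then obtain z0 where z0: "\<And>f. f \<in> F \<Longrightarrow> f z0 = 0" "g z0 \<noteq> 0" by blast
    define z where "z = smul (inverse (g z0)) z0"
    have z: "f z = 0" if "f \<in> F" for f
      using z0(1)[OF that] lin[of f] that by (simp add: z_def linear_to_field_scale)
    have gz: "g z = 1" using z0(2) g by (simp add: z_def linear_to_field_scale)
    define q where "q x = p (x - smul (g x) z)" for x
    have p: "seminorm smul p" by fact
    have "\<exists>C\<ge>0. \<forall>x. q x \<le> C * (\<Sum>f\<in>F. norm (f x))"
    proof (rule insert.IH)
      show "seminorm smul q"
        unfolding seminorm_def
      proof (intro conjI allI)
        fix x y
        have "x + y - smul (g (x + y)) z = (x - smul (g x) z) + (y - smul (g y) z)"
          by (simp only: linear_to_field_add[OF g] scale_left_distrib add_diff_add)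
        then show "q (x + y) \<le> q x + q y" by (simp only: q_def seminorm_add[OF p])
      next
        fix c x
        have "smul c x - smul (g (smul c x)) z = smul c (x - smul (g x) z)"
          by (simp only: linear_to_field_scale[OF g] scale_right_diff_distrib scale_scale)
        then show "q (smul c x) = norm c * q x" by (simp only: q_def seminorm_scale[OF p])
      qed
      fix x assume x: "\<And>f. f \<in> F \<Longrightarrow> f x = 0"
      show "q x = 0" unfolding q_def
      proof (rule insert.prems(3))
        fix f assume f: "f \<in> insert g F"
        show "f (x - smul (g x) z) = 0"
          using f
        proof
          assume "f = g"
          then show ?thesis
            by (simp add: linear_to_field_diff[OF g] linear_to_field_scale[OF g] gz)
        next
          assume "f \<in> F"
          then show ?thesis
            using x[of f] z[of f]
            by (simp add: linear_to_field_diff[OF lin[OF f]] linear_to_field_scale[OF lin[OF f]])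
        qed
      qed
    qed (use lin in auto)
    then obtain C where C: "C \<ge> 0" "\<And>x. q x \<le> C * (\<Sum>f\<in>F. norm (f x))" by blast
    have "p x \<le> (C + p z) * (\<Sum>f\<in>insert g F. norm (f x))" for x
    proof -
      have "p x \<le> q x + norm (g x) * p z"
        using seminorm_add[OF p, of "x - smul (g x) z" "smul (g x) z"]
        by (simp add: q_def seminorm_scale[OF p])
      also have "\<dots> \<le> C * (\<Sum>f\<in>F. norm (f x)) + norm (g x) * p z" using C(2)[of x] by simp
      also have "\<dots> \<le> (C + p z) * (norm (g x) + (\<Sum>f\<in>F. norm (f x)))"
        using C(1) seminorm_nonneg[OF p, of z]
        by (simp add: ring_distribs sum_nonneg add_increasing add_increasing2 mult.commute)
      finally show ?thesis using insert.hyps by simp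
    qed
    then show ?thesis using C(1) seminorm_nonneg[OF p, of z] by (intro exI[of _ "C + p z"]) auto
  qed
qed

end

lemma generate_topology_Ball_finite:
  assumes "finite F" "\<And>f. f \<in> F \<Longrightarrow> generate_topology G (A f)"
  shows "generate_topology G {y. \<forall>f\<in>F. y \<in> A f}"
  using assms
proof (induction F rule: finite_induct)
  case empty
  then show ?case by (simp add: generate_topology.UNIV)
next
  case (insert f F)
  have "{y. \<forall>f\<in>insert f F. y \<in> A f} = A f \<inter> {y. \<forall>f\<in>F. y \<in> A f}" by auto
  with insert show ?case by (auto intro: generate_topology.Int)
qed

text \<open>Contraposition, with \<open>Y\<close> the full continuous dual. A continuous seminorm
  that vanishes on a common kernel of finitely many elements of \<open>Y\<close> is bounded by a
  multiple of the sum of their moduli, so its balls contain weak neighbourhoods. Norming functionals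
  show that \<open>Y\<close> separates points.\<close>

lemma (in locally_convex_space) not_weak_seminorm:
  assumes nw: "\<not> weak_topology smul" and nf: "norming_functionals smul"
  shows "\<exists>p. cont_seminorm smul p \<and>
    (\<forall>F. finite F \<longrightarrow> (\<forall>f\<in>F. Vector_Spaces.linear smul (*) f \<and> continuous_on UNIV f) \<longrightarrow>
      (\<exists>z. (\<forall>f\<in>F. f z = 0) \<and> p z \<noteq> 0))"
proof (rule ccontr)
  assume neg: "\<not> ?thesis"
  have *: "\<exists>F. finite F \<and> (\<forall>f\<in>F. Vector_Spaces.linear smul (*) f \<and> continuous_on UNIV f) \<and>
      (\<forall>z. (\<forall>f\<in>F. f z = 0) \<longrightarrow> p z = 0)" if "cont_seminorm smul p" for p
  proof (rule ccontr)
    assume no: "\<not> ?thesis"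
    have "\<forall>F. finite F \<longrightarrow> (\<forall>f\<in>F. Vector_Spaces.linear smul (*) f \<and> continuous_on UNIV f) \<longrightarrow>
      (\<exists>z. (\<forall>f\<in>F. f z = 0) \<and> p z \<noteq> 0)"
    proof (intro allI impI, rule ccontr)
      fix F assume F: "finite F" "\<forall>f\<in>F. Vector_Spaces.linear smul (*) f \<and> continuous_on UNIV f"
        and "\<not> (\<exists>z. (\<forall>f\<in>F. f z = 0) \<and> p z \<noteq> 0)"
      then have "\<forall>z. (\<forall>f\<in>F. f z = 0) \<longrightarrow> p z = 0" by blast
      with F have "\<exists>F. finite F \<and> (\<forall>f\<in>F. Vector_Spaces.linear smul (*) f \<and> continuous_on UNIV f) \<and>
        (\<forall>z. (\<forall>f\<in>F. f z = 0) \<longrightarrow> p z = 0)" by (intro exI[of _ F] conjI)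
      with no show False by (rule notE)
    qed
    with that have "\<exists>p. cont_seminorm smul p \<and>
      (\<forall>F. finite F \<longrightarrow> (\<forall>f\<in>F. Vector_Spaces.linear smul (*) f \<and> continuous_on UNIV f) \<longrightarrow>
        (\<exists>z. (\<forall>f\<in>F. f z = 0) \<and> p z \<noteq> 0))" by (intro exI[of _ p] conjI)
    with neg show False by (rule notE)
  qed
  define Y where "Y = {f. Vector_Spaces.linear smul (*) f \<and> continuous_on UNIV f}"
  have lin: "Vector_Spaces.linear smul (*) f" if "f \<in> Y" for f using that by (simp add: Y_def)
  have "weak_topology smul"
    unfolding weak_topology_def
  proof (intro exI[of _ Y] conjI ballI allI impI)
    show "Vector_Spaces.linear smul (*) f" if "f \<in> Y" for f using that by (rule lin)
    show "(\<lambda>x. 0) \<in> Y" by (auto simp: Y_def intro!: linear_to_fieldI)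
    fix f assume f: "f \<in> Y"
    note f_simps = linear_to_field_add[OF lin[OF f]] linear_to_field_scale[OF lin[OF f]]
    have cf: "continuous_on UNIV f" using f by (simp add: Y_def)
    show "(\<lambda>x. c * f x) \<in> Y" for c
      unfolding Y_def
    proof (intro CollectI conjI linear_to_fieldI)
      show "continuous_on UNIV (\<lambda>x. c * f x)" by (intro continuous_intros cf)
    qed (simp_all add: f_simps algebra_simps)
    fix g assume g: "g \<in> Y"
    note g_simps = linear_to_field_add[OF lin[OF g]] linear_to_field_scale[OF lin[OF g]]
    have cg: "continuous_on UNIV g" using g by (simp add: Y_def)
    show "(\<lambda>x. f x + g x) \<in> Y"
      unfolding Y_def
    proof (intro CollectI conjI linear_to_fieldI)
      show "continuous_on UNIV (\<lambda>x. f x + g x)" by (intro continuous_intros cf cg)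
    qed (simp_all add: f_simps g_simps algebra_simps)
  next
    fix x y :: 'b assume "x \<noteq> y"
    then obtain U where U: "open U" "x \<in> U" "y \<notin> U" using hausdorff[of x y] by blast
    then obtain p where p: "cont_seminorm smul p" "\<And>z. p (z - x) < 1 \<Longrightarrow> z \<in> U"
      using gauge_exists_at by blast
    have ne: "p (y - x) \<noteq> 0" using p(2)[of y] U(3) by auto
    have "seminorm smul p" using p(1) by (simp add: cont_seminorm_def)
    with nf ne have "\<exists>f. Vector_Spaces.linear smul (*) f \<and> (\<forall>x. norm (f x) \<le> p x) \<and> f (y - x) \<noteq> 0"
      unfolding norming_functionals_def by blast
    then obtain f where f: "Vector_Spaces.linear smul (*) f" "\<And>x. norm (f x) \<le> p x"
      "f (y - x) \<noteq> 0" by blast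
    have "f \<in> Y" using f(1) linear_bounded_continuous[OF f(1) p(1) f(2)] by (simp add: Y_def)
    moreover have "f x \<noteq> f y" using f(3) linear_to_field_diff[OF f(1), of y x] by simp
    ultimately show "\<exists>f\<in>Y. f x \<noteq> f y" by blast
  next
    fix S :: "'b set"
    let ?G = "{f -` U |f U. f \<in> Y \<and> open U}"
    show "open S \<longleftrightarrow> generate_topology ?G S"
    proof
      assume "generate_topology ?G S"
      then show "open S"
        by induction (auto simp: Y_def continuous_on_open_vimage)
    next
      assume S: "open S"
      have "\<exists>N. generate_topology ?G N \<and> x \<in> N \<and> N \<subseteq> S" if "x \<in> S" for x
      proof -
        obtain p where p: "cont_seminorm smul p" "\<And>z. p (z - x) < 1 \<Longrightarrow> z \<in> S"
          using gauge_exists_at[OF S \<open>x \<in> S\<close>] by blast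
        from *[OF p(1)] obtain F where F0: "finite F \<and>
          (\<forall>f\<in>F. Vector_Spaces.linear smul (*) f \<and> continuous_on UNIV f) \<and>
          (\<forall>z. (\<forall>f\<in>F. f z = 0) \<longrightarrow> p z = 0)" by (rule exE)
        have F: "finite F" "\<And>f. f \<in> F \<Longrightarrow> f \<in> Y"
          "\<And>z. (\<And>f. f \<in> F \<Longrightarrow> f z = 0) \<Longrightarrow> p z = 0"
          using F0 by (simp_all add: Y_def)
        have "\<exists>C\<ge>0. \<forall>x. p x \<le> C * (\<Sum>f\<in>F. norm (f x))"
          using p(1)
          by (intro seminorm_le_functionals[OF F(1) lin[OF F(2)]] F(3)) (simp_all add: cont_seminorm_def)
        then obtain C where C: "C \<ge> 0" "\<And>x. p x \<le> C * (\<Sum>f\<in>F. norm (f x))" by blast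
        \<comment> \<open>Adding 1 to \<open>C\<close> keeps the quotient meaningful for
          \<open>C = 0\<close>; adding 1 to the cardinality makes the final estimate strict and
          covers the empty family.\<close>
        define e where "e = 1 / ((C + 1) * (card F + 1))"
        have e: "e > 0" using C by (simp add: e_def)
        define N where "N = {y. \<forall>f\<in>F. y \<in> f -` ball (f x) e}"
        have "generate_topology ?G N"
          unfolding N_def using F(1)
          by (rule generate_topology_Ball_finite) (use F(2) in \<open>auto intro!: generate_topology.Basis\<close>)
        moreover have "x \<in> N" using e by (simp add: N_def)
        moreover have "z \<in> S" if "z \<in> N" for z
        proof (rule p(2))
          have "(\<Sum>f\<in>F. norm (f (z - x))) \<le> (\<Sum>f\<in>F. e)"
          proof (rule sum_mono)
            fix f assume "f \<in> F"
            then show "norm (f (z - x)) \<le> e"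
              using that by (auto simp: N_def dist_norm linear_to_field_diff[OF lin[OF F(2)]]
                  norm_minus_commute intro!: less_imp_le)
          qed
          then have "p (z - x) \<le> C * (card F * e)"
            using C(1) by (intro order_trans[OF C(2)] mult_left_mono) auto
          also have "\<dots> \<le> (C + 1) * (card F * e)" using e by (intro mult_right_mono) auto
          also have "\<dots> < (C + 1) * ((card F + 1) * e)"
            using C(1) e by (intro mult_strict_left_mono) (auto simp: algebra_simps)
          also have "\<dots> = 1" using C(1) by (simp add: e_def)
          finally show "p (z - x) < 1" .
        qed
        ultimately show ?thesis by blast
      qed
      then have "\<exists>N. \<forall>x\<in>S. generate_topology ?G (N x) \<and> x \<in> N x \<and> N x \<subseteq> S"
        by (intro bchoice ballI)
      then obtain N where N: "\<forall>x\<in>S. generate_topology ?G (N x) \<and> x \<in> N x \<and> N x \<subseteq> S"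
        by (rule exE)
      have "S = \<Union> (N ` S)" using N by blast
      moreover have "generate_topology ?G (\<Union> (N ` S))"
        using N by (intro generate_topology.UN) auto
      ultimately show "generate_topology ?G S" by simp
    qed
  qed
  with nw show False by blast
qed

section \<open>Banach discs\<close>

text \<open>Completeness of ell_1 in coordinates: an absolutely convergent series of ell_1 sequences
  may be summed entry by entry. The norm bound comes from exchanging finite sums over
  \<open>j\<close> with the series over \<open>k\<close>.\<close>

lemma ell1_series:
  fixes a :: "nat \<Rightarrow> nat \<Rightarrow> 'k::banach"
  assumes a: "\<And>k. summable (\<lambda>j. norm (a k j))" "\<And>k. (\<Sum>j. norm (a k j)) \<le> e k"
    and e: "summable e"
  shows "summable (\<lambda>k. a k j)"
    and "summable (\<lambda>j. norm (\<Sum>k. a k j))"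
    and "(\<Sum>j. norm (\<Sum>k. a k j)) \<le> suminf e"
proof -
  have le: "(\<Sum>j\<in>J. norm (a k j)) \<le> e k" if "finite J" for k J
    using sum_le_suminf[OF a(1) that, of k] a(2)[of k] by (auto intro: order_trans)
  have sn: "summable (\<lambda>k. norm (a k j))" for j
    by (rule summable_comparison_test'[OF e]) (use le[of "{j}"] in auto)
  show "summable (\<lambda>k. a k j)" for j by (rule summable_norm_cancel[OF sn])
  have bd: "(\<Sum>j<n. norm (\<Sum>k. a k j)) \<le> suminf e" for n
  proof -
    have "(\<Sum>j<n. norm (\<Sum>k. a k j)) \<le> (\<Sum>j<n. \<Sum>k. norm (a k j))"
      by (intro sum_mono summable_norm sn)
    also have "\<dots> = (\<Sum>k. \<Sum>j<n. norm (a k j))" by (intro suminf_sum[symmetric] sn)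
    also have "\<dots> \<le> suminf e" by (intro suminf_le summable_sum sn e le) simp
    finally show ?thesis .
  qed
  show "summable (\<lambda>j. norm (\<Sum>k. a k j))"
    by (rule summableI_nonneg_bounded[OF _ bd]) simp
  then show "(\<Sum>j. norm (\<Sum>k. a k j)) \<le> suminf e"
    by (rule suminf_le_const) (rule bd)
qed

text \<open>Image of the closed ball of radius \<open>e\<close> of ell_1 under the map that sends
  \<open>a\<close> to the sum of the \<open>smul (a n) (x n)\<close>. This map may fail to be
  injective; one coefficient sequence of norm at most \<open>e\<close> suffices.\<close>

definition ell1_disc ::
    "('k::real_normed_field \<Rightarrow> 'x::{ab_group_add, topological_space} \<Rightarrow> 'x) \<Rightarrow>
      (nat \<Rightarrow> 'x) \<Rightarrow> real \<Rightarrow> 'x set" where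
  "ell1_disc smul x e =
    {y. \<exists>a. summable (\<lambda>n. norm (a n)) \<and> (\<Sum>n. norm (a n)) \<le> e \<and> (\<lambda>n. smul (a n) (x n)) sums y}"

text \<open>The sets \<open>B e\<close> are the balls of a Banach disc; they are used instead of a norm on its span.\<close>

locale banach_disc = locally_convex_space smul
  for smul :: "'k::{real_normed_field, banach} \<Rightarrow> 'x::{t2_space, topological_ab_group_add} \<Rightarrow> 'x" +
  fixes B :: "real \<Rightarrow> 'x set"
  assumes disc_add: "y \<in> B d \<Longrightarrow> z \<in> B e \<Longrightarrow> y + z \<in> B (d + e)"
    and disc_scale: "y \<in> B e \<Longrightarrow> smul c y \<in> B (norm c * e)"
    and disc_mono: "y \<in> B d \<Longrightarrow> d \<le> e \<Longrightarrow> y \<in> B e"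
    and disc_zero: "0 \<in> B 0"
    and disc_nonneg: "y \<in> B e \<Longrightarrow> 0 \<le> e"
    and disc_bounded: "cont_seminorm smul p \<Longrightarrow> \<exists>M\<ge>0. \<forall>e. \<forall>y\<in>B e. p y \<le> M * e"
    and disc_series: "(\<And>n. ys n \<in> B (es n)) \<Longrightarrow> summable es \<Longrightarrow> \<exists>s\<in>B (suminf es). ys sums s"

text \<open>The balls inherit completeness from ell_1. Given a series with summable radii, the
  coefficient sequences are added in ell_1, and the limit vector exists because \<open>x\<close> is
  an ell_1-sequence; completeness of X does not enter.\<close>

lemma banach_disc_ell1_disc:
  fixes smul :: "'k::{real_normed_field, banach} \<Rightarrow> 'x::{t2_space, topological_ab_group_add} \<Rightarrow> 'x"
  assumes "locally_convex_space smul" and x: "ell1_sequence smul x"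
  shows "banach_disc smul (ell1_disc smul x)"
proof -
  interpret locally_convex_space smul by fact
  let ?B = "ell1_disc smul x"
  have discI: "y \<in> ?B e" if "summable (\<lambda>n. norm (a n))" "(\<Sum>n. norm (a n)) \<le> e"
    "(\<lambda>n. smul (a n) (x n)) sums y" for a y e
    using that by (auto simp: ell1_disc_def)
  have discE: thesis if "y \<in> ?B e" "\<And>a. summable (\<lambda>n. norm (a n)) \<Longrightarrow> (\<Sum>n. norm (a n)) \<le> e \<Longrightarrow>
    (\<lambda>n. smul (a n) (x n)) sums y \<Longrightarrow> thesis" for y e thesis
    using that by (auto simp: ell1_disc_def)
  have diff: "(\<lambda>n. f n - g n) sums (s - t)" if "f sums s" "g sums t" for f g :: "nat \<Rightarrow> 'x" and s t
    using that unfolding sums_def by (simp add: sum_subtractf tendsto_diff)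
  have nonneg: "0 \<le> e" if ye: "y \<in> ?B e" for y e
    proof -
    obtain a where "summable (\<lambda>n. norm (a n))" "(\<Sum>n. norm (a n)) \<le> e"
      "(\<lambda>n. smul (a n) (x n)) sums y" by (rule discE[OF ye])
    then show ?thesis using suminf_nonneg[of "\<lambda>n. norm (a n)"] by simp
  qed
  have bounded: "\<exists>M\<ge>0. \<forall>e. \<forall>y\<in>?B e. p y \<le> M * e" if p: "cont_seminorm smul p" for p
  proof -
    have s: "seminorm smul p" using p by (simp add: cont_seminorm_def)
    have "(\<lambda>n. p (x n - 0)) \<longlonglongrightarrow> 0"
      using x by (intro cont_seminorm_tendsto_zero[OF p]) (simp add: ell1_sequence_def)
    then have "Bseq (\<lambda>n. p (x n))" by (intro convergent_imp_Bseq convergentI) simp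
    then obtain M where M: "M > 0" "\<forall>n. norm (p (x n)) \<le> M" by (rule BseqE)
    have "p y \<le> M * e" if y: "y \<in> ?B e" for y e
    proof -
      obtain a where a: "summable (\<lambda>n. norm (a n))" "(\<Sum>n. norm (a n)) \<le> e"
        "(\<lambda>n. smul (a n) (x n)) sums y" by (rule discE[OF y])
      have "p (\<Sum>n<N. smul (a n) (x n)) \<le> M * e" for N
      proof -
        have "p (\<Sum>n<N. smul (a n) (x n)) \<le> (\<Sum>n<N. norm (a n) * p (x n))"
          using seminorm_sum[OF s, of "\<lambda>n. smul (a n) (x n)" "{..<N}"] by (simp add: seminorm_scale[OF s])
        also have "\<dots> \<le> (\<Sum>n<N. norm (a n) * M)"
          using M(2) by (intro sum_mono mult_left_mono) (auto simp: abs_le_iff)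
        also have "\<dots> = M * (\<Sum>n<N. norm (a n))" by (simp add: sum_distrib_left mult.commute)
        also have "(\<Sum>n<N. norm (a n)) \<le> e"
          using sum_le_suminf[OF a(1), of "{..<N}"] a(2) by simp
        finally show ?thesis using M(1) by simp
      qed
      moreover have "(\<lambda>N. p (\<Sum>n<N. smul (a n) (x n))) \<longlonglongrightarrow> p y"
      proof (rule isCont_tendsto_compose[of _ p])
        show "isCont p y"
          using cont_seminorm_continuous[OF p] by (simp add: continuous_on_eq_continuous_at)
        show "(\<lambda>N. \<Sum>n<N. smul (a n) (x n)) \<longlonglongrightarrow> y" using a(3) by (simp add: sums_def)
      qed
      ultimately show ?thesis by (intro LIMSEQ_le_const2) auto
    qed
    then show ?thesis using M(1) by (intro exI[of _ M]) auto
  qed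
  show ?thesis
  proof unfold_locales
    fix y z d e assume y: "y \<in> ?B d" and z: "z \<in> ?B e"
    obtain a where a: "summable (\<lambda>n. norm (a n))" "(\<Sum>n. norm (a n)) \<le> d"
      "(\<lambda>n. smul (a n) (x n)) sums y" by (rule discE[OF y])
    obtain b where b: "summable (\<lambda>n. norm (b n))" "(\<Sum>n. norm (b n)) \<le> e"
      "(\<lambda>n. smul (b n) (x n)) sums z" by (rule discE[OF z])
    have ab: "summable (\<lambda>n. norm (a n + b n))"
      by (rule summable_comparison_test'[OF summable_add[OF a(1) b(1)]])
        (simp add: norm_triangle_ineq)
    show "y + z \<in> ?B (d + e)"
    proof (rule discI[OF ab])
      have "(\<Sum>n. norm (a n + b n)) \<le> (\<Sum>n. norm (a n) + norm (b n))"
        by (intro suminf_le ab summable_add a b norm_triangle_ineq)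
      then show "(\<Sum>n. norm (a n + b n)) \<le> d + e"
        using a(2) b(2) suminf_add[OF a(1) b(1)] by simp
      show "(\<lambda>n. smul (a n + b n) (x n)) sums (y + z)"
        using sums_add[OF a(3) b(3)] by (simp add: scale_left_distrib)
    qed
  next
    fix y e c assume y: "y \<in> ?B e"
    obtain a where a: "summable (\<lambda>n. norm (a n))" "(\<Sum>n. norm (a n)) \<le> e"
        "(\<lambda>n. smul (a n) (x n)) sums y" by (rule discE[OF y])
    show "smul c y \<in> ?B (norm c * e)"
    proof (rule discI[of "\<lambda>n. c * a n"])
      show "summable (\<lambda>n. norm (c * a n))" using a(1) by (simp add: norm_mult summable_mult)
      show "(\<Sum>n. norm (c * a n)) \<le> norm c * e"
        using a by (simp add: norm_mult suminf_mult mult_left_mono)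
      have "isCont (smul c) y"
        using continuous_scale_right[of c] by (simp add: continuous_on_eq_continuous_at)
      then have "(\<lambda>N. smul c (\<Sum>n<N. smul (a n) (x n))) \<longlonglongrightarrow> smul c y"
        using a(3) unfolding sums_def by (rule isCont_tendsto_compose[of _ "smul c"])
      then show "(\<lambda>n. smul (c * a n) (x n)) sums smul c y"
        unfolding sums_def scale_sum_right scale_scale .
    qed
  next
    fix y d e assume y: "y \<in> ?B d" and "d \<le> e"
    show "y \<in> ?B e" by (rule discE[OF y], rule discI) (use \<open>d \<le> e\<close> in auto)
  next
    show "0 \<in> ?B 0" by (rule discI[of "\<lambda>_. 0"]) auto
  next
    fix y e assume "y \<in> ?B e"
    then show "0 \<le> e" by (rule nonneg)
  next
    fix p assume "cont_seminorm smul p"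
    then show "\<exists>M\<ge>0. \<forall>e. \<forall>y\<in>?B e. p y \<le> M * e" by (rule bounded)
  next
    fix y :: "nat \<Rightarrow> 'x" and e :: "nat \<Rightarrow> real"
    assume y: "\<And>n. y n \<in> ?B (e n)" and e: "summable e"
    have "\<forall>k. \<exists>a. summable (\<lambda>n. norm (a n)) \<and> (\<Sum>n. norm (a n)) \<le> e k \<and>
      (\<lambda>n. smul (a n) (x n)) sums y k" using y by (simp add: ell1_disc_def)
    then obtain a where "\<forall>k. summable (\<lambda>n. norm (a k n)) \<and> (\<Sum>n. norm (a k n)) \<le> e k \<and>
      (\<lambda>n. smul (a k n) (x n)) sums y k" by (rule choice[THEN exE])
    then have a: "\<And>k. summable (\<lambda>n. norm (a k n))" "\<And>k. (\<Sum>n. norm (a k n)) \<le> e k"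
      "\<And>k. (\<lambda>n. smul (a k n) (x n)) sums y k" by auto
    define A where "A j = (\<Sum>k. a k j)" for j
    note A = ell1_series[OF a(1,2) e, folded A_def]
    obtain s where s: "(\<lambda>j. smul (A j) (x j)) sums s"
      using x A(2) unfolding ell1_sequence_def summable_def[of "\<lambda>j. smul (A j) (x j)", symmetric]
      by (meson summable_sums)
    have "s \<in> ?B (suminf e)" by (rule discI[OF A(2,3) s])
    \<comment> \<open>The tail has explicit ell_1 coefficients, so it lies in a ball whose radius
      tends to 0; seminorms are bounded on balls, which gives convergence in X.\<close>
    moreover have tail: "s - (\<Sum>k<K. y k) \<in> ?B (\<Sum>k. e (k + K))" for K
    proof (rule discI)
      have e': "summable (\<lambda>k. e (k + K))" using e by (simp add: summable_iff_shift)
      note A' = ell1_series[of "\<lambda>k. a (k + K)" "\<lambda>k. e (k + K)", OF a(1) a(2) e']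
      show "summable (\<lambda>j. norm (\<Sum>k. a (k + K) j))" "(\<Sum>j. norm (\<Sum>k. a (k + K) j)) \<le> (\<Sum>k. e (k + K))"
        by (rule A')+
      have "(\<lambda>j. smul (\<Sum>k<K. a k j) (x j)) sums (\<Sum>k<K. y k)"
        unfolding scale_sum_left by (intro sums_sum a(3))
      from diff[OF s this] show "(\<lambda>j. smul (\<Sum>k. a (k + K) j) (x j)) sums (s - (\<Sum>k<K. y k))"
        by (simp add: scale_left_diff_distrib[symmetric] suminf_minus_initial_segment[OF A(1)] A_def)
    qed
    have "y sums s" unfolding sums_def
    proof (rule tendsto_cont_seminormI)
      fix p assume p: "cont_seminorm smul p"
      then have sp: "seminorm smul p" by (simp add: cont_seminorm_def)
      obtain M where M: "M \<ge> 0" "\<And>e y. y \<in> ?B e \<Longrightarrow> p y \<le> M * e" using bounded[OF p] by blast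
      have "(\<lambda>K. suminf e - (\<Sum>k<K. e k)) \<longlonglongrightarrow> suminf e - suminf e"
        by (intro tendsto_diff tendsto_const summable_LIMSEQ e)
      then have "(\<lambda>K. \<Sum>k. e (k + K)) \<longlonglongrightarrow> 0" by (simp add: suminf_minus_initial_segment[OF e])
      then have lim: "(\<lambda>K. M * (\<Sum>k. e (k + K))) \<longlonglongrightarrow> 0" by (rule tendsto_mult_right_zero)
      show "(\<lambda>K. p ((\<Sum>k<K. y k) - s)) \<longlonglongrightarrow> 0"
      proof (rule tendsto_sandwich[OF _ _ tendsto_const lim]; intro always_eventually allI)
        show "0 \<le> p ((\<Sum>k<K. y k) - s)" for K by (rule seminorm_nonneg[OF sp])
        show "p ((\<Sum>k<K. y k) - s) \<le> M * (\<Sum>k. e (k + K))" for K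
          unfolding seminorm_diff_commute[OF sp, of _ s] by (rule M(2)[OF tail])
      qed
    qed
    ultimately show "\<exists>s\<in>?B (suminf e). y sums s" by blast
  qed
qed

lemma (in topological_vector_space) ell1_disc_member: "x n \<in> ell1_disc smul x 1"
  unfolding ell1_disc_def
proof (intro CollectI exI conjI)
  let ?a = "\<lambda>j. if j = n then 1 else 0 :: 'k"
  have *: "(\<lambda>j. norm (?a j)) sums (if n = n then 1 else 0)"
    using sums_single[of n "\<lambda>_. 1 :: real"] by (simp add: if_distrib[of norm] cong: if_cong)
  then show "summable (\<lambda>j. norm (?a j))" "(\<Sum>j. norm (?a j)) \<le> 1"
    by (auto simp: sums_iff)
  have "(\<lambda>j. smul (?a j) (x j)) = (\<lambda>j. if j = n then x j else 0)" by auto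
  then show "(\<lambda>j. smul (?a j) (x j)) sums x n" using sums_single[of n x] by simp
qed

context banach_disc
begin

lemma disc_minus: "y \<in> B e \<Longrightarrow> - y \<in> B e"
  using disc_scale[of y e "-1"] by simp

lemma disc_zero': "0 \<le> e \<Longrightarrow> 0 \<in> B e"
  using disc_mono[OF disc_zero] .

lemma disc_sum: "(\<And>a. a \<in> A \<Longrightarrow> f a \<in> B (e a)) \<Longrightarrow> sum f A \<in> B (sum e A)"
  by (induction A rule: infinite_finite_induct) (auto simp: disc_zero disc_add)

lemma disc_scale_le: "y \<in> B e \<Longrightarrow> norm c * e \<le> d \<Longrightarrow> smul c y \<in> B d"
  by (rule disc_mono[OF disc_scale])

text \<open>Closeness measured by the disc is stronger than closeness in X, since continuous
  seminorms are bounded on the balls. The mixing estimates are therefore made in the disc and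
  transferred to open sets by this lemma.\<close>

lemma disc_nhds:
  assumes "open V" "v \<in> V"
  shows "\<exists>e>0. \<forall>y. y - v \<in> B e \<longrightarrow> y \<in> V"
proof -
  obtain p where p: "cont_seminorm smul p" "\<And>y. p (y - v) < 1 \<Longrightarrow> y \<in> V"
    using gauge_exists_at[OF assms] by blast
  obtain M where M: "M \<ge> 0" "\<And>e y. y \<in> B e \<Longrightarrow> p y \<le> M * e" using disc_bounded[OF p(1)] by blast
  have "M * (1 / (M + 1)) < 1" using M(1) by simp
  then have "y \<in> V" if "y - v \<in> B (1 / (M + 1))" for y
    using M(2)[OF that] by (intro p(2)) simp
  then show ?thesis using M(1) by (intro exI[of _ "1 / (M + 1)"]) auto
qed

definition disc_span :: "'x set" where
  "disc_span = {y. \<exists>e. y \<in> B e}"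

lemma disc_spanI: "y \<in> B e \<Longrightarrow> y \<in> disc_span"
  by (auto simp: disc_span_def)

lemma disc_spanE: "y \<in> disc_span \<Longrightarrow> (\<And>e. e \<ge> 0 \<Longrightarrow> y \<in> B e \<Longrightarrow> P) \<Longrightarrow> P"
  using disc_nonneg by (auto simp: disc_span_def)

lemma subspace_disc_span: "subspace disc_span"
  unfolding subspace_def disc_span_def using disc_zero disc_add disc_scale by blast

end

section \<open>Biorthogonal systems\<close>

lemma (in topological_vector_space) cont_seminorm_dominated:
  assumes q: "seminorm smul q" and le: "\<And>x. q x \<le> K * p x" and p: "cont_seminorm smul p"
  shows "cont_seminorm smul q"
proof -
  have s: "seminorm smul p" using p by (simp add: cont_seminorm_def)
  obtain S where S: "open S" "0 \<in> S" "\<And>y. y \<in> S \<Longrightarrow> p (y - 0) < 1 / (\<bar>K\<bar> + 1)"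
    using cont_seminorm_small[OF p, of "1 / (\<bar>K\<bar> + 1)" 0]
    by (auto simp: eventually_nhds add_nonneg_pos)
  have "q y \<le> 1" if "y \<in> S" for y
  proof -
    have "q y \<le> (\<bar>K\<bar> + 1) * p y"
      using le[of y] mult_right_mono[of K "\<bar>K\<bar> + 1" "p y"] seminorm_nonneg[OF s, of y] by linarith
    also have "\<dots> \<le> 1" using S(3)[OF that] by (simp add: field_simps)
    finally show ?thesis .
  qed
  then show ?thesis using q S by (auto simp: cont_seminorm_def)
qed

lemma (in locally_convex_space) closure_subspace_UNIV:
  assumes x: "closure (span X) = UNIV" and S: "subspace S"
    and approx: "\<And>v q e. v \<in> X \<Longrightarrow> cont_seminorm smul q \<Longrightarrow> e > 0 \<Longrightarrow> \<exists>y\<in>S. q (y - v) < e"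
  shows "closure S = UNIV"
proof (rule closure_eq_UNIV_I)
  fix v q and e :: real assume q: "cont_seminorm smul q" and e: "e > 0"
  have s: "seminorm smul q" using q by (simp add: cont_seminorm_def)
  have span: "\<forall>e>0. \<exists>y\<in>S. q (y - u) < e" if "u \<in> span X" for u
    using that
  proof (induction rule: span_induct_alt)
    case base
    show ?case using S by (auto intro!: bexI[of _ 0] simp: subspace_0 seminorm_zero[OF s])
  next
    case (step c a u)
    show ?case
    proof (intro allI impI)
      fix e :: real assume "e > 0"
      then obtain y z where y: "y \<in> S" "q (y - u) < e / 2"
        and z: "z \<in> S" "q (z - a) < e / (2 * (norm c + 1))"
        using step approx[OF step(1) q, of "e / (2 * (norm c + 1))"]
        by (metis add_nonneg_pos divide_pos_pos half_gt_zero mult_pos_pos norm_ge_zero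
            zero_less_numeral zero_less_one)
      have "q (smul c z + y - (smul c a + u)) = q (smul c (z - a) + (y - u))"
        by (simp add: scale_right_diff_distrib algebra_simps)
      also have "\<dots> \<le> norm c * q (z - a) + q (y - u)"
        using seminorm_add[OF s, of "smul c (z - a)" "y - u"] by (simp only: seminorm_scale[OF s])
      also have "\<dots> < e"
      proof -
        have "norm c * q (z - a) \<le> (norm c + 1) * q (z - a)"
          using seminorm_nonneg[OF s, of "z - a"] by (simp add: algebra_simps)
        also have "\<dots> \<le> (norm c + 1) * (e / (2 * (norm c + 1)))"
          using z(2) by (intro mult_left_mono) auto
        also have "\<dots> = e / 2"
          using norm_ge_zero[of c] by (simp add: divide_simps del: norm_ge_zero)
        finally show ?thesis using y(2) by simp
      qed
      finally show "\<exists>w\<in>S. q (w - (smul c a + u)) < e"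
        using S y z by (intro bexI[of _ "smul c z + y"]) (auto intro: subspace_add subspace_scale)
    qed
  qed
  obtain u where u: "u \<in> span X" "q (u - v) < e / 2"
    using closure_eq_UNIV_D[OF x q, of "e / 2" v] e by auto
  obtain y where y: "y \<in> S" "q (y - u) < e / 2" using span[OF u(1)] e half_gt_zero by blast
  have "q (y - v) \<le> q (y - u) + q (u - v)" using seminorm_add[OF s, of "y - u" "u - v"] by simp
  then show "\<exists>y\<in>S. q (y - v) < e" using u y by (intro bexI[of _ y]) auto
qed

context banach_disc
begin

text \<open>One Gram-Schmidt step. \<open>P\<close> projects along the \<open>Y i\<close> onto the
  common kernel of the \<open>f i\<close> and is bounded with respect to \<open>p\<close>. The new
  vector is \<open>P w\<close> plus a small correction from the disc and from that kernel, chosen so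
  that \<open>p\<close> does not vanish at the sum; a norming functional composed with
  \<open>P\<close> then annihilates the old vectors and is still dominated by a multiple of
  \<open>p\<close>.\<close>

lemma biorthogonal_step:
  fixes n :: nat
  assumes nf: "norming_functionals smul" and p: "cont_seminorm smul p"
    and inf: "\<And>F. finite F \<Longrightarrow> (\<And>f. f \<in> F \<Longrightarrow> Vector_Spaces.linear smul (*) f) \<Longrightarrow>
      (\<And>f. f \<in> F \<Longrightarrow> continuous_on UNIV f) \<Longrightarrow> \<exists>z. (\<forall>f\<in>F. f z = 0) \<and> p z \<noteq> 0"
    and dense: "closure (span X) = UNIV" and X: "X \<subseteq> disc_span"
    and Y: "\<And>i. i < n \<Longrightarrow> Y i \<in> disc_span"
    and lin: "\<And>i. i < n \<Longrightarrow> Vector_Spaces.linear smul (*) (f i)"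
    and le: "\<And>i x. i < n \<Longrightarrow> norm (f i x) \<le> M i * p x"
    and bi: "\<And>i j. i < n \<Longrightarrow> j < n \<Longrightarrow> f i (Y j) = (if i = j then 1 else 0)"
    and w: "w \<in> disc_span" and e: "e > 0"
  shows "\<exists>y g K z. y \<in> disc_span \<and> Vector_Spaces.linear smul (*) g \<and> (\<forall>x. norm (g x) \<le> K * p x) \<and>
    (\<forall>i<n. f i y = 0 \<and> g (Y i) = 0) \<and> g y = 1 \<and> z \<in> B e \<and>
    w + z \<in> span (insert y (Y ` {..<n}))"
proof -
  have s: "seminorm smul p" using p by (simp add: cont_seminorm_def)
  define P where "P v = v - (\<Sum>i<n. smul (f i v) (Y i))" for v
  have f_add: "f i (a + b) = f i a + f i b" and f_scale: "f i (smul c a) = c * f i a"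
    and f_diff: "f i (a - b) = f i a - f i b"
    and f_sum: "f i (\<Sum>j<n. h j) = (\<Sum>j<n. f i (h j))" if "i < n" for i a b c and h :: "nat \<Rightarrow> 'x"
    using linear_to_field[OF lin[OF that]] by auto
  have P_add: "P (a + b) = P a + P b" for a b
    by (simp add: P_def f_add scale_left_distrib sum.distrib)
  have P_scale: "P (smul c a) = smul c (P a)" for a c
    by (simp add: P_def f_scale scale_right_diff_distrib scale_sum_right)
  have fP: "f i (P v) = 0" if "i < n" for i v
  proof -
    have "(\<Sum>j<n. f j v * f i (Y j)) = (\<Sum>j<n. if j = i then f j v else 0)"
      using that by (intro sum.cong) (auto simp: bi)
    then show ?thesis using that by (simp add: P_def f_diff f_sum f_scale)
  qed
  have P_fix: "P v = v" if "\<And>i. i < n \<Longrightarrow> f i v = 0" for v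
    using that by (simp add: P_def)
  have PY: "P (Y j) = 0" if "j < n" for j
  proof -
    have "(\<Sum>i<n. smul (f i (Y j)) (Y i)) = (\<Sum>i<n. if i = j then Y i else 0)"
      using that by (intro sum.cong) (auto simp: bi)
    then show ?thesis using that by (simp add: P_def)
  qed
  define K where "K = 1 + (\<Sum>i<n. M i * p (Y i))"
  have pP: "p (P v) \<le> K * p v" for v
  proof -
    have "p (P v) \<le> p v + p (\<Sum>i<n. smul (f i v) (Y i))"
      unfolding P_def by (rule seminorm_diff[OF s])
    also have "p (\<Sum>i<n. smul (f i v) (Y i)) \<le> (\<Sum>i<n. norm (f i v) * p (Y i))"
      using seminorm_sum[OF s, of "\<lambda>i. smul (f i v) (Y i)" "{..<n}"] by (simp add: seminorm_scale[OF s])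
    also have "\<dots> \<le> (\<Sum>i<n. (M i * p v) * p (Y i))"
      by (intro sum_mono mult_right_mono le seminorm_nonneg[OF s]) simp
    also have "\<dots> = (\<Sum>i<n. M i * p (Y i)) * p v"
      unfolding sum_distrib_right by (intro sum.cong) (simp_all add: mult_ac)
    finally show ?thesis by (simp add: K_def algebra_simps)
  qed
  have P_disc: "P v \<in> disc_span" if "v \<in> disc_span" for v
    unfolding P_def
    by (intro subspace_diff[OF subspace_disc_span] that subspace_sum[OF subspace_disc_span]
        subspace_scale[OF subspace_disc_span] Y) simp
  have q: "cont_seminorm smul (\<lambda>v. p (P v))"
  proof (rule cont_seminorm_dominated[OF _ pP p])
    show "seminorm smul (\<lambda>v. p (P v))"
      unfolding seminorm_def P_add P_scale using seminorm_add[OF s] seminorm_scale[OF s] by blast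
  qed
  have "\<exists>z. (\<forall>g\<in>f ` {..<n}. g z = 0) \<and> p z \<noteq> 0"
  proof (rule inf)
    fix g assume "g \<in> f ` {..<n}"
    then obtain i where i: "i < n" "g = f i" by auto
    show "Vector_Spaces.linear smul (*) g" using lin i by simp
    show "continuous_on UNIV g" unfolding i(2)
    proof (rule linear_bounded_continuous[OF lin[OF i(1)] _ order_refl])
      show "cont_seminorm smul (\<lambda>x. norm (f i x))"
      proof (rule cont_seminorm_dominated[OF _ le[OF i(1)] p])
        show "seminorm smul (\<lambda>x. norm (f i x))"
          using i(1) by (simp add: seminorm_def f_add f_scale norm_mult norm_triangle_ineq)
      qed
    qed
  qed simp
  then obtain z0 where z0: "\<And>i. i < n \<Longrightarrow> f i z0 = 0" "p z0 \<noteq> 0" by auto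
  \<comment> \<open>\<open>z0\<close> need not lie in the span of the disc. It is replaced by an
    element \<open>z1\<close> of \<open>span X\<close>, so close to it in the seminorm
    \<open>p (P v)\<close> that \<open>p (P z1)\<close> is still nonzero.\<close>
  have "p (P z0) > 0" using z0 P_fix[of z0] seminorm_nonneg[OF s, of z0] by simp
  from closure_eq_UNIV_D[OF dense q this, of z0]
  obtain z1 where z1: "z1 \<in> span X" "p (P (z1 - z0)) < p (P z0)" by auto
  have "P z0 - P z1 = P (z0 - z1)" using P_add[of "z0 - z1" z1] by simp
  then have "p (P z1) \<noteq> 0"
    using z1(2) seminorm_abs_diff[OF s, of "P z0" "P z1"] seminorm_diff_commute[of "\<lambda>v. p (P v)" z0 z1] q
    by (auto simp: cont_seminorm_def)
  moreover have "P z1 \<in> disc_span"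
    using span_minimal[OF X subspace_disc_span] z1(1) by (intro P_disc) auto
  ultimately obtain e0 where e0: "e0 \<ge> 0" "P z1 \<in> B e0" "p (P z1) \<noteq> 0" by (auto elim: disc_spanE)
  define z2 where "z2 = smul (of_real (e / (e0 + 1))) (P z1)"
  have z2: "z2 \<in> B e"
    unfolding z2_def using e e0
    by (intro disc_scale_le[OF e0(2)]) (simp only: norm_of_real, simp add: field_simps)
  have pz2: "p z2 \<noteq> 0" using e e0 by (simp add: z2_def seminorm_scale[OF s] norm_divide)
  have fz2: "f i z2 = 0" if "i < n" for i using that by (simp add: z2_def f_scale fP)
  \<comment> \<open>Of \<open>z2\<close> and half of \<open>z2\<close> at least one works: they
    differ by a vector at which \<open>p\<close> is nonzero, so \<open>p\<close> cannot vanish at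
    both sums with \<open>P w\<close>.\<close>
  obtain z where z: "z \<in> B e" "\<And>i. i < n \<Longrightarrow> f i z = 0" "p (P w + z) \<noteq> 0"
  proof (cases "p (P w + z2) = 0")
    case False
    then show ?thesis using that z2 fz2 by blast
  next
    case True
    define z3 where "z3 = smul (of_real (1 / 2)) z2"
    have "z2 = z3 + z3" by (simp add: z3_def scale_left_distrib[symmetric] flip: of_real_add)
    then have "z3 = (P w + z2) - (P w + z3)" by simp
    moreover have "p z3 \<noteq> 0" using pz2 by (simp add: z3_def seminorm_scale[OF s] norm_divide)
    ultimately have "p (P w + z3) \<noteq> 0"
      using True seminorm_diff[OF s, of "P w + z2" "P w + z3"] seminorm_nonneg[OF s, of z3] by auto
    moreover have "z3 \<in> B e"
      unfolding z3_def using e by (intro disc_scale_le[OF z2]) (simp add: norm_divide)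
    moreover have "f i z3 = 0" if "i < n" for i using that by (simp add: z3_def f_scale fz2)
    ultimately show ?thesis using that by blast
  qed
  define y where "y = P w + z"
  have fy: "f i y = 0" if "i < n" for i using that by (simp add: y_def f_add fP z(2))
  have py: "p y \<noteq> 0" using z(3) by (simp add: y_def)
  have "\<exists>g. Vector_Spaces.linear smul (*) g \<and> (\<forall>x. norm (g x) \<le> p x) \<and> g y \<noteq> 0"
    using nf s py unfolding norming_functionals_def by blast
  then obtain g where g: "Vector_Spaces.linear smul (*) g" "\<And>x. norm (g x) \<le> p x" "g y \<noteq> 0" by blast
  define h where "h v = g (P v) / g y" for v
  show ?thesis
  proof (intro exI conjI allI impI)
    show "y \<in> disc_span"
      unfolding y_def
      by (rule subspace_add[OF subspace_disc_span P_disc[OF w] disc_spanI[OF z(1)]])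
    show "Vector_Spaces.linear smul (*) h"
      by (rule linear_to_fieldI)
        (simp_all add: h_def P_add P_scale linear_to_field_add[OF g(1)] linear_to_field_scale[OF g(1)]
          add_divide_distrib)
    show "norm (h x) \<le> (K / norm (g y)) * p x" for x
      using order_trans[OF g(2)[of "P x"] pP[of x]] g(3)
      by (simp add: h_def norm_divide divide_simps)
    show "f i y = 0" if "i < n" for i using that by (rule fy)
    show "h (Y i) = 0" if "i < n" for i
      using that by (simp add: h_def PY linear_to_field_zero[OF g(1)])
    show "h y = 1" using g(3) P_fix[OF fy] by (simp add: h_def)
    show "z \<in> B e" by (rule z(1))
    \<comment> \<open>Putting back the part removed by \<open>P\<close> shows that a small
      perturbation of \<open>w\<close> itself lies in the span; density rests on this.\<close>
    have "w + z = y + (\<Sum>i<n. smul (f i w) (Y i))" by (simp add: y_def P_def)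
    also have "\<dots> \<in> span (insert y (Y ` {..<n}))"
      by (intro span_add span_sum span_scale) (auto intro: span_base)
    finally show "w + z \<in> span (insert y (Y ` {..<n}))" .
  qed
qed

text \<open>The step is iterated with \<open>w\<close> running through the \<open>x k\<close>, each
  \<open>k\<close> recurring infinitely often through the pairing function, and with error radius
  \<open>1 / Suc n\<close>; hence every \<open>x k\<close> is approximated from the span of the
  \<open>Y n\<close>. Rescaling the functionals so that \<open>p\<close> itself dominates them costs
  the normalisation, and only nonvanishing on the diagonal is kept.\<close>

lemma biorthogonal_system:
  fixes x :: "nat \<Rightarrow> 'x"
  assumes nf: "norming_functionals smul" and p: "cont_seminorm smul p"
    and inf: "\<And>F. finite F \<Longrightarrow> (\<And>f. f \<in> F \<Longrightarrow> Vector_Spaces.linear smul (*) f) \<Longrightarrow>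
      (\<And>f. f \<in> F \<Longrightarrow> continuous_on UNIV f) \<Longrightarrow> \<exists>z. (\<forall>f\<in>F. f z = 0) \<and> p z \<noteq> 0"
    and dense: "closure (span (range x)) = UNIV" and x: "range x \<subseteq> disc_span"
  shows "\<exists>(Y :: nat \<Rightarrow> 'x) f. range Y \<subseteq> disc_span \<and> (\<forall>n. Vector_Spaces.linear smul (*) (f n)) \<and>
    (\<forall>n v. norm (f n v) \<le> p v) \<and> (\<forall>n m. f n (Y m) = 0 \<longleftrightarrow> n \<noteq> m) \<and>
    closure (span (range Y)) = UNIV"
proof -
  have s: "seminorm smul p" using p by (simp add: cont_seminorm_def)
  \<comment> \<open>States are total functions of which only the first \<open>n\<close> entries
    carry information; later stages leave these entries unchanged.\<close>
  define good where "good n s \<longleftrightarrow> (case s of (Y, f, M) \<Rightarrow>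
      (\<forall>i<n. Y i \<in> disc_span \<and> Vector_Spaces.linear smul (*) (f i) \<and> (\<forall>v. norm (f i v) \<le> M i * p v)) \<and>
      (\<forall>i<n. \<forall>j<n. f i (Y j) = (if i = j then 1 else 0)))"
    for n and s :: "(nat \<Rightarrow> 'x) \<times> (nat \<Rightarrow> 'x \<Rightarrow> 'k) \<times> (nat \<Rightarrow> real)"
  define ext where "ext n s s' \<longleftrightarrow> (case (s, s') of ((Y, f, M), (Y', f', M')) \<Rightarrow>
      (\<forall>i<n. Y' i = Y i \<and> f' i = f i \<and> M' i = M i) \<and>
      (\<exists>z\<in>B (1 / Suc n). x (fst (prod_decode n)) + z \<in> span (Y' ` {..n})))"
    for n and s s' :: "(nat \<Rightarrow> 'x) \<times> (nat \<Rightarrow> 'x \<Rightarrow> 'k) \<times> (nat \<Rightarrow> real)"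
  have "\<exists>S. \<forall>n. good n (S n) \<and> ext n (S n) (S (Suc n))"
  proof (rule dependent_nat_choice)
    show "\<exists>s. good 0 s" by (auto simp: good_def)
  next
    fix s n assume good: "good n s"
    obtain Y f M where S: "s = (Y, f, M)" by (cases s) auto
    have Y: "\<And>i. i < n \<Longrightarrow> Y i \<in> disc_span"
      and lin: "\<And>i. i < n \<Longrightarrow> Vector_Spaces.linear smul (*) (f i)"
      and le: "\<And>i x. i < n \<Longrightarrow> norm (f i x) \<le> M i * p x"
      and bi: "\<And>i j. i < n \<Longrightarrow> j < n \<Longrightarrow> f i (Y j) = (if i = j then 1 else 0)"
      using good by (simp_all add: good_def S)
    have "\<exists>y g K z. y \<in> disc_span \<and> Vector_Spaces.linear smul (*) g \<and> (\<forall>x. norm (g x) \<le> K * p x) \<and>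
      (\<forall>i<n. f i y = 0 \<and> g (Y i) = 0) \<and> g y = 1 \<and> z \<in> B (1 / Suc n) \<and>
      x (fst (prod_decode n)) + z \<in> span (insert y (Y ` {..<n}))"
      by (rule biorthogonal_step[OF nf p inf dense x Y lin le bi]) (use x in auto)
    then obtain y g K z where step: "y \<in> disc_span" "Vector_Spaces.linear smul (*) g"
      "\<And>x. norm (g x) \<le> K * p x" "\<And>i. i < n \<Longrightarrow> f i y = 0 \<and> g (Y i) = 0" "g y = 1"
      "z \<in> B (1 / Suc n)" "x (fst (prod_decode n)) + z \<in> span (insert y (Y ` {..<n}))"
      by blast
    let ?s = "(Y(n := y), f(n := g), M(n := K))"
    have "(Y(n := y)) ` {..n} = insert y (Y ` {..<n})"
      by (auto simp: image_iff)
    then have "ext n s ?s" using step by (auto simp: ext_def S)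
    moreover have "good (Suc n) ?s"
      using step Y lin le bi by (auto simp: good_def less_Suc_eq)
    ultimately show "\<exists>s'. good (Suc n) s' \<and> ext n s s'" by blast
  qed
  then obtain S where S: "\<And>n. good n (S n)" "\<And>n. ext n (S n) (S (Suc n))" by blast
  define YY where "YY n = fst (S n)" for n
  define ff where "ff n = fst (snd (S n))" for n
  define MM where "MM n = snd (snd (S n))" for n
  have S_eq: "S n = (YY n, ff n, MM n)" for n by (simp add: YY_def ff_def MM_def)
  have good: "i < n \<Longrightarrow> YY n i \<in> disc_span" "i < n \<Longrightarrow> Vector_Spaces.linear smul (*) (ff n i)"
    "i < n \<Longrightarrow> norm (ff n i v) \<le> MM n i * p v"
    "i < n \<Longrightarrow> j < n \<Longrightarrow> ff n i (YY n j) = (if i = j then 1 else 0)" for n i j v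
    using S(1)[of n] by (simp_all add: good_def S_eq)
  have ext: "i < n \<Longrightarrow> YY (Suc n) i = YY n i \<and> ff (Suc n) i = ff n i \<and> MM (Suc n) i = MM n i"
    "\<exists>z\<in>B (1 / Suc n). x (fst (prod_decode n)) + z \<in> span (YY (Suc n) ` {..n})" for n i
    using S(2)[of n] by (simp_all add: ext_def S_eq)
  \<comment> \<open>Diagonal choice: entry \<open>i\<close> is fixed from stage \<open>Suc i\<close>
    onwards.\<close>
  define Y where "Y i = YY (Suc i) i" for i
  define f where "f i = ff (Suc i) i" for i
  define M where "M i = MM (Suc i) i" for i
  have stable: "i < n \<Longrightarrow> YY n i = Y i \<and> ff n i = f i \<and> MM n i = M i" for n i
  proof (induction n)
    case (Suc n)
    then show ?case
      using ext(1)[of i n] by (cases "i = n") (auto simp: Y_def f_def M_def)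
  qed simp
  have Y: "Y i \<in> disc_span" and lin: "Vector_Spaces.linear smul (*) (f i)"
    and le: "norm (f i v) \<le> M i * p v" for i v
    using good(1-3)[of i "Suc i"] by (simp_all add: Y_def f_def M_def)
  have bi: "f i (Y j) = (if i = j then 1 else 0)" for i j
    using good(4)[of i "Suc (max i j)" j] stable[of i "Suc (max i j)"] stable[of j "Suc (max i j)"] by simp
  \<comment> \<open>The denominator is positive and at least \<open>M i\<close>, whatever the sign
    of \<open>M i\<close>.\<close>
  define c where "c i = (of_real (1 / (\<bar>M i\<bar> + 1)) :: 'k)" for i
  have c: "c i \<noteq> 0" "norm (c i) = 1 / (\<bar>M i\<bar> + 1)" for i
    by (simp_all add: c_def norm_divide add_nonneg_eq_0_iff flip: of_real_add)
  have approx: "\<exists>z\<in>B (1 / Suc n). x (fst (prod_decode n)) + z \<in> span (range Y)" for n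
  proof -
    have "YY (Suc n) ` {..n} \<subseteq> range Y" using stable[of _ "Suc n"] by auto
    then show ?thesis using ext(2)[of n] span_mono by blast
  qed
  have "closure (span (range Y)) = UNIV"
  proof (rule closure_subspace_UNIV[OF dense subspace_span])
    fix v q and e :: real assume v: "v \<in> range x" and q: "cont_seminorm smul q" and e: "e > 0"
    obtain k where k: "v = x k" using v by blast
    obtain K where K: "K \<ge> 0" "\<And>d y. y \<in> B d \<Longrightarrow> q y \<le> K * d" using disc_bounded[OF q] by blast
    obtain N where N: "K / e < real N" using reals_Archimedean2 by blast
    \<comment> \<open>A stage that treats \<open>x k\<close> and comes no earlier than
      \<open>N\<close>, so that its error is small for \<open>q\<close>.\<close>
    define n where "n = prod_encode (k, N)"
    have n: "N \<le> n" "fst (prod_decode n) = k" by (simp_all add: n_def le_prod_encode_2)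
    obtain z where z: "z \<in> B (1 / Suc n)" "x k + z \<in> span (range Y)" using approx[of n] n by auto
    have "q z \<le> K * (1 / Suc n)" by (rule K(2)[OF z(1)])
    also have "\<dots> < e"
    proof -
      have "K / e < real (Suc n)" using N n(1) by linarith
      then show ?thesis using e by (simp add: field_simps)
    qed
    finally show "\<exists>y\<in>span (range Y). q (y - v) < e" using z(2) k by (intro bexI[of _ "x k + z"]) auto
  qed
  moreover have "Vector_Spaces.linear smul (*) (\<lambda>v. c i * f i v)" for i
    by (rule linear_to_fieldI)
      (simp_all add: linear_to_field_add[OF lin] linear_to_field_scale[OF lin] algebra_simps)
  moreover have "norm (c i * f i v) \<le> p v" for i v
  proof -
    have "norm (f i v) \<le> (\<bar>M i\<bar> + 1) * p v"
      using le[of i v] mult_right_mono[of "M i" "\<bar>M i\<bar> + 1" "p v"] seminorm_nonneg[OF s, of v] by linarith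
    then show ?thesis by (simp add: norm_mult c(2) field_simps)
  qed
  moreover have "c i * f i (Y j) = 0 \<longleftrightarrow> i \<noteq> j" for i j using c(1)[of i] by (simp add: bi)
  ultimately show ?thesis
    using Y by (intro exI[of _ Y] exI[of _ "\<lambda>i v. c i * f i v"]) blast
qed

end

section \<open>The translation kernel\<close>

text \<open>Multi-indices carry the pointwise order, so \<open>{..n}\<close> is a finite box and
  sums of products over it factor by coordinates; \<open>m < n\<close> means
  \<open>m \<le> n\<close> with some coordinate strictly smaller.\<close>

lemma atMost_fun_eq_PiE: "{..n} = PiE UNIV (\<lambda>i. {..n i})" for n :: "'n::finite \<Rightarrow> nat"
  by (auto simp: le_fun_def PiE_def Pi_def)

lemma finite_atMost_fun [simp]: "finite {..n}" for n :: "'n::finite \<Rightarrow> nat"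
  unfolding atMost_fun_eq_PiE by (intro finite_PiE) auto

definition mdeg :: "('n::finite \<Rightarrow> nat) \<Rightarrow> nat" where
  "mdeg n = (\<Sum>i\<in>UNIV. n i)"

lemma mdeg_diff: "m \<le> n \<Longrightarrow> (\<Sum>i\<in>UNIV. n i - m i) = mdeg n - mdeg m"
  unfolding mdeg_def by (rule sum_subtractf_nat) (auto simp: le_fun_def)

lemma mdeg_strict_mono:
  fixes m n :: "'n::finite \<Rightarrow> nat"
  assumes "m < n"
  shows "mdeg m < mdeg n"
proof -
  obtain j where "m j < n j" using assms by (auto simp: less_fun_def le_fun_def not_le)
  then show ?thesis
    unfolding mdeg_def using assms
    by (intro sum_strict_mono_ex1) (auto simp: less_fun_def le_fun_def)
qed

text \<open>The matrix of the translation \<open>f \<mapsto> f(\<cdot> + t)\<close> in the basis of monomials: the coefficient of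
  \<open>z\<^sup>m\<close> in \<open>(z + t)\<^sup>n\<close>.\<close>

definition translation_coeff :: "'k::comm_semiring_1 \<Rightarrow> nat \<Rightarrow> nat \<Rightarrow> 'k" where
  "translation_coeff t n m = of_nat (n choose m) * t ^ (n - m)"

definition shift_kernel :: "'k::comm_semiring_1 ^ 'n::finite \<Rightarrow> ('n \<Rightarrow> nat) \<Rightarrow> ('n \<Rightarrow> nat) \<Rightarrow> 'k" where
  "shift_kernel t n m = (\<Prod>i\<in>UNIV. translation_coeff (t $ i) (n i) (m i))"

text \<open>Gives access to polynomial algebra: an identity between translation coefficients can be
  read off from products of powers of a linear factor.\<close>

lemma translation_coeff_eq_coeff: "translation_coeff t n m = coeff ([:t, 1:] ^ n) m"
proof (cases "m \<le> n")
  case True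
  then show ?thesis by (simp add: translation_coeff_def coeff_linear_poly_power)
next
  case False
  have "degree ([:t, 1:] ^ n) \<le> n" by (rule order_trans[OF degree_power_le]) simp
  with False show ?thesis by (simp add: translation_coeff_def coeff_eq_0 binomial_eq_0)
qed

lemma translation_coeff_eq_0: "n < m \<Longrightarrow> translation_coeff t n m = 0"
  by (simp add: translation_coeff_def binomial_eq_0)

text \<open>With \<open>b = l + j\<close> the two binomials become
  \<open>(a choose l) * ((a - l) choose j)\<close>, and the sum over \<open>j\<close> is the
  binomial expansion of \<open>(s + t) ^ (a - l)\<close>.\<close>

lemma translation_coeff_add:
  "(\<Sum>b\<le>a. translation_coeff s a b * translation_coeff t b l) = translation_coeff (s + t) a l"
proof (cases "l \<le> a")
  case False
  then show ?thesis by (simp add: translation_coeff_eq_0)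
next
  case True
  have "(\<Sum>b\<le>a. translation_coeff s a b * translation_coeff t b l) =
      (\<Sum>b\<in>{l..a}. translation_coeff s a b * translation_coeff t b l)"
    by (intro sum.mono_neutral_right) (auto simp: translation_coeff_eq_0)
  also have "\<dots> = (\<Sum>j\<le>a - l. translation_coeff s a (l + j) * translation_coeff t (l + j) l)"
    by (rule sum.reindex_bij_witness[of _ "\<lambda>j. l + j" "\<lambda>b. b - l"]) (use True in auto)
  also have "\<dots> = (\<Sum>j\<le>a - l. of_nat (a choose l) * (of_nat ((a - l) choose j) * t ^ j * s ^ (a - l - j)))"
  proof (rule sum.cong[OF refl])
    fix j assume "j \<in> {..a - l}"
    then have "(a choose (l + j)) * ((l + j) choose l) = (a choose l) * ((a - l) choose j)"
      using choose_mult[of l "l + j" a] True by simp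
    then have "of_nat (a choose (l + j)) * of_nat ((l + j) choose l) =
        (of_nat (a choose l) * of_nat ((a - l) choose j) :: 'a)"
      by (simp only: of_nat_mult[symmetric])
    moreover have "translation_coeff s a (l + j) * translation_coeff t (l + j) l =
        (of_nat (a choose (l + j)) * of_nat ((l + j) choose l)) * (t ^ j * s ^ (a - l - j))"
      by (simp add: translation_coeff_def mult_ac)
    ultimately show "translation_coeff s a (l + j) * translation_coeff t (l + j) l =
        of_nat (a choose l) * (of_nat ((a - l) choose j) * t ^ j * s ^ (a - l - j))"
      by (simp only: mult.assoc)
  qed
  also have "\<dots> = translation_coeff (s + t) a l"
    by (simp add: translation_coeff_def binomial_ring sum_distrib_left add.commute[of s t])
  finally show ?thesis .
qed

lemma shift_kernel_refl [simp]: "shift_kernel t n n = 1"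
  by (simp add: shift_kernel_def translation_coeff_def)

lemma shift_kernel_eq_0: "\<not> m \<le> n \<Longrightarrow> shift_kernel t n m = 0"
  unfolding shift_kernel_def le_fun_def using translation_coeff_eq_0 not_le
  by (intro prod_zero) (simp, blast)

text \<open>The group law on monomials; the sum over the box is the product over the coordinates of
  the one-variable sums.\<close>

lemma shift_kernel_add:
  "(\<Sum>m\<in>{..n}. shift_kernel s n m * shift_kernel t m l) = shift_kernel (s + t) n l"
  unfolding shift_kernel_def atMost_fun_eq_PiE prod.distrib[symmetric]
  by (subst prod_sum_PiE[symmetric]) (auto simp: translation_coeff_add)

lemma shift_kernel_zero:
  assumes "m < n"
  shows "shift_kernel (0 :: 'k::comm_semiring_1 ^ 'n::finite) n m = 0"
proof -
  from assms obtain j where "m j < n j" by (auto simp: less_fun_def le_fun_def not_le)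
  then have "translation_coeff (0 :: 'k) (n j) (m j) = 0"
    by (simp add: translation_coeff_def power_0_left)
  then show ?thesis unfolding shift_kernel_def zero_index by (intro prod_zero) auto
qed

text \<open>Binomials are at most powers of 2, and exponents add up over the coordinates. The bound
  is phrased with coordinates because the mixing estimate uses the largest one in place of the
  norm.\<close>

lemma norm_shift_kernel_le_coord:
  fixes t :: "'k::real_normed_field ^ 'n::finite"
  assumes mn: "m \<le> n" and r: "\<And>i. norm (t $ i) \<le> r"
  shows "norm (shift_kernel t n m) \<le> 2 ^ mdeg n * r ^ (mdeg n - mdeg m)"
proof -
  have "norm (shift_kernel t n m) = (\<Prod>i\<in>UNIV. norm (translation_coeff (t $ i) (n i) (m i)))"
    by (simp add: shift_kernel_def prod_norm)
  also have "\<dots> \<le> (\<Prod>i\<in>UNIV. 2 ^ n i * r ^ (n i - m i))"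
  proof (intro prod_mono conjI)
    fix i
    have "real (n i choose m i) \<le> real (2 ^ n i)"
      unfolding of_nat_le_iff by (rule binomial_le_pow2)
    then have "real (n i choose m i) \<le> 2 ^ n i" by simp
    then show "norm (translation_coeff (t $ i) (n i) (m i)) \<le> 2 ^ n i * r ^ (n i - m i)"
      unfolding translation_coeff_def norm_mult norm_power norm_of_nat
      by (intro mult_mono power_mono r) auto
  qed simp
  also have "\<dots> = 2 ^ mdeg n * r ^ (mdeg n - mdeg m)"
    by (simp only: prod.distrib power_sum[symmetric] mdeg_diff[OF mn]) (simp add: mdeg_def)
  finally show ?thesis .
qed

lemma norm_shift_kernel_le:
  fixes t :: "'k::real_normed_field ^ 'n::finite"
  shows "m \<le> n \<Longrightarrow> norm (shift_kernel t n m) \<le> 2 ^ mdeg n * norm t ^ (mdeg n - mdeg m)"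
  by (rule norm_shift_kernel_le_coord) (auto intro: Finite_Cartesian_Product.norm_nth_le)

text \<open>If the degree drops by one, \<open>n\<close> exceeds \<open>m\<close> by a unit vector
  in a direction \<open>j\<close> that does not depend on \<open>h\<close>. These are the entries of
  a directional derivative, hence linear in \<open>h\<close>.\<close>

lemma shift_kernel_degree_one:
  fixes m n :: "'n::finite \<Rightarrow> nat"
  assumes mn: "m \<le> n" and deg: "mdeg n = Suc (mdeg m)"
  shows "\<exists>j. \<forall>h :: 'k::comm_semiring_1 ^ 'n. shift_kernel h n m = of_nat (n j) * h $ j"
proof -
  have sum: "(\<Sum>i\<in>UNIV. n i - m i) = 1" using mdeg_diff[OF mn] deg by simp
  then obtain j where j: "n j - m j \<noteq> 0" by (cases "\<forall>j. n j - m j = 0") auto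
  have "(\<Sum>i\<in>UNIV. n i - m i) = (n j - m j) + (\<Sum>i\<in>UNIV - {j}. n i - m i)"
    by (rule sum.remove) auto
  with sum j have nj: "n j - m j = 1" and "(\<Sum>i\<in>UNIV - {j}. n i - m i) = 0" by linarith+
  then have "n i - m i = 0" if "i \<noteq> j" for i using that by simp
  then have ni: "n i = m i" if "i \<noteq> j" for i
    using that le_funD[OF mn, of i] by (simp add: le_antisym)
  have nj: "n j = Suc (m j)" using nj by simp
  have "shift_kernel h n m = of_nat (n j) * h $ j" for h :: "'k ^ 'n"
  proof -
    have "shift_kernel h n m = translation_coeff (h $ j) (n j) (m j) *
        (\<Prod>i\<in>UNIV - {j}. translation_coeff (h $ i) (n i) (m i))"
      unfolding shift_kernel_def by (rule prod.remove) auto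
    also have "(\<Prod>i\<in>UNIV - {j}. translation_coeff (h $ i) (n i) (m i)) = 1"
      by (rule prod.neutral) (auto simp: ni translation_coeff_def)
    finally show ?thesis by (simp add: translation_coeff_def nj)
  qed
  then show ?thesis by blast
qed

text \<open>With \<open>L = z - t\<close>, the left side is the coefficient of \<open>z ^ b\<close>
  in \<open>L ^ a * (1 + L / t) ^ N\<close>. Since \<open>1 + L / t = z / t\<close>, the factor only
  shifts the coefficients of \<open>L ^ a\<close> by \<open>N\<close> and divides them by
  \<open>t ^ N\<close>.\<close>

lemma translation_coeff_cutoff:
  fixes t :: "'k::field_char_0"
  assumes "t \<noteq> 0"
  shows "(\<Sum>i\<le>N. of_nat (N choose i) * inverse t ^ i * translation_coeff (- t) (a + i) b) =
    (if b < N then 0 else inverse t ^ N * translation_coeff (- t) a (b - N))"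
proof -
  define L where "L = [:- t, 1:]"
  have "(\<Sum>i\<le>N. of_nat (N choose i) * inverse t ^ i * translation_coeff (- t) (a + i) b) =
      coeff (L ^ a * (\<Sum>i\<le>N. of_nat (N choose i) * (smult (inverse t) L) ^ i)) b"
    by (simp add: sum_distrib_left coeff_sum translation_coeff_eq_coeff L_def[symmetric] smult_power
        power_add of_nat_poly mult_ac)
  also have "(\<Sum>i\<le>N. of_nat (N choose i) * (smult (inverse t) L) ^ i) = (smult (inverse t) L + 1) ^ N"
    by (simp add: binomial_ring)
  also have "smult (inverse t) L + 1 = monom (inverse t) 1"
    using assms by (simp add: L_def monom_altdef one_pCons)
  also have "L ^ a * monom (inverse t) 1 ^ N = smult (inverse t ^ N) (monom 1 N * L ^ a)"
    by (simp add: monom_power smult_monom_mult mult.commute[of "L ^ a"] smult_monom)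
  also have "coeff \<dots> b = (if b < N then 0 else inverse t ^ N * translation_coeff (- t) a (b - N))"
    by (simp add: coeff_monom_mult translation_coeff_eq_coeff L_def)
  finally show ?thesis .
qed

text \<open>In terms of polynomials, \<open>(z - t)\<^sup>n (1 + (z\<^sub>j - t\<^sub>j) / t\<^sub>j)\<^sup>N = (z - t)\<^sup>n (z\<^sub>j / t\<^sub>j)\<^sup>N\<close>, so that
  the left-hand side has small coefficients when \<open>t\<^sub>j\<close> is large and \<open>N\<close> exceeds the degree of \<open>n\<close>.\<close>

lemma shift_kernel_cutoff:
  fixes t :: "'k::field_char_0 ^ 'n::finite"
  assumes t: "t $ j \<noteq> 0"
  shows "(\<Sum>i\<le>N. of_nat (N choose i) * inverse (t $ j) ^ i * shift_kernel (- t) (n(j := n j + i)) m) =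
    (if m j < N then 0 else inverse (t $ j) ^ N * shift_kernel (- t) n (m(j := m j - N)))"
proof -
  \<comment> \<open>Only coordinate \<open>j\<close> changes in the identity; the factors of all
    other coordinates are common to both sides.\<close>
  define Q where "Q = (\<Prod>i\<in>UNIV - {j}. translation_coeff (- t $ i) (n i) (m i))"
  have K: "shift_kernel (- t) (n(j := a)) (m(j := b)) = translation_coeff (- t $ j) a b * Q" for a b
  proof -
    have "shift_kernel (- t) (n(j := a)) (m(j := b)) = translation_coeff ((- t) $ j) a b *
        (\<Prod>i\<in>UNIV - {j}. translation_coeff ((- t) $ i) ((n(j := a)) i) ((m(j := b)) i))"
      unfolding shift_kernel_def by (subst prod.remove[of _ j]) auto
    also have "(\<Prod>i\<in>UNIV - {j}. translation_coeff ((- t) $ i) ((n(j := a)) i) ((m(j := b)) i)) = Q"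
      unfolding Q_def by (rule prod.cong) auto
    finally show ?thesis by (simp del: fun_upd_apply)
  qed
  have "(\<Sum>i\<le>N. of_nat (N choose i) * inverse (t $ j) ^ i * shift_kernel (- t) (n(j := n j + i)) m) =
    (\<Sum>i\<le>N. of_nat (N choose i) * inverse (t $ j) ^ i * translation_coeff (- (t $ j)) (n j + i) (m j)) * Q"
    unfolding sum_distrib_right using K[of _ "m j"] by (intro sum.cong) auto
  then show ?thesis
    using K[of "n j" "m j - N"] unfolding translation_coeff_cutoff[OF t] by simp
qed

text \<open>The cutoff exponent exceeds the degree of \<open>n\<close> by one: the kernel grows at
  most like the power \<open>mdeg n\<close> of the largest coordinate, the factor in front decays
  with the power \<open>Suc (mdeg n)\<close>, and one negative power survives.\<close>

lemma norm_shift_kernel_cutoff_le: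
  fixes t :: "'k::real_normed_field ^ 'n::finite"
  assumes max: "\<And>i. norm (t $ i) \<le> norm (t $ j)" and ge: "1 \<le> norm (t $ j)"
  shows "norm (\<Sum>i\<le>Suc (mdeg n). of_nat (Suc (mdeg n) choose i) * inverse (t $ j) ^ i *
      shift_kernel (- t) (n(j := n j + i)) m) \<le> 2 ^ mdeg n / norm (t $ j)"
proof -
  let ?N = "Suc (mdeg n)" and ?m = "m(j := m j - Suc (mdeg n))"
  have t: "t $ j \<noteq> 0" using ge by auto
  have "norm (inverse (t $ j) ^ ?N * shift_kernel (- t) n ?m) \<le> 2 ^ mdeg n / norm (t $ j)"
  proof (cases "?m \<le> n")
    case False
    then show ?thesis by (simp add: shift_kernel_eq_0)
  next
    case True
    have "norm (shift_kernel (- t) n ?m) \<le> 2 ^ mdeg n * norm (t $ j) ^ (mdeg n - mdeg ?m)"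
      using True by (intro norm_shift_kernel_le_coord) (auto simp: max)
    also have "\<dots> \<le> 2 ^ mdeg n * norm (t $ j) ^ mdeg n"
      using ge by (intro mult_left_mono power_increasing) auto
    finally have "norm (shift_kernel (- t) n ?m) / norm (t $ j) ^ ?N \<le>
        (2 ^ mdeg n * norm (t $ j) ^ mdeg n) / norm (t $ j) ^ ?N"
      by (rule divide_right_mono) simp
    also have "\<dots> = 2 ^ mdeg n / norm (t $ j)" using t by simp
    finally show ?thesis
      by (simp add: norm_mult norm_power norm_inverse divide_inverse power_inverse mult.commute)
  qed
  then show ?thesis unfolding shift_kernel_cutoff[OF t] by simp
qed

section \<open>The translation group\<close>

lemma (in topological_vector_space) sums_smul:
  assumes "f sums s"
  shows "(\<lambda>n. smul c (f n)) sums smul c s"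
proof -
  have "isCont (smul c) s"
    using continuous_scale_right[of c] by (simp add: continuous_on_eq_continuous_at)
  then have "(\<lambda>N. smul c (\<Sum>n<N. f n)) \<longlonglongrightarrow> smul c s"
    using assms unfolding sums_def by (rule isCont_tendsto_compose[of _ "smul c"])
  then show ?thesis unfolding sums_def scale_sum_right .
qed

text \<open>The vectors \<open>u n\<close> play the role of the monomials \<open>z\<^sup>n\<close>, and \<open>g\<close> is biorthogonal to \<open>u\<close>. The
  enumeration \<open>e\<close> of the multi-indices turns sums over them into series.\<close>

locale monomial_system = banach_disc smul B
  for smul :: "'k::{real_normed_field, banach} \<Rightarrow> 'x::{t2_space, topological_ab_group_add} \<Rightarrow> 'x"
    and B :: "real \<Rightarrow> 'x set" +
  fixes u :: "('n::finite \<Rightarrow> nat) \<Rightarrow> 'x" and g :: "('n \<Rightarrow> nat) \<Rightarrow> 'x \<Rightarrow> 'k"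
    and p :: "'x \<Rightarrow> real" and r \<rho> w :: "('n \<Rightarrow> nat) \<Rightarrow> real" and e :: "nat \<Rightarrow> 'n \<Rightarrow> nat"
  assumes p: "cont_seminorm smul p"
    and e: "bij e"
    and g_linear: "Vector_Spaces.linear smul (*) (g n)"
    and g_le: "norm (g n x) \<le> \<rho> n * p x"
    and g_u: "g n (u m) = (if n = m then 1 else 0)"
    and u_disc: "u n \<in> B (r n)"
    and \<rho>_nonneg: "0 \<le> \<rho> n"
    and weight: "\<rho> n * (\<Sum>m\<in>{..<n}. r m) \<le> w n"
    and weight_summable: "0 \<le> A \<Longrightarrow> summable (\<lambda>k. w (e k) * A ^ mdeg (e k))"
    and dense: "closure (span (range u)) = UNIV"

text \<open>Multiplying a vector by \<open>c n\<close> divides its dual functional by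
  \<open>c n\<close>. If \<open>c m * b n \<le> c n\<close> for all \<open>m < n\<close>, then
  \<open>\<rho> n * r m\<close> is at most \<open>s (d m) / (b n * \<phi> n)\<close>, and
  \<open>b n\<close> is chosen so that the sum of these over \<open>m\<close> is at most
  \<open>w n\<close>.\<close>

lemma (in banach_disc) monomial_system_exists:
  fixes Y :: "nat \<Rightarrow> 'x" and f :: "nat \<Rightarrow> 'x \<Rightarrow> 'k"
  assumes p: "cont_seminorm smul p" and Y: "range Y \<subseteq> disc_span"
    and lin: "\<And>n. Vector_Spaces.linear smul (*) (f n)"
    and le: "\<And>n v. norm (f n v) \<le> p v"
    and bi: "\<And>n m. f n (Y m) = 0 \<longleftrightarrow> n \<noteq> m"
    and dense: "closure (span (range Y)) = UNIV"
  shows "\<exists>(u :: ('n::finite \<Rightarrow> nat) \<Rightarrow> 'x) g p r \<rho> w e. monomial_system smul B u g p r \<rho> w e"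
proof -
  have "infinite (UNIV :: ('n \<Rightarrow> nat) set)" by (simp add: finite_UNIV_fun)
  then have e: "bij (from_nat_into (UNIV :: ('n \<Rightarrow> nat) set))"
    using bij_betw_from_nat_into[of "UNIV :: ('n \<Rightarrow> nat) set"] by simp
  define e where "e = from_nat_into (UNIV :: ('n \<Rightarrow> nat) set)"
  note e = e[folded e_def]
  define d where "d = inv e"
  have de: "d (e k) = k" for k using e by (simp add: d_def bij_is_inj inv_f_f)
  have ed: "e (d n) = n" for n using e by (simp add: d_def bij_is_surj surj_f_inv_f)
  have d_eq: "d n = d m \<longleftrightarrow> n = m" for n m by (auto dest: arg_cong[of _ _ e] simp: ed)
  have "\<forall>n. \<exists>s. Y n \<in> B s" using Y by (auto simp: disc_span_def)
  then obtain s where s: "\<forall>n. Y n \<in> B (s n)" by (rule choice[THEN exE])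
  have s0: "0 \<le> s n" for n using s disc_nonneg by blast
  define \<phi> where "\<phi> n = norm (f (d n) (Y (d n)))" for n
  have \<phi>: "\<phi> n > 0" for n using bi[of "d n" "d n"] by (simp add: \<phi>_def)
  \<comment> \<open>The weight must beat \<open>A ^ mdeg n\<close> for every \<open>A\<close>, since
    \<open>A\<close> grows with the group parameter. The denominator does so as soon as
    \<open>A \<le> 1 + real (d n)\<close>, and the geometric factor then gives summability.\<close>
  define w where "w n = (1 / 2) ^ d n / (1 + real (d n)) ^ mdeg n" for n
  have w: "w n > 0" for n by (simp add: w_def)
  define b where "b n = max 1 ((\<Sum>m\<in>{..<n}. s (d m)) / (\<phi> n * w n))" for n
  have b1: "1 \<le> b n" for n by (simp add: b_def)
  have b2: "(\<Sum>m\<in>{..<n}. s (d m)) \<le> b n * (\<phi> n * w n)" for n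
  proof -
    have "(\<Sum>m\<in>{..<n}. s (d m)) / (\<phi> n * w n) \<le> b n" by (simp add: b_def)
    then show ?thesis using \<phi>[of n] w[of n] by (simp add: divide_le_eq)
  qed
  \<comment> \<open>The product over all predecessors gives the growth along the partial order in
    closed form: all factors are at least 1, so \<open>c m\<close> is at most the product for
    \<open>c n\<close> without the factor \<open>b n\<close>.\<close>
  define c where "c n = (\<Prod>m\<in>{..n}. b m)" for n :: "'n \<Rightarrow> nat"
  have c1: "1 \<le> c n" for n unfolding c_def by (rule prod_ge_1) (rule b1)
  have c0: "0 < c n" for n using c1[of n] by simp
  have cb: "c m * b n \<le> c n" if "m < n" for m n
  proof -
    have "c m \<le> (\<Prod>k\<in>{..n} - {n}. b k)"
      unfolding c_def using that
      by (intro prod_mono2) (auto intro: order_trans[OF _ b1] order_trans[OF zero_le_one b1] b1)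
    then have "c m * b n \<le> b n * (\<Prod>k\<in>{..n} - {n}. b k)"
      using b1[of n] by (simp add: mult.commute mult_left_mono)
    also have "\<dots> = c n" unfolding c_def by (rule prod.remove[symmetric]) auto
    finally show ?thesis .
  qed
  define u where "u n = smul (of_real (c n)) (Y (d n))" for n
  define g where "g n v = f (d n) v / (of_real (c n) * f (d n) (Y (d n)))" for n v
  define r where "r n = c n * s (d n)" for n
  define \<rho> where "\<rho> n = 1 / (c n * \<phi> n)" for n
  have fY: "f n (Y n) \<noteq> 0" for n using bi[of n n] by simp
  have "monomial_system smul B u g p r \<rho> w e"
  proof (intro monomial_system.intro banach_disc_axioms monomial_system_axioms.intro)
    show "cont_seminorm smul p" by (rule p)
    show "bij e" by (rule e)
    fix n :: "'n \<Rightarrow> nat"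
    show "Vector_Spaces.linear smul (*) (g n)"
      by (rule linear_to_fieldI)
        (simp_all add: g_def linear_to_field_add[OF lin] linear_to_field_scale[OF lin] add_divide_distrib)
    show "norm (g n v) \<le> \<rho> n * p v" for v
      using le[of "d n" v] c0[of n] \<phi>[of n]
      by (simp add: g_def \<rho>_def norm_divide norm_mult \<phi>_def[symmetric] divide_right_mono)
    show "g n (u m) = (if n = m then 1 else 0)" for m
      using c0[of n] fY bi[of "d n" "d m"] d_eq[of n m]
      by (auto simp: g_def u_def linear_to_field_scale[OF lin])
    show "u n \<in> B (r n)"
      unfolding u_def r_def using s c0[of n] by (intro disc_scale_le[of _ "s (d n)"]) auto
    show "0 \<le> \<rho> n" using c0[of n] \<phi>[of n] by (simp add: \<rho>_def)
    show "\<rho> n * (\<Sum>m\<in>{..<n}. r m) \<le> w n"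
    proof -
      have "b n * (\<Sum>m\<in>{..<n}. r m) = (\<Sum>m\<in>{..<n}. (c m * b n) * s (d m))"
        by (simp add: r_def sum_distrib_left mult_ac)
      also have "\<dots> \<le> (\<Sum>m\<in>{..<n}. c n * s (d m))"
        by (intro sum_mono mult_right_mono cb s0) auto
      also have "\<dots> = c n * (\<Sum>m\<in>{..<n}. s (d m))" by (simp add: sum_distrib_left)
      also have "\<dots> \<le> c n * (b n * (\<phi> n * w n))" using c0[of n] b2[of n] by simp
      finally have "b n * (\<Sum>m\<in>{..<n}. r m) \<le> b n * (c n * \<phi> n * w n)" by (simp add: mult_ac)
      then have "(\<Sum>m\<in>{..<n}. r m) \<le> c n * \<phi> n * w n" using b1[of n] by simp
      then show ?thesis using c0[of n] \<phi>[of n] by (simp add: \<rho>_def divide_le_eq mult.commute)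
    qed
  next
    fix A :: real assume A: "0 \<le> A"
    show "summable (\<lambda>k. w (e k) * A ^ mdeg (e k))"
    proof (rule summable_comparison_test_ev)
      show "summable (\<lambda>k. (1 / 2 :: real) ^ k)" by (rule summable_geometric) simp
      have "eventually (\<lambda>k. k \<ge> nat \<lceil>A\<rceil>) sequentially" by (rule eventually_ge_at_top)
      then show "eventually (\<lambda>k. norm (w (e k) * A ^ mdeg (e k)) \<le> (1 / 2) ^ k) sequentially"
      proof (rule eventually_mono)
        fix k assume "k \<ge> nat \<lceil>A\<rceil>"
        then have "A \<le> 1 + real k" by linarith
        then have "A ^ mdeg (e k) \<le> (1 + real k) ^ mdeg (e k)" using A by (rule power_mono)
        then have "A ^ mdeg (e k) / (1 + real k) ^ mdeg (e k) \<le> 1" by (simp add: divide_le_eq_1)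
        then have "(1 / 2) ^ k * (A ^ mdeg (e k) / (1 + real k) ^ mdeg (e k)) \<le> (1 / 2) ^ k * 1"
          by (rule mult_left_mono) simp
        then show "norm (w (e k) * A ^ mdeg (e k)) \<le> (1 / 2) ^ k"
          using A by (simp add: w_def de abs_mult power_abs)
      qed
    qed
  next
    show "closure (span (range u)) = UNIV"
    proof -
      have "Y k \<in> span (range u)" for k
      proof -
        have "smul (inverse (of_real (c (e k)))) (u (e k)) \<in> span (range u)"
          by (intro span_scale span_base rangeI)
        moreover have "c (e k) \<noteq> 0" using c0[of "e k"] by simp
        ultimately show ?thesis by (simp add: u_def de)
      qed
      then have "span (range Y) \<subseteq> span (range u)"
        by (intro span_minimal subspace_span) auto
      then show ?thesis using dense closure_mono by blast
    qed
  qed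
  then show ?thesis by blast
qed

section \<open>Operators given by strictly triangular kernels\<close>

context monomial_system
begin

text \<open>Growth like \<open>A ^ mdeg n\<close> is what the weights absorb, for any
  \<open>A\<close>. The constant \<open>C\<close> is kept apart because the size of the operator is
  proportional to it.\<close>

definition band_bounded :: "real \<Rightarrow> real \<Rightarrow> (('n \<Rightarrow> nat) \<Rightarrow> ('n \<Rightarrow> nat) \<Rightarrow> 'k) \<Rightarrow> bool" where
  "band_bounded C A \<kappa> \<longleftrightarrow> 0 \<le> C \<and> 0 \<le> A \<and> (\<forall>n. \<forall>m<n. norm (\<kappa> n m) \<le> C * A ^ mdeg n)"

definition band_row :: "(('n \<Rightarrow> nat) \<Rightarrow> ('n \<Rightarrow> nat) \<Rightarrow> 'k) \<Rightarrow> ('n \<Rightarrow> nat) \<Rightarrow> 'x" where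
  "band_row \<kappa> n = (\<Sum>m\<in>{..<n}. smul (\<kappa> n m) (u m))"

text \<open>The operator that sends \<open>u n\<close> to \<open>band_row \<kappa> n\<close>, as a
  series of rank one operators along the enumeration \<open>e\<close>; as a \<open>suminf\<close> it
  has its intended meaning once convergence is known.\<close>

definition band_op :: "(('n \<Rightarrow> nat) \<Rightarrow> ('n \<Rightarrow> nat) \<Rightarrow> 'k) \<Rightarrow> 'x \<Rightarrow> 'x" where
  "band_op \<kappa> x = (\<Sum>k. smul (g (e k) x) (band_row \<kappa> (e k)))"

definition weight_sum :: "real \<Rightarrow> real" where
  "weight_sum A = (\<Sum>k. w (e k) * A ^ mdeg (e k))"

lemma p_seminorm: "seminorm smul p"
  using p by (simp add: cont_seminorm_def)

lemma p_nonneg: "0 \<le> p x"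
  by (rule seminorm_nonneg[OF p_seminorm])

lemma r_nonneg: "0 \<le> r n"
  by (rule disc_nonneg[OF u_disc])

lemma w_nonneg: "0 \<le> w n"
  by (rule order_trans[OF _ weight]) (intro mult_nonneg_nonneg sum_nonneg r_nonneg \<rho>_nonneg)

lemma finite_lessThan_fun: "finite {..<n}" for n :: "'n \<Rightarrow> nat"
  by (rule finite_subset[of _ "{..n}"]) (auto simp: less_imp_le)

lemma weight_sum_nonneg: "0 \<le> A \<Longrightarrow> 0 \<le> weight_sum A"
  unfolding weight_sum_def by (intro suminf_nonneg weight_summable) (auto simp: w_nonneg)

text \<open>The functional contributes \<open>\<rho> n * p x\<close> and the row
  \<open>C * A ^ mdeg n\<close> times the sum of the \<open>r m\<close>, so \<open>weight\<close>
  and \<open>weight_summable\<close> make the series converge in the disc. The radius is linear in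
  \<open>p x\<close> and in \<open>C\<close>: the first gives continuity and uniformity on a
  neighbourhood of 0, the second gives smallness in the group parameter.\<close>

lemma band_op_sums_disc:
  assumes "band_bounded C A \<kappa>"
  shows "(\<lambda>k. smul (g (e k) x) (band_row \<kappa> (e k))) sums band_op \<kappa> x"
    and "band_op \<kappa> x \<in> B (p x * C * weight_sum A)"
proof -
  have C: "0 \<le> C" and A: "0 \<le> A" and le: "\<And>n m. m < n \<Longrightarrow> norm (\<kappa> n m) \<le> C * A ^ mdeg n"
    using assms by (auto simp: band_bounded_def)
  have row: "smul (g n x) (band_row \<kappa> n) \<in> B (p x * C * (w n * A ^ mdeg n))" for n
  proof -
    have "band_row \<kappa> n \<in> B (\<Sum>m\<in>{..<n}. (C * A ^ mdeg n) * r m)"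
      unfolding band_row_def
      by (intro disc_sum disc_scale_le[OF u_disc] mult_right_mono le r_nonneg) simp
    then show ?thesis
    proof (rule disc_scale_le)
      have "norm (g n x) * (\<Sum>m\<in>{..<n}. (C * A ^ mdeg n) * r m) \<le>
          (\<rho> n * p x) * (\<Sum>m\<in>{..<n}. (C * A ^ mdeg n) * r m)"
        using C A by (intro mult_right_mono g_le sum_nonneg mult_nonneg_nonneg r_nonneg) auto
      also have "\<dots> = (p x * C * A ^ mdeg n) * (\<rho> n * (\<Sum>m\<in>{..<n}. r m))"
        unfolding sum_distrib_left[symmetric] by (simp add: mult_ac)
      also have "\<dots> \<le> (p x * C * A ^ mdeg n) * w n"
        using C A by (intro mult_left_mono weight mult_nonneg_nonneg p_nonneg) auto
      finally show "norm (g n x) * (\<Sum>m\<in>{..<n}. (C * A ^ mdeg n) * r m) \<le> p x * C * (w n * A ^ mdeg n)"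
        by (simp add: mult_ac)
    qed
  qed
  have "summable (\<lambda>k. p x * C * (w (e k) * A ^ mdeg (e k)))"
    by (intro summable_mult weight_summable A)
  from disc_series[of "\<lambda>k. smul (g (e k) x) (band_row \<kappa> (e k))", OF row this]
  obtain s where s: "s \<in> B (\<Sum>k. p x * C * (w (e k) * A ^ mdeg (e k)))"
    "(\<lambda>k. smul (g (e k) x) (band_row \<kappa> (e k))) sums s" by (rule bexE)
  have "s = band_op \<kappa> x" using s(2) by (simp add: band_op_def sums_iff)
  moreover have "(\<Sum>k. p x * C * (w (e k) * A ^ mdeg (e k))) = p x * C * weight_sum A"
    unfolding weight_sum_def by (intro suminf_mult weight_summable A)
  ultimately show "(\<lambda>k. smul (g (e k) x) (band_row \<kappa> (e k))) sums band_op \<kappa> x"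
    and "band_op \<kappa> x \<in> B (p x * C * weight_sum A)" using s by simp_all
qed

lemma band_op_add:
  assumes "band_bounded C A \<kappa>"
  shows "band_op \<kappa> (x + y) = band_op \<kappa> x + band_op \<kappa> y"
proof (rule sums_unique2[OF band_op_sums_disc(1)[OF assms]])
  show "(\<lambda>k. smul (g (e k) (x + y)) (band_row \<kappa> (e k))) sums (band_op \<kappa> x + band_op \<kappa> y)"
    unfolding linear_to_field_add[OF g_linear] scale_left_distrib
    by (intro sums_add band_op_sums_disc(1)[OF assms])
qed

lemma band_op_scale:
  assumes "band_bounded C A \<kappa>"
  shows "band_op \<kappa> (smul c x) = smul c (band_op \<kappa> x)"
proof (rule sums_unique2[OF band_op_sums_disc(1)[OF assms]])
  show "(\<lambda>k. smul (g (e k) (smul c x)) (band_row \<kappa> (e k))) sums smul c (band_op \<kappa> x)"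
    unfolding linear_to_field_scale[OF g_linear] scale_scale[symmetric]
    by (intro sums_smul band_op_sums_disc(1)[OF assms])
qed

lemma band_op_cong:
  assumes "\<And>n m. m < n \<Longrightarrow> \<kappa> n m = \<nu> n m"
  shows "band_op \<kappa> x = band_op \<nu> x"
  unfolding band_op_def band_row_def using assms by simp

lemma band_op_add_kernel:
  assumes "band_bounded C A \<kappa>" "band_bounded D A' \<nu>" "\<And>n m. m < n \<Longrightarrow> \<mu> n m = \<kappa> n m + \<nu> n m"
  shows "band_op \<mu> x = band_op \<kappa> x + band_op \<nu> x"
proof -
  have "band_row \<mu> n = band_row \<kappa> n + band_row \<nu> n" for n
    unfolding band_row_def using assms(3) by (simp add: scale_left_distrib sum.distrib)
  then have "(\<lambda>k. smul (g (e k) x) (band_row \<mu> (e k))) sums (band_op \<kappa> x + band_op \<nu> x)"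
    using sums_add[OF band_op_sums_disc(1)[OF assms(1)] band_op_sums_disc(1)[OF assms(2)], of x x]
    by (simp add: scale_right_distrib)
  then show ?thesis unfolding band_op_def by (simp add: sums_iff)
qed

lemma band_op_scale_kernel:
  assumes "band_bounded C A \<kappa>" "\<And>n m. m < n \<Longrightarrow> \<mu> n m = c * \<kappa> n m"
  shows "band_op \<mu> x = smul c (band_op \<kappa> x)"
proof -
  have "band_row \<mu> n = smul c (band_row \<kappa> n)" for n
    unfolding band_row_def using assms(2) by (simp add: scale_sum_right)
  then have "(\<lambda>k. smul (g (e k) x) (band_row \<mu> (e k))) sums smul c (band_op \<kappa> x)"
    using sums_smul[OF band_op_sums_disc(1)[OF assms(1)], of c x] by (simp add: mult.commute)
  then show ?thesis unfolding band_op_def by (simp add: sums_iff)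
qed

lemma band_op_monomial: "band_op \<kappa> (u n) = band_row \<kappa> n"
proof -
  have k: "e (inv e n) = n" using e by (simp add: bij_is_surj surj_f_inv_f)
  have "smul (g (e i) (u n)) (band_row \<kappa> (e i)) = (if i = inv e n then band_row \<kappa> n else 0)" for i
    using k e by (auto simp: g_u inv_f_f bij_is_inj)
  then have "(\<lambda>i. smul (g (e i) (u n)) (band_row \<kappa> (e i))) sums band_row \<kappa> n"
    using sums_single[of "inv e n" "\<lambda>_. band_row \<kappa> n"] by simp
  then show ?thesis by (simp add: band_op_def sums_iff)
qed

section \<open>The group and its uniform continuity\<close>

text \<open>The diagonal entries of the kernel are 1 and no rescaling of the basis changes them, so
  the identity is split off. The remaining sum maps X into the span of the disc, which the identity
  need not do.\<close>

definition T :: "'k ^ 'n \<Rightarrow> 'x \<Rightarrow> 'x" where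
  "T t x = x + band_op (shift_kernel t) x"

lemma band_bounded_shift_kernel: "band_bounded 1 (2 * max 1 (norm t)) (shift_kernel t)"
  unfolding band_bounded_def
proof (intro conjI allI impI)
  fix m n :: "'n \<Rightarrow> nat" assume "m < n"
  then have "norm (shift_kernel t n m) \<le> 2 ^ mdeg n * norm t ^ (mdeg n - mdeg m)"
    by (intro norm_shift_kernel_le) simp
  also have "\<dots> \<le> 2 ^ mdeg n * max 1 (norm t) ^ (mdeg n - mdeg m)"
    by (intro mult_left_mono power_mono) auto
  also have "\<dots> \<le> 2 ^ mdeg n * max 1 (norm t) ^ mdeg n"
    by (intro mult_left_mono power_increasing) auto
  finally show "norm (shift_kernel t n m) \<le> 1 * (2 * max 1 (norm t)) ^ mdeg n"
    by (simp add: power_mult_distrib)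
qed auto

text \<open>Below the diagonal the degree drops at least by one, so a factor \<open>norm t\<close>
  can be taken out while the base stays 2. Uniform continuity comes from this factor.\<close>

lemma band_bounded_shift_kernel_small:
  assumes "norm t \<le> 1"
  shows "band_bounded (norm t) 2 (shift_kernel t)"
  unfolding band_bounded_def
proof (intro conjI allI impI)
  fix m n :: "'n \<Rightarrow> nat" assume "m < n"
  then have "norm (shift_kernel t n m) \<le> 2 ^ mdeg n * norm t ^ (mdeg n - mdeg m)"
    by (intro norm_shift_kernel_le) simp
  also have "\<dots> \<le> 2 ^ mdeg n * norm t ^ 1"
    using assms mdeg_strict_mono[OF \<open>m < n\<close>] by (intro mult_left_mono power_decreasing) auto
  finally show "norm (shift_kernel t n m) \<le> norm t * 2 ^ mdeg n" by (simp add: mult.commute)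
qed auto

lemma T_add: "T t (x + y) = T t x + T t y"
  by (simp add: T_def band_op_add[OF band_bounded_shift_kernel] algebra_simps)

lemma T_scale: "T t (smul c x) = smul c (T t x)"
  by (simp add: T_def band_op_scale[OF band_bounded_shift_kernel] scale_right_distrib)

lemma T_linear: "Vector_Spaces.linear smul smul (T t)"
  unfolding Vector_Spaces.linear_iff by (simp add: T_add T_scale vector_space_axioms)

lemma T_zero_right: "T t 0 = 0"
  using T_scale[of t 0 0] by simp

lemma T_diff: "T t (x - y) = T t x - T t y"
  using T_add[of t "x - y" y] by simp

lemma T_sum: "T t (sum f A) = (\<Sum>a\<in>A. T t (f a))"
  by (induction A rule: infinite_finite_induct) (auto simp: T_add T_zero_right)

text \<open>\<open>p\<close> is bounded on the balls and the correction takes values in them, so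
  each \<open>T t\<close> acts boundedly on the span of the disc. The constant depends on
  \<open>t\<close>, and the construction of hypercyclic vectors has to compensate for that.\<close>

lemma T_disc: "\<exists>C\<ge>1. \<forall>d. \<forall>y\<in>B d. T t y \<in> B (C * d)"
proof -
  obtain M where M: "M \<ge> 0" "\<And>d y. y \<in> B d \<Longrightarrow> p y \<le> M * d" using disc_bounded[OF p] by blast
  define W where "W = weight_sum (2 * max 1 (norm t))"
  have W: "W \<ge> 0" unfolding W_def by (rule weight_sum_nonneg) simp
  have "T t y \<in> B ((1 + M * W) * d)" if y: "y \<in> B d" for y d
  proof -
    have "band_op (shift_kernel t) y \<in> B (p y * 1 * W)"
      unfolding W_def by (rule band_op_sums_disc(2)[OF band_bounded_shift_kernel])
    then have "T t y \<in> B (d + p y * 1 * W)" unfolding T_def by (rule disc_add[OF y])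
    moreover have "p y * W \<le> (M * d) * W" by (rule mult_right_mono[OF M(2)[OF y] W])
    then have "d + p y * 1 * W \<le> d + (M * d) * W" by linarith
    then have "d + p y * 1 * W \<le> (1 + M * W) * d" by (simp only: distrib_right mult_1_left mult_1_right mult.assoc mult.commute[of d W])
    ultimately show ?thesis by (rule disc_mono)
  qed
  moreover have "1 + M * W \<ge> 1" using M(1) W by simp
  ultimately show ?thesis by (intro exI[of _ "1 + M * W"]) blast
qed

lemma T_continuous: "continuous_on UNIV (T t)"
  unfolding continuous_on_eq_continuous_at[OF open_UNIV] continuous_at
proof (intro ballI tendsto_cont_seminormI)
  fix x q assume q: "cont_seminorm smul q"
  have s: "seminorm smul q" using q by (simp add: cont_seminorm_def)
  obtain M where M: "M \<ge> 0" "\<forall>d. \<forall>y\<in>B d. q y \<le> M * d" using disc_bounded[OF q] by blast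
  define W where "W = weight_sum (2 * max 1 (norm t))"
  have "q (T t y - T t x) \<le> q (y - x) + M * (p (y - x) * 1 * W)" for y
  proof -
    have "band_op (shift_kernel t) (y - x) \<in> B (p (y - x) * 1 * W)"
      unfolding W_def by (rule band_op_sums_disc(2)[OF band_bounded_shift_kernel])
    then have "q (band_op (shift_kernel t) (y - x)) \<le> M * (p (y - x) * 1 * W)" using M(2) by blast
    moreover have "T t y - T t x = (y - x) + band_op (shift_kernel t) (y - x)"
      by (simp only: T_diff[symmetric]) (simp only: T_def)
    ultimately show ?thesis
      using seminorm_add[OF s, of "y - x" "band_op (shift_kernel t) (y - x)"] by simp
  qed
  moreover have "((\<lambda>y. q (y - x) + M * (p (y - x) * 1 * W)) \<longlongrightarrow> 0 + M * (0 * 1 * W)) (at x)"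
    by (intro tendsto_intros cont_seminorm_tendsto_zero[OF q] cont_seminorm_tendsto_zero[OF p])
  then have lim: "((\<lambda>y. q (y - x) + M * (p (y - x) * 1 * W)) \<longlongrightarrow> 0) (at x)" by simp
  ultimately show "((\<lambda>y. q (T t y - T t x)) \<longlongrightarrow> 0) (at x)"
    by (intro tendsto_sandwich[OF _ _ tendsto_const lim] always_eventually allI seminorm_nonneg[OF s])
qed

lemma T_monomial: "T t (u n) = (\<Sum>m\<in>{..n}. smul (shift_kernel t n m) (u m))"
proof -
  have "{..n} = insert n {..<n}" by (auto simp: less_le)
  then show ?thesis
    by (simp add: T_def band_op_monomial band_row_def finite_lessThan_fun)
qed

lemma T_zero: "T 0 = id"
proof
  fix x
  have "band_op (shift_kernel 0) x = band_op (\<lambda>n m. 0) x"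
    by (rule band_op_cong) (rule shift_kernel_zero)
  then show "T 0 x = id x" by (simp add: T_def band_op_def band_row_def)
qed

lemma eq_if_eq_on_monomials:
  assumes "continuous_on UNIV S" "continuous_on UNIV R"
    and "Vector_Spaces.linear smul smul S" "Vector_Spaces.linear smul smul R"
    and eq: "\<And>n. S (u n) = R (u n)"
  shows "S = R"
proof -
  have "span (range u) \<subseteq> {x. S x = R x}"
  proof (rule span_minimal)
    show "subspace {x. S x = R x}"
    proof (rule subspaceI)
      have *: "S 0 = 0" "R 0 = 0"
        using module_hom.zero[OF Vector_Spaces.linear.axioms(3)] assms(3,4) by auto
      then show "0 \<in> {x. S x = R x}" by simp
    qed (use assms(3,4) in \<open>auto simp: Vector_Spaces.linear_iff\<close>)
  qed (use eq in auto)
  moreover have "closed {x. S x = R x}" using assms(1,2) by (rule closed_Collect_eq)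
  ultimately have "closure (span (range u)) \<subseteq> {x. S x = R x}" by (rule closure_minimal)
  then show ?thesis using dense by auto
qed

text \<open>Both sides are continuous and linear, so it suffices to compare them on the monomials,
  where the claim is \<open>shift_kernel_add\<close>.\<close>

lemma T_group: "T (s + t) = T t \<circ> T s"
proof (rule eq_if_eq_on_monomials)
  show "continuous_on UNIV (T (s + t))" by (rule T_continuous)
  show "continuous_on UNIV (T t \<circ> T s)"
    by (rule continuous_on_compose) (auto intro: T_continuous continuous_on_subset[OF T_continuous])
  show "Vector_Spaces.linear smul smul (T (s + t))" by (rule T_linear)
  show "Vector_Spaces.linear smul smul (T t \<circ> T s)"
    unfolding Vector_Spaces.linear_iff by (simp add: T_add T_scale vector_space_axioms)
  fix n
  have "(T t \<circ> T s) (u n) =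
      (\<Sum>m\<in>{..n}. \<Sum>l\<in>{..m}. smul (shift_kernel s n m * shift_kernel t m l) (u l))"
    by (simp add: T_monomial[of s] T_sum T_scale T_monomial[of t] scale_sum_right)
  \<comment> \<open>The inner range is enlarged to the fixed box \<open>{..n}\<close>, which the
    kernel permits since it vanishes unless \<open>l \<le> m\<close>; only then can the sums be
    swapped.\<close>
  also have "\<dots> = (\<Sum>m\<in>{..n}. \<Sum>l\<in>{..n}. smul (shift_kernel s n m * shift_kernel t m l) (u l))"
    by (intro sum.cong[OF refl] sum.mono_neutral_left) (auto simp: shift_kernel_eq_0 intro: order_trans)
  also have "\<dots> = (\<Sum>l\<in>{..n}. \<Sum>m\<in>{..n}. smul (shift_kernel s n m * shift_kernel t m l) (u l))"
    by (rule sum.swap)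
  also have "\<dots> = T (s + t) (u n)"
    by (simp add: T_monomial scale_sum_left[symmetric] shift_kernel_add)
  finally show "T (s + t) (u n) = (T t \<circ> T s) (u n)" by (rule sym)
qed

lemma T_group': "T (s + t) x = T t (T s x)"
  by (simp add: T_group)

lemma T_inverse: "T t (T (- t) x) = x" "T (- t) (T t x) = x"
  using T_group'[of "- t" t x] T_group'[of t "- t" x] by (simp_all add: T_zero)

lemma T_operator_group: "operator_group smul T"
  unfolding operator_group_def using T_linear T_continuous T_zero T_group by blast

text \<open>\<open>T (t n) - T l\<close> is \<open>T l\<close> applied to
  \<open>T (t n - l) - id\<close>, which reduces the claim to small parameters. There the correction
  lies in a ball of radius proportional to \<open>norm (t n - l)\<close>, for all \<open>x\<close>
  with \<open>p x \<le> 1\<close> at once.\<close>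

lemma T_uniformly_continuous: "uniformly_continuous_group T"
proof -
  obtain U where U: "open U" "0 \<in> U" "\<forall>x\<in>U. p x \<le> 1" using p unfolding cont_seminorm_def by blast
  show ?thesis
    unfolding uniformly_continuous_group_def
  proof (intro exI[of _ U] conjI allI impI)
    show "0 \<in> interior U" using U by (simp add: interior_open)
    fix t :: "nat \<Rightarrow> 'k ^ 'n" and l and V :: "'x set" assume t: "t \<longlonglongrightarrow> l" and V: "open V \<and> 0 \<in> V"
    obtain d where d: "d > 0" "\<forall>y. y - 0 \<in> B d \<longrightarrow> y \<in> V" using disc_nhds V by blast
    obtain C where C: "C \<ge> 1" "\<forall>d. \<forall>y\<in>B d. T l y \<in> B (C * d)" using T_disc by blast
    have "(\<lambda>n. norm (t n - l)) \<longlonglongrightarrow> 0"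
      using t by (simp add: LIM_zero_iff tendsto_norm_zero_iff)
    moreover have "(\<lambda>n. C * (norm (t n - l) * weight_sum 2)) \<longlonglongrightarrow> C * (0 * weight_sum 2)"
      by (intro tendsto_intros) fact
    then have "(\<lambda>n. C * (norm (t n - l) * weight_sum 2)) \<longlonglongrightarrow> 0" by simp
    ultimately have "eventually (\<lambda>n. norm (t n - l) < 1 \<and> C * (norm (t n - l) * weight_sum 2) < d) sequentially"
      using d(1) by (intro eventually_conj order_tendstoD(2)) auto
    then show "eventually (\<lambda>n. \<forall>x\<in>U. T (t n) x - T l x \<in> V) sequentially"
    proof (rule eventually_mono, intro ballI)
      fix n x
      assume n: "norm (t n - l) < 1 \<and> C * (norm (t n - l) * weight_sum 2) < d" and x: "x \<in> U"
      have "T (t n) x - T l x = T l (T (t n - l) x - x)"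
        using T_group'[of "t n - l" l x] by (simp add: T_diff)
      also have "\<dots> = T l (band_op (shift_kernel (t n - l)) x)" by (simp add: T_def)
      finally have eq: "T (t n) x - T l x = T l (band_op (shift_kernel (t n - l)) x)" .
      have "band_op (shift_kernel (t n - l)) x \<in> B (p x * norm (t n - l) * weight_sum 2)"
        using n by (intro band_op_sums_disc(2) band_bounded_shift_kernel_small) simp
      then have "band_op (shift_kernel (t n - l)) x \<in> B (norm (t n - l) * weight_sum 2)"
        using U(3) x weight_sum_nonneg[of 2]
        by (elim disc_mono) (intro mult_right_mono mult_left_le_one_le p_nonneg, simp_all)
      then have "T l (band_op (shift_kernel (t n - l)) x) \<in> B (C * (norm (t n - l) * weight_sum 2))"
        using C(2) by blast
      then have "T l (band_op (shift_kernel (t n - l)) x) \<in> B d"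
        using n by (elim disc_mono) simp
      then show "T (t n) x - T l x \<in> V" using d(2) eq by simp
    qed
  qed
qed

section \<open>Mixing, hypercyclicity and holomorphy\<close>

lemma T_span: "x \<in> span (range u) \<Longrightarrow> T t x \<in> span (range u)"
proof -
  have "span (range u) \<subseteq> {x. T t x \<in> span (range u)}"
  proof (rule span_minimal)
    show "subspace {x. T t x \<in> span (range u)}"
      by (rule subspaceI) (auto simp: T_zero_right T_add T_scale span_zero span_add span_scale)
    have "T t (u n) \<in> span (range u)" for n
      unfolding T_monomial by (intro span_sum span_scale span_base) auto
    then show "range u \<subseteq> {x. T t x \<in> span (range u)}" by auto
  qed
  then show "x \<in> span (range u) \<Longrightarrow> T t x \<in> span (range u)" by blast
qed

lemma coordinate_max:
  fixes t :: "'a::real_normed_vector ^ 'n"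
  shows "\<exists>j. (\<forall>i. norm (t $ i) \<le> norm (t $ j)) \<and> norm t \<le> CARD('n) * norm (t $ j)"
proof -
  have "Max (range (\<lambda>i. norm (t $ i))) \<in> range (\<lambda>i. norm (t $ i))" by (rule Max_in) auto
  then obtain j where j: "Max (range (\<lambda>i. norm (t $ i))) = norm (t $ j)" by (rule imageE)
  have le: "norm (t $ i) \<le> norm (t $ j)" for i
    unfolding j[symmetric] by (rule Max_ge) auto
  have "norm t \<le> (\<Sum>i\<in>UNIV. norm (t $ i))"
    unfolding norm_vec_def by (rule L2_set_le_sum) simp
  also have "\<dots> \<le> (\<Sum>i\<in>(UNIV :: 'n set). norm (t $ j))" by (rule sum_mono) (rule le)
  also have "\<dots> = CARD('n) * norm (t $ j)" by simp
  finally show ?thesis using le by blast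
qed

text \<open>The vector \<open>w\<close> is the polynomial \<open>(z - t)\<^sup>n (z\<^sub>j / t\<^sub>j)\<^sup>N\<close>, where \<open>j\<close> is the largest coordinate of
  \<open>t\<close> and \<open>N\<close> exceeds the degree of \<open>n\<close>; its translate is \<open>z\<^sup>n (1 + z\<^sub>j / t\<^sub>j)\<^sup>N\<close>.\<close>

lemma monomial_preimage:
  assumes \<epsilon>: "\<epsilon> > 0"
  shows "\<exists>R. \<forall>t. norm t > R \<longrightarrow> (\<exists>w\<in>span (range u). w \<in> B \<epsilon> \<and> T t w - u n \<in> B \<epsilon>)"
proof -
  define N where "N = Suc (mdeg n)"
  \<comment> \<open>\<open>nn j i\<close> is the exponent of the monomial
    \<open>z ^ n * z_j ^ i\<close>.\<close>
  define nn where "nn j i = n(j := n j + i)" for j i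
  \<comment> \<open>Which coordinate is largest depends on \<open>t\<close>, so both constants are
    summed over all \<open>j\<close>. Up to the factor \<open>1 / norm \<tau>\<close>,
    \<open>R1\<close> bounds the error of the translate and \<open>R2\<close> the size of
    \<open>w\<close>.\<close>
  define R1 where "R1 = (\<Sum>j\<in>UNIV. \<Sum>i\<le>N. real (N choose i) * r (nn j i))"
  define R2 where "R2 = (\<Sum>j\<in>UNIV. \<Sum>m\<in>{..nn j N}. 2 ^ mdeg n * r m)"
  have R1: "(\<Sum>i\<le>N. real (N choose i) * r (nn j i)) \<le> R1" for j
    unfolding R1_def
    by (rule member_le_sum) (auto intro!: sum_nonneg mult_nonneg_nonneg r_nonneg)
  have R2: "(\<Sum>m\<in>{..nn j N}. 2 ^ mdeg n * r m) \<le> R2" for j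
    unfolding R2_def
    by (rule member_le_sum) (auto intro!: sum_nonneg mult_nonneg_nonneg r_nonneg)
  have R1_0: "0 \<le> R1" and R2_0: "0 \<le> R2"
    unfolding R1_def R2_def by (auto intro!: sum_nonneg mult_nonneg_nonneg r_nonneg)
  \<comment> \<open>The cardinality compares the norm with the largest coordinate; the maximum with
    1 ensures that all higher inverse powers of \<open>norm \<tau>\<close> are bounded by the first
    one.\<close>
  define R where "R = CARD('n) * max 1 ((R1 + R2) / \<epsilon>)"
  have "\<exists>w\<in>span (range u). w \<in> B \<epsilon> \<and> T t w - u n \<in> B \<epsilon>" if t: "norm t > R" for t
  proof -
    obtain j where j: "\<forall>i. norm (t $ i) \<le> norm (t $ j)" "norm t \<le> CARD('n) * norm (t $ j)"
      using coordinate_max[of t] by (elim exE conjE)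
    define \<tau> where "\<tau> = t $ j"
    have "CARD('n) * max 1 ((R1 + R2) / \<epsilon>) < CARD('n) * norm \<tau>"
      using t j(2) unfolding R_def \<tau>_def by (rule less_le_trans)
    then have big: "max 1 ((R1 + R2) / \<epsilon>) < norm \<tau>" by (rule mult_left_less_imp_less) simp
    then have \<tau>1: "1 \<le> norm \<tau>" and \<tau>0: "\<tau> \<noteq> 0" by auto
    have "(R1 + R2) / \<epsilon> < norm \<tau>" using big by simp
    then have "R1 + R2 < \<epsilon> * norm \<tau>" using \<epsilon> by (simp add: divide_less_eq mult.commute)
    then have small: "R1 / norm \<tau> \<le> \<epsilon>" "R2 / norm \<tau> \<le> \<epsilon>"
      using R1_0 R2_0 \<tau>0 by (simp_all add: divide_le_eq)
    define a where "a i = of_nat (N choose i) * inverse \<tau> ^ i" for i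
    define v where "v = (\<Sum>i\<le>N. smul (a i) (u (nn j i)))"
    define w where "w = T (- t) v"
    have v_span: "v \<in> span (range u)"
      unfolding v_def by (intro span_sum span_scale span_base) auto
    have w_span: "w \<in> span (range u)" unfolding w_def by (rule T_span[OF v_span])
    have "v = u n + (\<Sum>i\<in>{1..N}. smul (a i) (u (nn j i)))"
    proof -
      have "{..N} = insert 0 {1..N}" by auto
      then show ?thesis by (simp add: v_def a_def nn_def)
    qed
    then have "T t w - u n = (\<Sum>i\<in>{1..N}. smul (a i) (u (nn j i)))"
      by (simp add: w_def T_inverse)
    also have "\<dots> \<in> B (\<Sum>i\<in>{1..N}. real (N choose i) * r (nn j i) / norm \<tau>)"
    proof (intro disc_sum disc_scale_le[OF u_disc])
      fix i assume i: "i \<in> {1..N}"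
      have "inverse (norm \<tau>) ^ i \<le> inverse (norm \<tau>) ^ 1"
        using i \<tau>1 by (intro power_decreasing) (auto simp: inverse_le_1_iff)
      then have "real (N choose i) * inverse (norm \<tau>) ^ i * r (nn j i) \<le>
          real (N choose i) * inverse (norm \<tau>) ^ 1 * r (nn j i)"
        by (intro mult_right_mono mult_left_mono r_nonneg) auto
      then show "norm (a i) * r (nn j i) \<le> real (N choose i) * r (nn j i) / norm \<tau>"
        by (simp add: a_def norm_mult norm_power norm_inverse divide_inverse mult_ac)
    qed
    finally have "T t w - u n \<in> B \<epsilon>"
    proof (rule disc_mono)
      have "(\<Sum>i\<in>{1..N}. real (N choose i) * r (nn j i) / norm \<tau>) =
          (\<Sum>i\<in>{1..N}. real (N choose i) * r (nn j i)) / norm \<tau>"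
        by (simp add: sum_divide_distrib)
      also have "\<dots> \<le> (\<Sum>i\<le>N. real (N choose i) * r (nn j i)) / norm \<tau>"
        by (intro divide_right_mono sum_mono2) (auto intro!: mult_nonneg_nonneg r_nonneg)
      also have "\<dots> \<le> R1 / norm \<tau>" by (intro divide_right_mono R1) simp
      finally show "(\<Sum>i\<in>{1..N}. real (N choose i) * r (nn j i) / norm \<tau>) \<le> \<epsilon>"
        using small(1) by simp
    qed
    moreover have "w \<in> B \<epsilon>"
    proof -
      have "w = (\<Sum>i\<le>N. \<Sum>m\<in>{..nn j i}. smul (a i * shift_kernel (- t) (nn j i) m) (u m))"
        by (simp add: w_def v_def T_sum T_scale T_monomial scale_sum_right)
      \<comment> \<open>A common range of \<open>m\<close> for all \<open>i\<close> allows the sums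
        to be exchanged; the inner sum over \<open>i\<close> is then the cutoff expression with
        \<open>N = Suc (mdeg n)\<close>.\<close>
      also have "\<dots> = (\<Sum>i\<le>N. \<Sum>m\<in>{..nn j N}. smul (a i * shift_kernel (- t) (nn j i) m) (u m))"
      proof (rule sum.cong[OF refl], rule sum.mono_neutral_left)
        fix i assume "i \<in> {..N}"
        then have "nn j i \<le> nn j N" by (auto simp: nn_def le_fun_def)
        then show "{..nn j i} \<subseteq> {..nn j N}" by auto
        show "\<forall>m\<in>{..nn j N} - {..nn j i}. smul (a i * shift_kernel (- t) (nn j i) m) (u m) = 0"
          by (auto simp: shift_kernel_eq_0)
      qed simp
      also have "\<dots> = (\<Sum>m\<in>{..nn j N}. smul (\<Sum>i\<le>N. a i * shift_kernel (- t) (nn j i) m) (u m))"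
        unfolding scale_sum_left by (rule sum.swap)
      also have "\<dots> \<in> B (\<Sum>m\<in>{..nn j N}. 2 ^ mdeg n * r m / norm \<tau>)"
      proof (intro disc_sum disc_scale_le[OF u_disc])
        fix m
        have "norm (\<Sum>i\<le>N. a i * shift_kernel (- t) (nn j i) m) \<le> 2 ^ mdeg n / norm \<tau>"
          using norm_shift_kernel_cutoff_le[of t j n m] j(1) \<tau>1
          by (simp add: a_def nn_def N_def \<tau>_def)
        then have "norm (\<Sum>i\<le>N. a i * shift_kernel (- t) (nn j i) m) * r m \<le> 2 ^ mdeg n / norm \<tau> * r m"
          by (rule mult_right_mono) (rule r_nonneg)
        then show "norm (\<Sum>i\<le>N. a i * shift_kernel (- t) (nn j i) m) * r m \<le> 2 ^ mdeg n * r m / norm \<tau>"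
          by simp
      qed
      finally show ?thesis
      proof (rule disc_mono)
        have "(\<Sum>m\<in>{..nn j N}. 2 ^ mdeg n * r m / norm \<tau>) =
            (\<Sum>m\<in>{..nn j N}. 2 ^ mdeg n * r m) / norm \<tau>"
          by (simp add: sum_divide_distrib)
        also have "\<dots> \<le> R2 / norm \<tau>" by (intro divide_right_mono R2) simp
        finally show "(\<Sum>m\<in>{..nn j N}. 2 ^ mdeg n * r m / norm \<tau>) \<le> \<epsilon>" using small(2) by simp
      qed
    qed
    ultimately show ?thesis using w_span by blast
  qed
  then show ?thesis by blast
qed

lemma span_preimage:
  assumes "b \<in> span (range u)"
  shows "\<forall>\<epsilon>>0. \<exists>R. \<forall>t. norm t > R \<longrightarrow> (\<exists>w\<in>span (range u). w \<in> B \<epsilon> \<and> T t w - b \<in> B \<epsilon>)"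
  using assms
proof (induction rule: span_induct_alt)
  case base
  have "0 \<in> B \<epsilon> \<and> T t 0 - 0 \<in> B \<epsilon>" if "\<epsilon> > 0" for \<epsilon> t
    using that by (simp add: T_zero_right disc_zero')
  then show ?case using span_zero by blast
next
  case (step c a b)
  show ?case
  proof (intro allI impI)
    fix \<epsilon> :: real assume \<epsilon>: "\<epsilon> > 0"
    define \<delta> where "\<delta> = \<epsilon> / 2 / (norm c + 1)"
    have c: "norm c + 1 > 0" by (simp add: add_nonneg_pos)
    then have \<delta>: "\<delta> > 0" using \<epsilon> by (simp add: \<delta>_def)
    have "\<delta> * (norm c + 1) = \<epsilon> / 2"
      using c nonzero_eq_divide_eq[of "norm c + 1" \<delta> "\<epsilon> / 2"] by (simp add: \<delta>_def)
    then have c\<delta>: "norm c * \<delta> \<le> \<epsilon> / 2" using \<delta> by (simp add: distrib_left mult.commute)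
    obtain n where n: "a = u n" using step(1) by blast
    obtain R1 where R1: "\<And>t. norm t > R1 \<Longrightarrow> \<exists>w\<in>span (range u). w \<in> B \<delta> \<and> T t w - u n \<in> B \<delta>"
      using monomial_preimage[OF \<delta>, of n] by blast
    obtain R2 where R2: "\<And>t. norm t > R2 \<Longrightarrow> \<exists>w\<in>span (range u). w \<in> B (\<epsilon> / 2) \<and> T t w - b \<in> B (\<epsilon> / 2)"
      using step(2) \<epsilon> half_gt_zero by blast
    have "\<exists>w\<in>span (range u). w \<in> B \<epsilon> \<and> T t w - (smul c a + b) \<in> B \<epsilon>" if t: "norm t > max R1 R2" for t
    proof -
      obtain w1 where w1: "w1 \<in> span (range u)" "w1 \<in> B \<delta>" "T t w1 - u n \<in> B \<delta>"
        using R1[of t] t by auto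
      obtain w2 where w2: "w2 \<in> span (range u)" "w2 \<in> B (\<epsilon> / 2)" "T t w2 - b \<in> B (\<epsilon> / 2)"
        using R2[of t] t by auto
      have half: "\<epsilon> / 2 + \<epsilon> / 2 = \<epsilon>" by simp
      have eq: "T t (smul c w1 + w2) - (smul c a + b) = smul c (T t w1 - u n) + (T t w2 - b)"
        by (simp add: T_add T_scale n scale_right_diff_distrib)
      show ?thesis
      proof (intro bexI[of _ "smul c w1 + w2"] conjI)
        show "smul c w1 + w2 \<in> B \<epsilon>"
          using disc_add[OF disc_scale_le[OF w1(2) c\<delta>] w2(2)] unfolding half .
        show "T t (smul c w1 + w2) - (smul c a + b) \<in> B \<epsilon>"
          using disc_add[OF disc_scale_le[OF w1(3) c\<delta>] w2(3)] unfolding half eq .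
        show "smul c w1 + w2 \<in> span (range u)" by (intro span_add span_scale w1 w2)
      qed
    qed
    then show "\<exists>R. \<forall>t. norm t > R \<longrightarrow>
      (\<exists>w\<in>span (range u). w \<in> B \<epsilon> \<and> T t w - (smul c a + b) \<in> B \<epsilon>)" by blast
  qed
qed

text \<open>Take \<open>v = T (- t) w1 + w2\<close> with \<open>w1\<close> and \<open>w2\<close>
  small, \<open>T (- t) w1\<close> near \<open>a\<close> and \<open>T t w2\<close> near
  \<open>b\<close>; then \<open>T t v = w1 + T t w2\<close>. The preimage lemma covers
  \<open>- t\<close> because its threshold concerns the norm alone.\<close>

lemma span_mixing:
  assumes a: "a \<in> span (range u)" and b: "b \<in> span (range u)" and \<epsilon>: "\<epsilon> > 0"
  shows "\<exists>R. \<forall>t. norm t > R \<longrightarrow> (\<exists>v\<in>span (range u). v - a \<in> B \<epsilon> \<and> T t v - b \<in> B \<epsilon>)"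
proof -
  have \<epsilon>2: "\<epsilon> / 2 > 0" using \<epsilon> by simp
  obtain R1 where R1: "\<And>t. norm t > R1 \<Longrightarrow> \<exists>w\<in>span (range u). w \<in> B (\<epsilon> / 2) \<and> T t w - a \<in> B (\<epsilon> / 2)"
    using span_preimage[OF a] \<epsilon>2 by blast
  obtain R2 where R2: "\<And>t. norm t > R2 \<Longrightarrow> \<exists>w\<in>span (range u). w \<in> B (\<epsilon> / 2) \<and> T t w - b \<in> B (\<epsilon> / 2)"
    using span_preimage[OF b] \<epsilon>2 by blast
  have "\<exists>v\<in>span (range u). v - a \<in> B \<epsilon> \<and> T t v - b \<in> B \<epsilon>" if t: "norm t > max R1 R2" for t
  proof -
    obtain w1 where w1: "w1 \<in> span (range u)" "w1 \<in> B (\<epsilon> / 2)" "T (- t) w1 - a \<in> B (\<epsilon> / 2)"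
      using R1[of "- t"] t by auto
    obtain w2 where w2: "w2 \<in> span (range u)" "w2 \<in> B (\<epsilon> / 2)" "T t w2 - b \<in> B (\<epsilon> / 2)"
      using R2[of t] t by auto
    have half: "\<epsilon> / 2 + \<epsilon> / 2 = \<epsilon>" by simp
    have eq: "T t (T (- t) w1 + w2) - b = w1 + (T t w2 - b)"
      "T (- t) w1 + w2 - a = (T (- t) w1 - a) + w2" by (simp_all add: T_add T_inverse)
    show ?thesis
    proof (intro bexI[of _ "T (- t) w1 + w2"] conjI)
      show "T (- t) w1 + w2 - a \<in> B \<epsilon>" using disc_add[OF w1(3) w2(2)] unfolding half eq .
      show "T t (T (- t) w1 + w2) - b \<in> B \<epsilon>" using disc_add[OF w1(2) w2(3)] unfolding half eq .
      show "T (- t) w1 + w2 \<in> span (range u)" by (intro span_add T_span w1 w2)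
    qed
  qed
  then show ?thesis by blast
qed

lemma T_mixing: "mixing_group T"
  unfolding mixing_group_def
proof (intro allI impI, elim conjE)
  fix U V :: "'x set" assume U: "open U" "U \<noteq> {}" and V: "open V" "V \<noteq> {}"
  have "\<exists>a. a \<in> W \<and> a \<in> span (range u)" if "open W" "W \<noteq> {}" for W
    using open_Int_closure_eq_empty[OF that(1), of "span (range u)"] that(2) dense by auto
  then obtain a b where a: "a \<in> U" "a \<in> span (range u)" and b: "b \<in> V" "b \<in> span (range u)"
    using U V by metis
  obtain d where d: "d > 0" "\<And>y. y - a \<in> B d \<Longrightarrow> y \<in> U" using disc_nhds[OF U(1) a(1)] by blast
  obtain d' where d': "d' > 0" "\<And>y. y - b \<in> B d' \<Longrightarrow> y \<in> V" using disc_nhds[OF V(1) b(1)] by blast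
  have m: "min d d' > 0" using d(1) d'(1) by simp
  obtain R where R: "\<And>t. norm t > R \<Longrightarrow> \<exists>v\<in>span (range u). v - a \<in> B (min d d') \<and> T t v - b \<in> B (min d d')"
    using span_mixing[OF a(2) b(2) m] by blast
  have "T t ` U \<inter> V \<noteq> {}" if t: "norm t > max R 1" for t
  proof -
    obtain v where v: "v - a \<in> B (min d d')" "T t v - b \<in> B (min d d')" using R[of t] t by auto
    have "v \<in> U" by (rule d(2), rule disc_mono[OF v(1)]) simp
    moreover have "T t v \<in> V" by (rule d'(2), rule disc_mono[OF v(2)]) simp
    ultimately show ?thesis by blast
  qed
  then show "\<exists>r>0. \<forall>t. norm t > r \<longrightarrow> T t ` U \<inter> V \<noteq> {}" by (intro exI[of _ "max R 1"]) auto
qed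

section \<open>Construction of hypercyclic vectors\<close>

text \<open>Provides the targets of the orbit. Indexing finite sums of the vectors
  \<open>smul d (u m)\<close> by lists makes countability immediate, and coefficients are
  approximated by elements of \<open>D\<close> one at a time.\<close>

lemma countable_dense_span:
  assumes D: "countable D" "\<And>c :: 'k. \<And>\<epsilon>. \<epsilon> > 0 \<Longrightarrow> \<exists>d\<in>D. norm (d - c) < \<epsilon>"
  shows "\<exists>Q. countable Q \<and> Q \<subseteq> span (range u) \<and> Q \<noteq> {} \<and> closure Q = UNIV"
proof -
  define G where "G = (\<lambda>(d, m). smul d (u m)) ` (D \<times> UNIV)"
  define Q where "Q = sum_list ` lists G"
  have "countable G" unfolding G_def using D(1) by (intro countable_image countable_SIGMA) auto
  then have "countable Q" unfolding Q_def by (intro countable_image countable_lists)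
  moreover have "sum_list l \<in> span (range u)" if "l \<in> lists G" for l
    using that
  proof (induction l)
    case (Cons x l)
    then have "x \<in> span (range u)" by (auto simp: G_def intro: span_scale span_base)
    with Cons show ?case by (simp add: span_add)
  qed (simp add: span_zero)
  then have "Q \<subseteq> span (range u)" by (auto simp: Q_def)
  moreover have Q0: "0 \<in> Q" unfolding Q_def by (rule image_eqI[of _ _ "[]"]) auto
  moreover have Q_add: "smul d (u m) + y \<in> Q" if dy: "d \<in> D" "y \<in> Q" for d m y
  proof -
    obtain l where l: "l \<in> lists G" "y = sum_list l" using dy(2) by (auto simp: Q_def)
    have "smul d (u m) \<in> G" using that(1) by (auto simp: G_def)
    then show ?thesis unfolding Q_def by (intro image_eqI[of _ _ "smul d (u m) # l"]) (auto simp: l)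
  qed
  have "closure Q = UNIV"
  proof (rule closure_eq_UNIV_I)
    fix x q and \<epsilon> :: real assume q: "cont_seminorm smul q" and \<epsilon>: "\<epsilon> > 0"
    have s: "seminorm smul q" using q by (simp add: cont_seminorm_def)
    have approx: "\<forall>\<epsilon>>0. \<exists>y\<in>Q. q (y - v) < \<epsilon>" if "v \<in> span (range u)" for v
      using that
    proof (induction rule: span_induct_alt)
      case base
      show ?case using Q0 by (intro allI impI bexI[of _ 0]) (auto simp: seminorm_zero[OF s])
    next
      case (step c a v)
      show ?case
      proof (intro allI impI)
        fix \<epsilon> :: real assume \<epsilon>: "\<epsilon> > 0"
        obtain y where y: "y \<in> Q" "q (y - v) < \<epsilon> / 2" using step(2) \<epsilon> half_gt_zero by blast
        have qa: "q a + 1 > 0" using seminorm_nonneg[OF s, of a] by simp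
        then obtain d where d: "d \<in> D" "norm (d - c) < \<epsilon> / 2 / (q a + 1)"
          using D(2)[of "\<epsilon> / 2 / (q a + 1)" c] \<epsilon> by auto
        have "norm (d - c) * (q a + 1) < \<epsilon> / 2" using d(2) unfolding pos_less_divide_eq[OF qa] .
        then have "norm (d - c) * q a < \<epsilon> / 2"
          using norm_ge_zero[of "d - c"] by (simp add: distrib_left del: norm_ge_zero)
        moreover have "q ((smul d a + y) - (smul c a + v)) \<le> norm (d - c) * q a + q (y - v)"
        proof -
          have "(smul d a + y) - (smul c a + v) = smul (d - c) a + (y - v)"
            by (simp add: scale_left_diff_distrib)
          then show ?thesis
            using seminorm_add[OF s, of "smul (d - c) a" "y - v"] by (simp only: seminorm_scale[OF s])
        qed
        ultimately have "q ((smul d a + y) - (smul c a + v)) < \<epsilon>" using y(2) by linarith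
        moreover have "smul d a + y \<in> Q" using step(1) Q_add[OF d(1) y(1)] by auto
        ultimately show "\<exists>y\<in>Q. q (y - (smul c a + v)) < \<epsilon>" by blast
      qed
    qed
    have \<epsilon>2: "\<epsilon> / 2 > 0" using \<epsilon> by simp
    obtain v where v: "v \<in> span (range u)" "q (v - x) < \<epsilon> / 2"
      using closure_eq_UNIV_D[OF dense q \<epsilon>2] by blast
    obtain y where y: "y \<in> Q" "q (y - v) < \<epsilon> / 2" using approx[OF v(1)] \<epsilon>2 by blast
    have "q (y - x) \<le> q (y - v) + q (v - x)" using seminorm_add[OF s, of "y - v" "v - x"] by simp
    then show "\<exists>y\<in>Q. q (y - x) < \<epsilon>" using v(2) y by (intro bexI[of _ y]) auto
  qed
  ultimately show ?thesis by blast
qed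

text \<open>Stage \<open>k\<close> corrects \<open>s k\<close> so that an operator from the given
  sequence sends \<open>s (Suc k)\<close> near the target \<open>\<theta> k\<close>. Corrections are
  made small relative to the bounds of all operators chosen before, so they do not spoil the
  approximations already achieved, and the limit \<open>x\<close> inherits all of them.\<close>

lemma T_hereditarily_hypercyclic:
  assumes D: "countable D" "\<And>c :: 'k. \<And>\<epsilon>. \<epsilon> > 0 \<Longrightarrow> \<exists>d\<in>D. norm (d - c) < \<epsilon>"
  shows "hereditarily_hypercyclic T"
  unfolding hereditarily_hypercyclic_def
proof (intro allI impI)
  fix t :: "nat \<Rightarrow> 'k ^ 'n" assume t: "filterlim (\<lambda>n. norm (t n)) at_top sequentially"
  have "\<exists>Q. countable Q \<and> Q \<subseteq> span (range u) \<and> Q \<noteq> {} \<and> closure Q = UNIV"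
    by (rule countable_dense_span) (fact D)+
  then obtain Q where Q: "countable Q" "Q \<subseteq> span (range u)" "Q \<noteq> {}" "closure Q = UNIV"
    by (elim exE conjE)
  \<comment> \<open>By the pairing, every element of \<open>Q\<close> is a target at arbitrarily
    late stages, hence with arbitrarily small error.\<close>
  define \<theta> where "\<theta> k = from_nat_into Q (fst (prod_decode k))" for k
  have \<theta>: "\<theta> k \<in> span (range u)" for k
    unfolding \<theta>_def using from_nat_into[OF Q(3)] Q(2) by (rule set_mp[rotated])
  define good where "good k st \<longleftrightarrow> fst st \<in> span (range u) \<and> (1::real) \<le> snd (snd st)"
    for k :: nat and st :: "'x \<times> nat \<times> real"
  \<comment> \<open>\<open>M\<close> bounds, on the disc, all operators chosen so far; each of them
    maps a correction of radius \<open>(1 / 2) ^ k / M\<close> into a ball of radius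
    \<open>(1 / 2) ^ k\<close>.\<close>
  define next_st where "next_st k st st' \<longleftrightarrow> (case (st, st') of ((s, N, M), (s', N', M')) \<Rightarrow>
      s' - s \<in> B ((1 / 2) ^ k / M) \<and> T (t N') s' - \<theta> k \<in> B ((1 / 2) ^ k) \<and> M \<le> M' \<and>
      (\<forall>d. \<forall>y\<in>B d. T (t N') y \<in> B (M' * d)))"
    for k :: nat and st st' :: "'x \<times> nat \<times> real"
  have "\<exists>S. \<forall>k. good k (S k) \<and> next_st k (S k) (S (Suc k))"
  proof (rule dependent_nat_choice)
    \<comment> \<open>The index 0 in the initial state is a placeholder; only the indices
      \<open>N (Suc k)\<close> enter the estimates.\<close>
    show "\<exists>st. good 0 st" by (rule exI[of _ "(0, 0, 1)"]) (simp add: good_def span_zero)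
  next
    fix st k assume st: "good k st"
    obtain s N M where S: "st = (s, N, M)" by (cases st) auto
    have s: "s \<in> span (range u)" and M: "1 \<le> M" using st by (simp_all add: good_def S)
    define \<epsilon> where "\<epsilon> = (1 / 2 :: real) ^ k / M"
    have \<epsilon>: "\<epsilon> > 0" using M by (simp add: \<epsilon>_def)
    have \<epsilon>_le: "\<epsilon> \<le> (1 / 2) ^ k" using M by (simp add: \<epsilon>_def divide_le_eq mult_le_cancel_left1)
    obtain R where R: "\<And>t. norm t > R \<Longrightarrow>
        \<exists>v\<in>span (range u). v - s \<in> B \<epsilon> \<and> T t v - \<theta> k \<in> B \<epsilon>"
      using span_mixing[OF s \<theta> \<epsilon>] by blast
    have "eventually (\<lambda>n. norm (t n) > R) sequentially"
      using t by (simp add: filterlim_at_top_dense)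
    then obtain N' where N': "norm (t N') > R" by (auto simp: eventually_sequentially)
    obtain v where v: "v \<in> span (range u)" "v - s \<in> B \<epsilon>" "T (t N') v - \<theta> k \<in> B \<epsilon>"
      using R[OF N'] by blast
    obtain C where C: "C \<ge> 1" "\<forall>d. \<forall>y\<in>B d. T (t N') y \<in> B (C * d)" using T_disc by blast
    have "T (t N') y \<in> B (max M C * d)" if y: "y \<in> B d" for y d
    proof (rule disc_mono)
      show "T (t N') y \<in> B (C * d)" using C(2) y by blast
      show "C * d \<le> max M C * d" by (rule mult_right_mono) (use disc_nonneg[OF y] in auto)
    qed
    moreover have "T (t N') v - \<theta> k \<in> B ((1 / 2) ^ k)" by (rule disc_mono[OF v(3) \<epsilon>_le])
    ultimately have "next_st k st (v, N', max M C)"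
      using v(2) by (simp add: next_st_def S \<epsilon>_def)
    moreover have "good (Suc k) (v, N', max M C)" using v(1) M by (simp add: good_def)
    ultimately show "\<exists>st'. good (Suc k) st' \<and> next_st k st st'" by blast
  qed
  then obtain S where S: "\<And>k. good k (S k)" "\<And>k. next_st k (S k) (S (Suc k))" by blast
  define s where "s k = fst (S k)" for k
  define N where "N k = fst (snd (S k))" for k
  define M where "M k = snd (snd (S k))" for k
  have S_eq: "S k = (s k, N k, M k)" for k by (simp add: s_def N_def M_def)
  have M1: "1 \<le> M k" for k using S(1)[of k] by (simp add: good_def M_def)
  have step: "s (Suc k) - s k \<in> B ((1 / 2) ^ k / M k)"
    and target: "T (t (N (Suc k))) (s (Suc k)) - \<theta> k \<in> B ((1 / 2) ^ k)"
    and M_step: "M k \<le> M (Suc k)"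
    and T_bound: "\<And>d y. y \<in> B d \<Longrightarrow> T (t (N (Suc k))) y \<in> B (M (Suc k) * d)" for k
    using S(2)[of k] by (simp_all add: next_st_def S_eq)
  have M_mono: "M i \<le> M j" if "i \<le> j" for i j using M_step that by (rule lift_Suc_mono_le)
  have geom: "summable (\<lambda>k. (1 / 2 :: real) ^ (k + i))" for i
    using summable_ignore_initial_segment[OF summable_geometric[of "1 / 2 :: real"]] by simp
  have "s (Suc k) - s k \<in> B ((1 / 2) ^ k)" for k
    by (rule disc_mono[OF step]) (use M1[of k] in \<open>simp add: divide_le_eq mult_le_cancel_left1\<close>)
  from disc_series[of "\<lambda>k. s (Suc k) - s k" "\<lambda>k. (1 / 2) ^ k", OF this] geom[of 0]
  obtain \<sigma> where \<sigma>: "(\<lambda>k. s (Suc k) - s k) sums \<sigma>" by auto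
  define x where "x = s 0 + \<sigma>"
  have s_lim: "s \<longlonglongrightarrow> x"
    using tendsto_add[OF tendsto_const[of "s 0"] \<sigma>[unfolded sums_def sum_lessThan_telescope]]
    by (simp add: x_def)
  \<comment> \<open>Two errors of radius \<open>(1 / 2) ^ i\<close>: that of stage \<open>i\<close>
    itself, and the images of all later corrections, whose radii start at
    \<open>(1 / 2) ^ Suc i\<close> and therefore add up to \<open>(1 / 2) ^ i\<close>.\<close>
  have close: "T (t (N (Suc i))) x - \<theta> i \<in> B (2 * (1 / 2) ^ i)" for i
  proof -
    let ?T = "T (t (N (Suc i)))"
    let ?d = "\<lambda>k. s (Suc (k + Suc i)) - s (k + Suc i)"
    have "?T (?d k) \<in> B ((1 / 2) ^ (k + Suc i))" for k
    proof (rule disc_mono)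
      show "?T (?d k) \<in> B (M (Suc i) * ((1 / 2) ^ (k + Suc i) / M (k + Suc i)))"
        by (rule T_bound[OF step])
      have "M (Suc i) * (1 / 2) ^ (k + Suc i) \<le> M (k + Suc i) * (1 / 2) ^ (k + Suc i)"
        by (intro mult_right_mono M_mono) auto
      then show "M (Suc i) * ((1 / 2) ^ (k + Suc i) / M (k + Suc i)) \<le> (1 / 2) ^ (k + Suc i)"
        using M1[of "k + Suc i"] by (simp add: divide_le_eq mult.commute)
    qed
    from disc_series[OF this geom]
    obtain y where y: "y \<in> B (\<Sum>k. (1 / 2) ^ (k + Suc i))" "(\<lambda>k. ?T (?d k)) sums y" by blast
    have "(\<lambda>n. \<Sum>k<n. ?T (?d k)) = (\<lambda>n. ?T (s (n + Suc i) - s (Suc i)))"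
    proof
      fix n
      have "(\<Sum>k<n. ?d k) = s (n + Suc i) - s (Suc i)"
        using sum_lessThan_telescope[of "\<lambda>k. s (k + Suc i)" n] by simp
      then show "(\<Sum>k<n. ?T (?d k)) = ?T (s (n + Suc i) - s (Suc i))" by (simp only: T_sum[symmetric])
    qed
    \<comment> \<open>Continuity in X identifies the vector obtained by summing in the disc with the
      image of the tail \<open>x - s (Suc i)\<close>.\<close>
    moreover have "(\<lambda>n. ?T (s (n + Suc i) - s (Suc i))) \<longlonglongrightarrow> ?T (x - s (Suc i))"
    proof (rule isCont_tendsto_compose[of _ ?T])
      show "isCont ?T (x - s (Suc i))"
        using T_continuous by (simp add: continuous_on_eq_continuous_at)
      show "(\<lambda>n. s (n + Suc i) - s (Suc i)) \<longlonglongrightarrow> x - s (Suc i)"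
        by (intro tendsto_diff tendsto_const LIMSEQ_ignore_initial_segment s_lim)
    qed
    ultimately have "(\<lambda>k. ?T (?d k)) sums ?T (x - s (Suc i))" by (simp add: sums_def)
    then have "y = ?T (x - s (Suc i))" by (rule sums_unique2[OF y(2)])
    moreover have "(\<Sum>k. (1 / 2 :: real) ^ (k + Suc i)) = (1 / 2) ^ i"
    proof -
      have "(\<Sum>k. (1 / 2 :: real) ^ (k + Suc i)) = (\<Sum>k. (1 / 2) ^ k) * (1 / 2) ^ Suc i"
        unfolding power_add by (rule suminf_mult2[symmetric]) (simp add: summable_geometric)
      then show ?thesis by (simp add: suminf_geometric)
    qed
    ultimately have "?T (x - s (Suc i)) \<in> B ((1 / 2) ^ i)" using y(1) by simp
    from disc_add[OF this target[of i]]
    have "?T (x - s (Suc i)) + (?T (s (Suc i)) - \<theta> i) \<in> B ((1 / 2) ^ i + (1 / 2) ^ i)" .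
    then show ?thesis by (simp add: T_diff)
  qed
  show "\<exists>x. closure (range (\<lambda>n. T (t n) x)) = UNIV"
  proof (intro exI closure_eq_UNIV_I)
    fix v q and \<epsilon> :: real assume q: "cont_seminorm smul q" and \<epsilon>: "\<epsilon> > 0"
    have sn: "seminorm smul q" using q by (simp add: cont_seminorm_def)
    obtain K where K: "K \<ge> 0" "\<And>d y. y \<in> B d \<Longrightarrow> q y \<le> K * d" using disc_bounded[OF q] by blast
    have \<epsilon>2: "\<epsilon> / 2 > 0" using \<epsilon> by simp
    obtain a where a: "a \<in> Q" "q (a - v) < \<epsilon> / 2" using closure_eq_UNIV_D[OF Q(4) q \<epsilon>2] by blast
    obtain l where l: "from_nat_into Q l = a" using from_nat_into_surj[OF Q(1) a(1)] by blast
    have "(\<lambda>i. K * (2 * (1 / 2) ^ i)) \<longlonglongrightarrow> K * (2 * 0)"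
      by (intro tendsto_intros LIMSEQ_realpow_zero) auto
    then have "eventually (\<lambda>i. K * (2 * (1 / 2) ^ i) < \<epsilon> / 2) sequentially"
      using \<epsilon>2 by (intro order_tendstoD) auto
    then obtain b where b: "\<And>i. i \<ge> b \<Longrightarrow> K * (2 * (1 / 2) ^ i) < \<epsilon> / 2"
      by (auto simp: eventually_sequentially)
    define i where "i = prod_encode (l, b)"
    have i: "i \<ge> b" "\<theta> i = a" by (simp_all add: i_def \<theta>_def l le_prod_encode_2)
    have "q (T (t (N (Suc i))) x - a) < \<epsilon> / 2"
      using K(2)[OF close[of i]] b[OF i(1)] i(2) by simp
    then have "q (T (t (N (Suc i))) x - v) < \<epsilon>"
      using seminorm_add[OF sn, of "T (t (N (Suc i))) x - a" "a - v"] a(2) by simp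
    then show "\<exists>y\<in>range (\<lambda>n. T (t n) x). q (y - v) < \<epsilon>" by blast
  qed
qed

section \<open>Differentiability in the group parameter\<close>

text \<open>The part of the translation kernel of first order in \<open>h\<close>: the matrix of the
  derivative in direction \<open>h\<close>, which lowers the degree by exactly one.\<close>

definition linear_kernel :: "'k ^ 'n \<Rightarrow> ('n \<Rightarrow> nat) \<Rightarrow> ('n \<Rightarrow> nat) \<Rightarrow> 'k" where
  "linear_kernel h n m = (if mdeg n = Suc (mdeg m) then shift_kernel h n m else 0)"

lemma band_bounded_linear_kernel: "band_bounded (norm h) 2 (linear_kernel h)"
  unfolding band_bounded_def
proof (intro conjI allI impI)
  fix m n :: "'n \<Rightarrow> nat" assume "m < n"
  then have "norm (shift_kernel h n m) \<le> 2 ^ mdeg n * norm h ^ (mdeg n - mdeg m)"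
    by (intro norm_shift_kernel_le) simp
  then show "norm (linear_kernel h n m) \<le> norm h * 2 ^ mdeg n"
    by (auto simp: linear_kernel_def mult.commute)
qed auto

text \<open>The remaining entries lower the degree at least by two and so carry a factor
  \<open>norm h ^ 2\<close>.\<close>

lemma band_bounded_remainder:
  assumes h: "norm h \<le> 1"
  shows "band_bounded (norm h ^ 2) 2 (\<lambda>n m. shift_kernel h n m - linear_kernel h n m)"
  unfolding band_bounded_def
proof (intro conjI allI impI)
  fix m n :: "'n \<Rightarrow> nat" assume mn: "m < n"
  show "norm (shift_kernel h n m - linear_kernel h n m) \<le> norm h ^ 2 * 2 ^ mdeg n"
  proof (cases "mdeg n = Suc (mdeg m)")
    case True
    then show ?thesis by (simp add: linear_kernel_def)
  next
    case False
    then have "mdeg n - mdeg m \<ge> 2" using mdeg_strict_mono[OF mn] by linarith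
    have "norm (shift_kernel h n m) \<le> 2 ^ mdeg n * norm h ^ (mdeg n - mdeg m)"
      using mn by (intro norm_shift_kernel_le) simp
    also have "\<dots> \<le> 2 ^ mdeg n * norm h ^ 2"
      using h \<open>mdeg n - mdeg m \<ge> 2\<close> by (intro mult_left_mono power_decreasing) auto
    finally show ?thesis using False by (simp add: linear_kernel_def mult.commute)
  qed
qed auto

lemma linear_kernel_linear:
  assumes "m < n"
  shows "linear_kernel (h + h') n m = linear_kernel h n m + linear_kernel h' n m"
    and "linear_kernel (c *s h) n m = c * linear_kernel h n m"
proof -
  have "\<exists>j. \<forall>h :: 'k ^ 'n. linear_kernel h n m = (if mdeg n = Suc (mdeg m) then of_nat (n j) * h $ j else 0)"
    using shift_kernel_degree_one[of m n, where 'k = 'k] assms by (auto simp: linear_kernel_def)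
  then obtain j where j: "\<And>h. linear_kernel h n m =
    (if mdeg n = Suc (mdeg m) then of_nat (n j) * h $ j else 0)" by blast
  show "linear_kernel (h + h') n m = linear_kernel h n m + linear_kernel h' n m"
    and "linear_kernel (c *s h) n m = c * linear_kernel h n m"
    unfolding j by (simp_all add: distrib_left)
qed

text \<open>The group law reduces differentiation at \<open>z\<close> to differentiation at 0, where
  the derivative is the band operator of the linear part and the remainder is of order
  \<open>norm h ^ 2\<close> in the disc. Since band operators take values in the span of the disc,
  the derivative has values in X and not merely in its completion.\<close>

lemma T_differentiable:
  "\<exists>L. Vector_Spaces.linear vector_scalar_mult smul L \<and>
    ((\<lambda>h. smul (inverse (of_real (norm h))) (T (z + h) x - T z x - L h)) \<longlongrightarrow> 0) (at 0)"
proof (intro exI conjI)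
  let ?L = "\<lambda>h. T z (band_op (linear_kernel h) x)"
  have "?L (h + h') = ?L h + ?L h'" for h h'
    unfolding T_add[symmetric]
    by (rule arg_cong[of _ _ "T z"])
      (rule band_op_add_kernel[OF band_bounded_linear_kernel band_bounded_linear_kernel linear_kernel_linear(1)])
  moreover have "?L (c *s h) = smul c (?L h)" for c h
    unfolding T_scale[symmetric]
    by (rule arg_cong[of _ _ "T z"])
      (rule band_op_scale_kernel[OF band_bounded_linear_kernel linear_kernel_linear(2)])
  ultimately show "Vector_Spaces.linear vector_scalar_mult smul ?L"
    unfolding Vector_Spaces.linear_iff using vec.vector_space_axioms vector_space_axioms by blast
  obtain C where C: "C \<ge> 1" "\<And>d y. y \<in> B d \<Longrightarrow> T z y \<in> B (C * d)" using T_disc by blast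
  define W where "W = C * (p x * weight_sum 2)"
  let ?D = "\<lambda>h. smul (inverse (of_real (norm h))) (T (z + h) x - T z x - ?L h)"
  have D: "?D h \<in> B (W * norm h)" if h: "norm h \<le> 1" for h
  proof -
    have "band_op (shift_kernel h) x =
        band_op (\<lambda>n m. shift_kernel h n m - linear_kernel h n m) x + band_op (linear_kernel h) x"
      by (rule band_op_add_kernel[OF band_bounded_remainder[OF h] band_bounded_linear_kernel]) simp
    then have "T h x - x - band_op (linear_kernel h) x =
        band_op (\<lambda>n m. shift_kernel h n m - linear_kernel h n m) x" by (simp add: T_def)
    moreover have "T (z + h) x - T z x - ?L h = T z (T h x - x - band_op (linear_kernel h) x)"
      using T_group'[of h z x] by (simp add: T_diff add.commute)
    ultimately have "T (z + h) x - T z x - ?L h \<in> B (C * (p x * norm h ^ 2 * weight_sum 2))"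
      using C(2)[OF band_op_sums_disc(2)[OF band_bounded_remainder[OF h]]] by simp
    then show ?thesis
    proof (rule disc_scale_le)
      show "norm (inverse (of_real (norm h)) :: 'k) * (C * (p x * norm h ^ 2 * weight_sum 2)) \<le> W * norm h"
      proof -
        have eq: "norm (inverse (of_real (norm h)) :: 'k) = inverse (norm h)"
          by (simp add: norm_inverse)
        \<comment> \<open>At \<open>h = 0\<close> both sides vanish because
          \<open>inverse 0 = 0\<close>.\<close>
        show ?thesis unfolding eq
          by (cases "h = 0") (simp_all add: W_def power2_eq_square field_simps)
      qed
    qed
  qed
  show "(?D \<longlongrightarrow> 0) (at 0)"
  proof (rule tendsto_cont_seminormI)
    fix q assume q: "cont_seminorm smul q"
    have s: "seminorm smul q" using q by (simp add: cont_seminorm_def)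
    obtain K where K: "K \<ge> 0" "\<And>d y. y \<in> B d \<Longrightarrow> q y \<le> K * d" using disc_bounded[OF q] by blast
    have "((\<lambda>h :: 'k ^ 'n. K * (W * norm h)) \<longlongrightarrow> K * (W * norm (0 :: 'k ^ 'n))) (at 0)"
      by (intro tendsto_intros)
    then have lim: "((\<lambda>h :: 'k ^ 'n. K * (W * norm h)) \<longlongrightarrow> 0) (at 0)" by simp
    have "eventually (\<lambda>h :: 'k ^ 'n. norm h < 1) (at 0)"
      using eventually_at_ball[of 1 "0 :: 'k ^ 'n" UNIV] by (auto elim!: eventually_mono)
    then have "eventually (\<lambda>h. q (?D h - 0) \<le> K * (W * norm h)) (at 0)"
    proof (rule eventually_mono)
      fix h :: "'k ^ 'n" assume "norm h < 1"
      then have "?D h \<in> B (W * norm h)" by (intro D) simp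
      then show "q (?D h - 0) \<le> K * (W * norm h)" unfolding diff_zero by (rule K(2))
    qed
    from tendsto_sandwich[OF _ this tendsto_const lim]
    show "((\<lambda>h. q (?D h - 0)) \<longlongrightarrow> 0) (at 0)" by (simp add: seminorm_nonneg[OF s])
  qed
qed

end

text \<open>Stated for a general scalar field to treat the real and the complex case together;
  second countability supplies the countable dense set of scalars for the targets. The
  differentiability clause makes sense over either field and is holomorphy over the complex
  numbers.\<close>

lemma class_M_group:
  fixes smul :: "'k::{real_normed_field, banach, second_countable_topology} \<Rightarrow>
    'x::{t2_space, topological_ab_group_add} \<Rightarrow> 'x"
  assumes M: "class_M smul" and nf: "norming_functionals smul"
  shows "\<exists>T :: 'k ^ 'n \<Rightarrow> 'x \<Rightarrow> 'x.
    operator_group smul T \<and> uniformly_continuous_group T \<and>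
    hereditarily_hypercyclic T \<and> mixing_group T \<and>
    (\<forall>x z. \<exists>L. Vector_Spaces.linear vector_scalar_mult smul L \<and>
      ((\<lambda>h. smul (inverse (of_real (norm h))) (T (z + h) x - T z x - L h)) \<longlongrightarrow> 0) (at 0))"
proof -
  have lcs: "locally_convex_space smul" and nw: "\<not> weak_topology smul"
    using M by (simp_all add: class_M_def)
  interpret locally_convex_space smul by (rule lcs)
  obtain x where x: "ell1_sequence smul x" "closure (span (range x)) = UNIV"
    using M unfolding class_M_def by (elim conjE exE)
  interpret banach_disc smul "ell1_disc smul x"
    by (rule banach_disc_ell1_disc[OF lcs x(1)])
  have x_span: "range x \<subseteq> disc_span" by (auto intro: disc_spanI[OF ell1_disc_member])
  obtain p where p: "cont_seminorm smul p"
    and inf: "\<forall>F. finite F \<longrightarrow> (\<forall>f\<in>F. Vector_Spaces.linear smul (*) f \<and> continuous_on UNIV f) \<longrightarrow>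
      (\<exists>z. (\<forall>f\<in>F. f z = 0) \<and> p z \<noteq> 0)"
    using not_weak_seminorm[OF nw nf] by (elim exE conjE)
  have "\<exists>(Y :: nat \<Rightarrow> 'x) f. range Y \<subseteq> disc_span \<and> (\<forall>n. Vector_Spaces.linear smul (*) (f n)) \<and>
    (\<forall>n v. norm (f n v) \<le> p v) \<and> (\<forall>n m. f n (Y m) = 0 \<longleftrightarrow> n \<noteq> m) \<and>
    closure (span (range Y)) = UNIV"
  proof (rule biorthogonal_system[OF nf p _ x(2) x_span])
    fix F :: "('x \<Rightarrow> 'k) set"
    assume F: "finite F" "\<And>f. f \<in> F \<Longrightarrow> Vector_Spaces.linear smul (*) f"
      "\<And>f. f \<in> F \<Longrightarrow> continuous_on UNIV f"
    then have "\<forall>f\<in>F. Vector_Spaces.linear smul (*) f \<and> continuous_on UNIV f" by simp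
    with spec[OF inf, of F] F(1) show "\<exists>z. (\<forall>f\<in>F. f z = 0) \<and> p z \<noteq> 0" by (elim impE)
  qed
  then obtain Y :: "nat \<Rightarrow> 'x" and f where Y: "range Y \<subseteq> disc_span" "\<forall>n. Vector_Spaces.linear smul (*) (f n)"
    "\<forall>n v. norm (f n v) \<le> p v" "\<forall>n m. f n (Y m) = 0 \<longleftrightarrow> n \<noteq> m" "closure (span (range Y)) = UNIV"
    by (elim exE conjE)
  have "\<exists>(u :: ('n \<Rightarrow> nat) \<Rightarrow> 'x) g p r \<rho> w e. monomial_system smul (ell1_disc smul x) u g p r \<rho> w e"
    by (rule monomial_system_exists[OF p Y(1) spec[OF Y(2)] _ _ Y(5)]) (simp_all only: Y(3,4))
  then obtain u :: "('n \<Rightarrow> nat) \<Rightarrow> 'x" and g p r \<rho> w e where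
    "monomial_system smul (ell1_disc smul x) u g p r \<rho> w e" by (elim exE)
  then interpret monomial_system smul "ell1_disc smul x" u g p r \<rho> w e .
  obtain D :: "'k set" where D: "countable D" "\<And>X. open X \<Longrightarrow> X \<noteq> {} \<Longrightarrow> \<exists>d\<in>D. d \<in> X"
    using countable_dense_setE[where 'a = 'k] by metis
  have "\<exists>d\<in>D. norm (d - c) < \<epsilon>" if "\<epsilon> > 0" for c \<epsilon>
    using D(2)[of "ball c \<epsilon>"] that by (auto simp: dist_norm norm_minus_commute)
  then have "hereditarily_hypercyclic T" by (rule T_hereditarily_hypercyclic[OF D(1)])
  then show ?thesis
    by (intro exI[of _ T] conjI allI T_operator_group T_uniformly_continuous T_mixing T_differentiable)
qed

theorem theorem1p3:
  shows "(\<forall>smul :: real \<Rightarrow> 'x::{t2_space, topological_ab_group_add} \<Rightarrow> 'x.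
      class_M smul \<longrightarrow>
        (\<exists>T :: real ^ 'n \<Rightarrow> 'x \<Rightarrow> 'x.
          operator_group smul T \<and> uniformly_continuous_group T \<and>
          hereditarily_hypercyclic T \<and> mixing_group T)) \<and>
    (\<forall>smul :: complex \<Rightarrow> 'x \<Rightarrow> 'x.
      class_M smul \<longrightarrow>
        (\<exists>T :: complex ^ 'n \<Rightarrow> 'x \<Rightarrow> 'x.
          operator_group smul T \<and> uniformly_continuous_group T \<and>
          hereditarily_hypercyclic T \<and> mixing_group T \<and>
          (\<forall>x. entire_map smul (\<lambda>z. T z x))))"
proof (intro conjI allI impI)
  have vs: "vector_space smul" if "class_M smul"
    for smul :: "'k::real_normed_field \<Rightarrow> 'x \<Rightarrow> 'x"
    using that
    by (simp add: class_M_def locally_convex_space_def topological_vector_space_def)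
  {
    fix smul :: "real \<Rightarrow> 'x \<Rightarrow> 'x" assume "class_M smul"
    from class_M_group[OF this norming_functionals_real, OF vs[OF this], where 'n = 'n]
    show "\<exists>T :: real ^ 'n \<Rightarrow> 'x \<Rightarrow> 'x. operator_group smul T \<and> uniformly_continuous_group T \<and>
        hereditarily_hypercyclic T \<and> mixing_group T"
      by (elim exE conjE) (intro exI conjI)
  next
    fix smul :: "complex \<Rightarrow> 'x \<Rightarrow> 'x" assume "class_M smul"
    from class_M_group[OF this norming_functionals_complex, OF vs[OF this], where 'n = 'n]
    show "\<exists>T :: complex ^ 'n \<Rightarrow> 'x \<Rightarrow> 'x. operator_group smul T \<and> uniformly_continuous_group T \<and>
        hereditarily_hypercyclic T \<and> mixing_group T \<and> (\<forall>x. entire_map smul (\<lambda>z. T z x))"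
      unfolding entire_map_def .
  }
qed

end
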